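(* Let $\omega>0$ and suppose $\Theta_\omega$ is a meromorphic inner function in $\mathbb{C}^+$. For compactly supported smooth functions $f$ on $(0,\infty)$ define $$(\tilde{\mathsf{H}}_\omega f)(x)=\sqrt{x}\,\frac{d}{dx}\Big(\sqrt{x}\int_0^\infty h_\omega^{\langle1\rangle}(xy)f(y)\,dy\Big).$$ Then $\tilde{\mathsf{H}}_\omega f$ belongs to $L^2((0,\infty),dx)$, and $f\mapsto\tilde{\mathsf{H}}_\omega f$ extends to an isometry of $L^2((0,\infty),dx)$ which coincides with $\mathsf{H}_\omega$.
   Context: $\xi(s)=\frac12 s(s-1)\pi^{-s/2}\Gamma(s/2)\zeta(s)$; $\Theta_\omega(z)=\xi(\tfrac12-\omega-iz)/\xi(\tfrac12+\omega-iz)$. A meromorphic inner function in $\mathbb{C}^+$ is a function meromorphic on $\mathbb{C}$, bounded and analytic in $\{\Im z>0\}$, with boundary values of modulus $1$ a.e. on $\mathbb{R}$. For $n\in\mathbb{N}$, $c_\omega(n)=n^{\omega}\sum_{d\mid n}\mu(d)d^{-2\omega}$; $g_\omega(x)=\frac{2\pi^\omega}{\Gamma(\omega)}\big(x^{2-\omega}(1-x^2)^{\omega-1}-\omega x^{\omega-1}\int_{x^2}^1 t^{\frac12-\omega}(1-t)^{\omega-1}dt\big)$ for $0<x<1$, $g_\omega(x)=0$ for $x>1$; $h_\omega(x)=\frac1x\sum_{n=1}^{\lfloor x\rfloor}c_\omega(n)g_\omega(n/x)$ for $x>1$, $h_\omega=0$ on $(0,1)$; $g_\omega^{\langle1\rangle}(x)=\int_x^1\sqrt{y/x}\,g_\omega(y)\frac{dy}{y}$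 for $0<x<1$, $0$ for $x>1$; $h_\omega^{\langle1\rangle}(x)=\frac1x\sum_{n=1}^{\lfloor x\rfloor}c_\omega(n)g_\omega^{\langle1\rangle}(n/x)$ for $x>1$, $0$ for $0<x<1$. When $\Theta_\omega$ is inner, $\mathsf{H}_\omega$ denotes the isometry of $L^2((0,\infty),dx)$ obtained as the continuous extension of $f\mapsto\int_0^\infty h_\omega(xy)f(y)\,dy$ from compactly supported smooth $f$. *)

theory Defs
  imports "HOL-Complex_Analysis.Complex_Analysis" "HOL-Computational_Algebra.Squarefree"
begin

text \<open>The completed zeta function xi(s) = 1/2 s(s-1) pi^(-s/2) Gamma(s/2) zeta(s) is entire;
  we define it as the unique entire function agreeing with the Dirichlet-series formula
  on the half plane Re s > 1 (uniqueness by the identity theorem).\<close>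

definition xi :: "complex \<Rightarrow> complex" where
  "xi = (THE F. F holomorphic_on UNIV \<and>
      (\<forall>s. 1 < Re s \<longrightarrow>
         F s = 1/2 * s * (s - 1) * (of_real pi) powr (- s / 2) * Gamma (s / 2)
               * (\<Sum>n. (of_nat (Suc n)) powr (- s))))"

definition Theta :: "real \<Rightarrow> complex \<Rightarrow> complex" where
  "Theta \<omega> z = xi (1/2 - of_real \<omega> - \<i> * z) / xi (1/2 + of_real \<omega> - \<i> * z)"

definition upper_half :: "complex set" where
  "upper_half = {z. 0 < Im z}"

definition meromorphic_inner :: "(complex \<Rightarrow> complex) \<Rightarrow> bool" where
  "meromorphic_inner F \<longleftrightarrow>
     F meromorphic_on UNIV \<and>
     (\<exists>G. G holomorphic_on upper_half \<and> bounded (G ` upper_half) \<and>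
          (\<forall>z\<in>upper_half. \<forall>\<^sub>F w in at z. F w = G w) \<and>
          (AE x in lborel. \<exists>c. (G \<longlongrightarrow> c) (at (complex_of_real x) within upper_half)
                                \<and> cmod c = 1))"

definition moebius :: "nat \<Rightarrow> int" where
  "moebius d = (if squarefree d then (-1) ^ card (prime_factors d) else 0)"

definition c_coef :: "real \<Rightarrow> nat \<Rightarrow> real" where
  "c_coef \<omega> n = real n powr \<omega> * (\<Sum>d | d dvd n. real_of_int (moebius d) * real d powr (-2 * \<omega>))"

definition g_fun :: "real \<Rightarrow> real \<Rightarrow> real" where
  "g_fun \<omega> x = (if 0 < x \<and> x < 1 then
      2 * pi powr \<omega> / Gamma \<omega> *
        (x powr (2 - \<omega>) * (1 - x\<^sup>2) powr (\<omega> - 1)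
         - \<omega> * x powr (\<omega> - 1) *
           set_lebesgue_integral lborel {x\<^sup>2..1} (\<lambda>t. t powr (1/2 - \<omega>) * (1 - t) powr (\<omega> - 1)))
     else 0)"

definition h_fun :: "real \<Rightarrow> real \<Rightarrow> real" where
  "h_fun \<omega> x = (if 1 < x then
      (1 / x) * (\<Sum>n=1..nat \<lfloor>x\<rfloor>. c_coef \<omega> n * g_fun \<omega> (real n / x)) else 0)"

definition g1_fun :: "real \<Rightarrow> real \<Rightarrow> real" where
  "g1_fun \<omega> x = (if 0 < x \<and> x < 1 then
      set_lebesgue_integral lborel {x..1} (\<lambda>y. sqrt (y / x) * g_fun \<omega> y / y)
     else 0)"

definition h1_fun :: "real \<Rightarrow> real \<Rightarrow> real" where
  "h1_fun \<omega> x = (if 1 < x then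
      (1 / x) * (\<Sum>n=1..nat \<lfloor>x\<rfloor>. c_coef \<omega> n * g1_fun \<omega> (real n / x)) else 0)"

abbreviation posline :: "real measure" where
  "posline \<equiv> lebesgue_on {0<..}"

definition L2pos :: "(real \<Rightarrow> complex) \<Rightarrow> bool" where
  "L2pos g \<longleftrightarrow> g \<in> borel_measurable posline \<and> integrable posline (\<lambda>x. (cmod (g x))\<^sup>2)"

definition L2norm :: "(real \<Rightarrow> complex) \<Rightarrow> real" where
  "L2norm g = sqrt (\<integral>x. (cmod (g x))\<^sup>2 \<partial>posline)"

definition vderiv :: "(real \<Rightarrow> complex) \<Rightarrow> real \<Rightarrow> complex" where
  "vderiv f x = vector_derivative f (at x)"

definition test_fun :: "(real \<Rightarrow> complex) \<Rightarrow> bool" where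
  "test_fun f \<longleftrightarrow> (\<exists>a b. 0 < a \<and> a \<le> b \<and> (\<forall>x. x \<notin> {a..b} \<longrightarrow> f x = 0)) \<and>
     (\<forall>n. \<forall>x>0. (vderiv ^^ n) f differentiable (at x))"

definition int_op :: "(real \<Rightarrow> real) \<Rightarrow> (real \<Rightarrow> complex) \<Rightarrow> real \<Rightarrow> complex" where
  "int_op k f x = (\<integral>y. complex_of_real (k (x * y)) * f y \<partial>posline)"

definition Htilde_pre :: "real \<Rightarrow> (real \<Rightarrow> complex) \<Rightarrow> real \<Rightarrow> complex" where
  "Htilde_pre \<omega> f x = complex_of_real (sqrt x) * int_op (h1_fun \<omega>) f x"

definition Htilde :: "real \<Rightarrow> (real \<Rightarrow> complex) \<Rightarrow> real \<Rightarrow> complex" where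
  "Htilde \<omega> f x = complex_of_real (sqrt x) * vderiv (Htilde_pre \<omega> f) x"

end

theory Submission
  imports Defs "HOL-Probability.Probability"
begin

text \<open>
  Substituting \<open>x = exp t\<close> turns the kernels into convolution kernels on the real line. For \<open>Re w\<close> large,
  \<open>\<integral> h_fun \<omega> x * x powr (- w) dx = xi (w - \<omega>) / xi (w + \<omega>)\<close>: the Dirichlet series of \<open>c_coef \<omega>\<close>
  contributes \<open>zeta (w - \<omega>) / zeta (w + \<omega>)\<close> and the Mellin transform of \<open>g_fun \<omega>\<close> is a Beta integral
  contributing the remaining factors. With \<open>w = 1/2 - \<i> * z\<close> this quotient is \<open>Theta \<omega> z\<close>. For \<open>h1_fun\<close> the
  transform acquires the extra factor \<open>1 / (w - 1/2)\<close>, which the differential operator in \<open>Htilde\<close> cancels; hence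
  \<open>Htilde \<omega> f = int_op (h_fun \<omega>) f\<close> pointwise for test functions \<open>f\<close>.

  Fourier inversion writes \<open>int_op (h_fun \<omega>) f\<close> as an integral over a vertical line far to the right. As
  \<open>Theta \<omega>\<close> is bounded and holomorphic in the upper half plane, the line can be moved to \<open>Re w = \<sigma>\<close> for every
  \<open>\<sigma> > 1/2\<close>. Plancherel on that line, the limit \<open>\<sigma> \<longrightarrow> 1/2\<close> and \<open>\<bar>Theta \<omega>\<bar> = 1\<close> almost everywhere on the boundary
  show that \<open>int_op (h_fun \<omega>)\<close> is isometric on test functions, which are dense in the complete space
  \<open>L\<^sup>2(0, \<infinity>)\<close>.
\<close>

section \<open>Laplace integrals of bounded functions\<close>

text \<open>Two definitions shape the work. \<open>xi\<close> is a definite description, so an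
  entire continuation must be built before anything can be said about it. When the Bose integral for
  \<open>Gamma s * zeta s\<close> is cut at 1, poles arise only at 1, 0 and the negative odd
  integers, because \<open>x / (exp x - 1) + x / 2\<close> is even; duplication trades
  \<open>Gamma (s / 2)\<close> for \<open>Gamma s * rGamma ((s + 1) / 2)\<close>, up to elementary
  factors, and the zeros of this \<open>rGamma\<close> lie exactly at the negative odd integers.
  \<open>meromorphic_inner\<close>, on the other hand, supplies a bounded holomorphic function that
  agrees with \<open>Theta \<omega>\<close> around each point but perhaps not at it. Comparison with
  the kernel transform is therefore made on a real ray, where every factor is an explicit real
  number, and spread by the identity theorem. The multiplier is merely bounded, so decay on vertical
  lines has to come from the test function: two derivatives give a quadratic rate.\<close>

lemma norm_integral_le_integral:
  fixes f :: "'a \<Rightarrow> 'b::{banach, second_countable_topology}"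
  assumes g: "integrable M g" and le: "\<And>x. x \<in> space M \<Longrightarrow> norm (f x) \<le> g x"
  shows "norm (integral\<^sup>L M f) \<le> integral\<^sup>L M g"
proof (cases "integrable M f")
  case True
  have "norm (integral\<^sup>L M f) \<le> (\<integral>x. norm (f x) \<partial>M)" by (rule integral_norm_bound)
  also have "\<dots> \<le> integral\<^sup>L M g" using True g le by (intro integral_mono integrable_norm)
  finally show ?thesis .
next
  case False
  have "0 \<le> integral\<^sup>L M g" using le by (intro integral_nonneg_AE AE_I2) (meson norm_ge_zero order_trans)
  \<comment> \<open>A non-integrable function has integral 0 by convention.\<close>
  thus ?thesis using False by (simp add: not_integrable_integral_eq)
qed

text \<open>The exponential series from degree 2 on is compared termwise with
  \<open>(norm z)\<^sup>2 * exp (norm z)\<close>, using \<open>fact n \<le> fact (n + 2)\<close>.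
  This second-order remainder makes Laplace integrals differentiable with one explicit error
  bound.\<close>

lemma norm_exp_minus_one_minus_le:
  fixes z :: complex
  shows "norm (exp z - 1 - z) \<le> (norm z)\<^sup>2 * exp (norm z)"
proof -
  have s: "(\<lambda>n. z ^ n /\<^sub>R fact n) sums exp z"
    by (rule exp_converges)
  have s2: "(\<lambda>n. z ^ (n + 2) /\<^sub>R fact (n + 2)) sums (exp z - 1 - z)"
    using sums_split_initial_segment[OF s, of 2] by (simp add: numeral_2_eq_2 algebra_simps)
  have s3: "(\<lambda>n. (norm z)\<^sup>2 * (norm z ^ n /\<^sub>R fact n)) sums ((norm z)\<^sup>2 * exp (norm z))"
    by (intro sums_mult exp_converges)
  have le: "norm (z ^ (n + 2) /\<^sub>R fact (n + 2)) \<le> (norm z)\<^sup>2 * (norm z ^ n /\<^sub>R fact n)" for n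
  proof -
    have "(fact n :: real) \<le> fact (n + 2)" by (rule fact_mono) simp
    hence "norm z ^ (n + 2) / fact (n + 2) \<le> norm z ^ (n + 2) / fact n"
      by (intro divide_left_mono) auto
    thus ?thesis by (simp add: norm_mult norm_power power_add divide_inverse mult_ac power2_eq_square del: fact_Suc)
  qed
  have "norm (exp z - 1 - z) \<le> (\<Sum>n. (norm z)\<^sup>2 * (norm z ^ n /\<^sub>R fact n))"
    unfolding sums_unique[OF s2]
    using le sums_summable[OF s3] by (intro norm_suminf_le) (auto simp del: fact_Suc)
  thus ?thesis using s3 by (simp add: sums_iff)
qed

text \<open>A single term of the exponential series already dominates. The lemma lets any power be
  absorbed at the price of an arbitrarily small exponential rate.\<close>

lemma exp_ge_power_div:
  assumes "0 < d"
  shows "\<exists>C. \<forall>t\<ge>0. (t::real) ^ n \<le> C * exp (d * t)"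
proof (intro exI allI impI)
  fix t :: real assume t: "t \<ge> 0"
  have "(d * t) ^ n / fact n \<le> exp (d * t)"
    using t assms sum_le_suminf[OF sums_summable[OF exp_converges[of "d*t"]], of "{n}"]
    by (simp add: exp_def divide_inverse mult_ac)
  thus "t ^ n \<le> (fact n / d ^ n) * exp (d * t)"
    using assms by (simp add: field_simps power_mult_distrib)
qed

text \<open>Convergence on an open half plane leaves room to the left of every point, so all moments
  in \<tau> converge as well and the candidate derivative exists. The difference quotient then
  misses it by at most \<open>norm h * K\<close>. An arbitrary measure and a nonnegative phase
  \<tau> allow the same lemma to serve for zeta, for test functions and for kernels.\<close>

lemma holomorphic_on_laplace_integral:
  fixes \<phi> :: "'a \<Rightarrow> complex" and \<tau> :: "'a \<Rightarrow> real"
  assumes \<phi> [measurable]: "\<phi> \<in> borel_measurable M" and \<tau> [measurable]: "\<tau> \<in> borel_measurable M"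
    and nonneg: "\<And>x. x \<in> space M \<Longrightarrow> 0 \<le> \<tau> x"
    and int: "\<And>\<sigma>. \<sigma> > \<sigma>0 \<Longrightarrow> integrable M (\<lambda>x. norm (\<phi> x) * exp (- \<sigma> * \<tau> x))"
  shows "(\<lambda>s. \<integral>x. \<phi> x * exp (- s * \<tau> x) \<partial>M) holomorphic_on {s. Re s > \<sigma>0}"
proof -
  have meas_exp: "(\<lambda>x. exp (- s * complex_of_real (\<tau> x))) \<in> borel_measurable M" for s :: complex
    by (auto intro!: borel_measurable_continuous_on[of exp] continuous_intros)
  have intk: "integrable M (\<lambda>x. norm (\<phi> x) * \<tau> x ^ n * exp (- \<sigma> * \<tau> x))" if "\<sigma> > \<sigma>0" for \<sigma> n
  proof -
    \<comment> \<open>Half of the margin above \<sigma>0 pays for the power of \<tau>; the other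
      half keeps the exponent admissible.\<close>
    define d where "d = (\<sigma> - \<sigma>0) / 2"
    have d: "d > 0" "\<sigma> - d > \<sigma>0" using that by (auto simp: d_def field_simps)
    obtain C where C: "\<And>t. t \<ge> 0 \<Longrightarrow> t ^ n \<le> C * exp (d * t)" using exp_ge_power_div[OF d(1), of n] by blast
    show ?thesis
    proof (rule Bochner_Integration.integrable_bound[OF integrable_mult_right[OF int[OF d(2)], of C]])
      show "AE x in M. norm (norm (\<phi> x) * \<tau> x ^ n * exp (- \<sigma> * \<tau> x)) \<le> norm (C * (norm (\<phi> x) * exp (- (\<sigma> - d) * \<tau> x)))"
      proof (rule AE_I2)
        fix x assume x: "x \<in> space M"
        have "norm (\<phi> x) * \<tau> x ^ n * exp (- \<sigma> * \<tau> x) \<le> norm (\<phi> x) * (C * exp (d * \<tau> x)) * exp (- \<sigma> * \<tau> x)"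
          by (intro mult_right_mono mult_left_mono C nonneg x) auto
        also have "\<dots> = C * (norm (\<phi> x) * exp (- (\<sigma> - d) * \<tau> x))"
          by (simp add: algebra_simps flip: exp_add)
        finally show "norm (norm (\<phi> x) * \<tau> x ^ n * exp (- \<sigma> * \<tau> x)) \<le> norm (C * (norm (\<phi> x) * exp (- (\<sigma> - d) * \<tau> x)))"
          using nonneg[OF x] by (simp only: real_norm_def) (rule abs_leI, auto intro: order_trans[OF _ abs_ge_self] order_trans[OF _ abs_ge_zero])
      qed
    qed measurable
  qed
  have intc: "integrable M (\<lambda>x. \<phi> x * of_real (\<tau> x ^ n) * exp (- s * \<tau> x))" if "Re s > \<sigma>0" for s :: complex and n
    by (rule Bochner_Integration.integrable_bound[OF intk[OF that, of n]])
       (use meas_exp nonneg in \<open>auto simp: norm_mult norm_power intro!: AE_I2\<close>)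
  have "((\<lambda>s. \<integral>x. \<phi> x * exp (- s * \<tau> x) \<partial>M) has_field_derivative (- (\<integral>x. \<phi> x * of_real (\<tau> x ^ 1) * exp (- s * \<tau> x) \<partial>M))) (at s)"
    (is "(?L has_field_derivative - ?D s) _") if s: "Re s > \<sigma>0" for s :: complex
  proof -
    \<comment> \<open>An increment of norm below d costs at most a factor
      \<open>exp (d * \<tau> x)\<close>, so one constant K covers all of them.\<close>
    define d where "d = (Re s - \<sigma>0) / 2"
    have d: "d > 0" "Re s - d > \<sigma>0" using s by (auto simp: d_def field_simps)
    define K where "K = (\<integral>x. norm (\<phi> x) * \<tau> x ^ 2 * exp (- (Re s - d) * \<tau> x) \<partial>M)"
    have bound: "norm (?L (s + h) - ?L s + h * ?D s) \<le> norm h ^ 2 * K" if h: "norm h < d" for h :: complex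
    proof -
      have "Re (s + h) > \<sigma>0" using h d abs_Re_le_cmod[of h] by auto
      note i = intc[OF this, of 0, simplified] intc[OF s, of 0, simplified] intc[OF s, of 1, simplified]
      have pt: "p * exp (- (s + h) * t) - p * exp (- s * t) + h * (p * t * exp (- s * t))
          = p * exp (- s * t) * (exp (- h * t) - 1 - (- h * t))" for p :: complex and t :: real
      proof -
        have e: "- (s + h) * t = - s * t + - h * t" by (simp add: algebra_simps)
        show ?thesis unfolding e exp_add by (simp add: algebra_simps)
      qed
      have eq: "?L (s + h) - ?L s + h * ?D s
          = (\<integral>x. \<phi> x * exp (- s * \<tau> x) * (exp (- h * \<tau> x) - 1 - (- h * \<tau> x)) \<partial>M)"
      proof -
        have "?L (s + h) - ?L s + h * ?D s = (\<integral>x. (\<phi> x * exp (- (s + h) * \<tau> x) - \<phi> x * exp (- s * \<tau> x))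
            + h * (\<phi> x * of_real (\<tau> x ^ 1) * exp (- s * \<tau> x)) \<partial>M)"
          using i by (subst Bochner_Integration.integral_add Bochner_Integration.integral_diff; simp)+
        also have "\<dots> = (\<integral>x. \<phi> x * exp (- s * \<tau> x) * (exp (- h * \<tau> x) - 1 - (- h * \<tau> x)) \<partial>M)"
          by (simp only: power_one_right pt)
        finally show ?thesis .
      qed
      have "norm (?L (s + h) - ?L s + h * ?D s) \<le> (\<integral>x. norm h ^ 2 * (norm (\<phi> x) * \<tau> x ^ 2 * exp (- (Re s - d) * \<tau> x)) \<partial>M)"
        unfolding eq
      proof (rule norm_integral_le_integral[OF integrable_mult_right[OF intk[OF d(2), of 2]]])
        fix x assume x: "x \<in> space M"
        have "norm (exp (- h * \<tau> x) - 1 - (- h * \<tau> x)) \<le> (norm (- h * \<tau> x))\<^sup>2 * exp (norm (- h * \<tau> x))"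
          by (rule norm_exp_minus_one_minus_le)
        also have "\<dots> \<le> (norm h)\<^sup>2 * \<tau> x ^ 2 * exp (d * \<tau> x)"
          using h nonneg[OF x] by (auto simp: norm_mult power_mult_distrib intro!: mult_left_mono mult_right_mono)
        finally have "norm (\<phi> x) * exp (- Re s * \<tau> x) * norm (exp (- h * \<tau> x) - 1 - (- h * \<tau> x))
             \<le> norm (\<phi> x) * exp (- Re s * \<tau> x) * ((norm h)\<^sup>2 * \<tau> x ^ 2 * exp (d * \<tau> x))"
          by (intro mult_left_mono) auto
        also have "\<dots> = norm h ^ 2 * (norm (\<phi> x) * \<tau> x ^ 2 * exp (- (Re s - d) * \<tau> x))"
          by (simp add: algebra_simps flip: exp_add)
        finally show "norm (\<phi> x * exp (- s * \<tau> x) * (exp (- h * \<tau> x) - 1 - (- h * \<tau> x))) 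
            \<le> norm h ^ 2 * (norm (\<phi> x) * \<tau> x ^ 2 * exp (- (Re s - d) * \<tau> x))"
          by (simp add: norm_mult)
      qed
      thus ?thesis by (simp add: K_def)
    qed
    have K0: "K \<ge> 0" unfolding K_def by (intro integral_nonneg_AE AE_I2) auto
    show ?thesis
      unfolding has_field_derivative_def has_derivative_at
    proof (intro conjI bounded_linear_mult_right)
      show "((\<lambda>h. norm (?L (s + h) - ?L s - (- ?D s) * h) / norm h) \<longlongrightarrow> 0) (at 0)"
      proof (rule Lim_null_comparison)
        show "\<forall>\<^sub>F h in at 0. norm (norm (?L (s + h) - ?L s - (- ?D s) * h) / norm h) \<le> norm h * K"
          unfolding eventually_at
        proof (intro exI[of _ d] conjI d ballI impI)
          fix h :: complex assume "h \<in> UNIV" "h \<noteq> 0 \<and> dist h 0 < d"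
          hence "norm (?L (s + h) - ?L s + h * ?D s) \<le> norm h ^ 2 * K" "h \<noteq> 0" using bound[of h] by auto
          thus "norm (norm (?L (s + h) - ?L s - (- ?D s) * h) / norm h) \<le> norm h * K"
            by (simp add: field_simps power2_eq_square)
        qed
        show "((\<lambda>h::complex. norm h * K) \<longlongrightarrow> 0) (at 0)" by (auto intro!: tendsto_eq_intros)
      qed
    qed
  qed
  thus ?thesis
    by (auto simp: holomorphic_on_def field_differentiable_def intro: has_field_derivative_at_within)
qed
lemma holomorphic_on_laplace_integral_UNIV:
  fixes \<phi> :: "'a \<Rightarrow> complex" and \<tau> :: "'a \<Rightarrow> real"
  assumes "\<phi> \<in> borel_measurable M" "\<tau> \<in> borel_measurable M"
    and "\<And>x. x \<in> space M \<Longrightarrow> 0 \<le> \<tau> x"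
    and "\<And>\<sigma>. integrable M (\<lambda>x. norm (\<phi> x) * exp (- \<sigma> * \<tau> x))"
  shows "(\<lambda>s. \<integral>x. \<phi> x * exp (- s * \<tau> x) \<partial>M) holomorphic_on UNIV"
proof -
  have "(\<lambda>s. \<integral>x. \<phi> x * exp (- s * \<tau> x) \<partial>M) holomorphic_on (\<Union>n::nat. {s. Re s > - real n})"
    by (intro holomorphic_on_UN_open holomorphic_on_laplace_integral assms open_halfspace_Re_gt)
  moreover have "(\<Union>n::nat. {s. Re s > - real n}) = UNIV"
  proof (intro equalityI subsetI UNIV_I)
    fix s :: complex
    obtain n :: nat where "real n > - Re s" using reals_Archimedean2 by blast
    thus "s \<in> (\<Union>n::nat. {s. Re s > - real n})" by (auto intro: exI[of _ n])
  qed
  ultimately show ?thesis by simp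
qed

section \<open>Entire continuation of the completed zeta function\<close>

text \<open>Euler's integral rescaled by c; the choice c = Suc n later produces the terms of the
  zeta series. Complex powers are written as exponentials of a real logarithm, so that they multiply
  by plain addition of exponents.\<close>

lemma Gamma_integral_exp_ln:
  fixes s :: complex
  assumes s: "Re s > 0" and c: "c > 0"
  shows "has_bochner_integral lborel (\<lambda>x. if 0 < x then exp ((s - 1) * of_real (ln x)) * of_real (exp (- c * x)) else 0)
           (Gamma s * exp (- s * of_real (ln c)))"
proof -
  let ?f = "\<lambda>x. if 0 < x then exp ((s - 1) * of_real (ln x)) * of_real (exp (- x)) else 0 :: complex"
  have eq: "indicator {0<..} x *\<^sub>R (of_real x powr (s - 1) / of_real (exp x)) = ?f x" for x :: real
    by (auto simp: indicator_def powr_def Ln_of_real exp_minus divide_inverse)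
  have abs: "(\<lambda>t. of_real t powr (s - 1) / of_real (exp t)) absolutely_integrable_on {0::real<..}"
    by (rule absolutely_integrable_Gamma_integral'[OF s])
  have i: "integrable lebesgue ?f"
    using abs unfolding set_integrable_def eq .
  have "(\<integral>x. ?f x \<partial>lebesgue) = Gamma s"
    using set_lebesgue_integral_eq_integral(2)[OF abs] integral_unique[OF Gamma_integral_complex'[OF s]]
    unfolding set_lebesgue_integral_def eq by simp
  hence "has_bochner_integral lborel ?f (Gamma s)"
    using i by (simp add: has_bochner_integral_iff integrable_completion integral_completion)
  hence "has_bochner_integral lborel (\<lambda>x. ?f (0 + c * x)) (Gamma s /\<^sub>R \<bar>c\<bar>)"
    using c lborel_has_bochner_integral_real_affine_iff[of c ?f "Gamma s" 0] by simp
  hence "has_bochner_integral lborel (\<lambda>x. exp (- (s - 1) * of_real (ln c)) * ?f (0 + c * x))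
          (exp (- (s - 1) * of_real (ln c)) * (Gamma s /\<^sub>R \<bar>c\<bar>))"
    by (rule has_bochner_integral_mult_right)
  moreover have "exp (- (s - 1) * of_real (ln c)) * ?f (0 + c * x)
      = (if 0 < x then exp ((s - 1) * of_real (ln x)) * of_real (exp (- c * x)) else 0)" for x
  proof -
    have "exp (- (s - 1) * of_real (ln c)) * exp ((s - 1) * (of_real (ln c) + of_real (ln x))) = exp ((s - 1) * of_real (ln x))"
      by (simp add: algebra_simps flip: exp_add)
    thus ?thesis using c by (auto simp: ln_mult zero_less_mult_iff)
  qed
  moreover have "exp (- (s - 1) * of_real (ln c)) * (Gamma s /\<^sub>R \<bar>c\<bar>) = Gamma s * exp (- s * of_real (ln c))"
  proof -
    have "exp (- (s - 1) * of_real (ln c)) = exp (- s * of_real (ln c)) * of_real c"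
    proof -
      have "exp (complex_of_real (ln c)) = of_real c" using c by (simp add: exp_of_real)
      thus ?thesis by (simp add: algebra_simps exp_add exp_diff exp_minus divide_inverse)
    qed
    thus ?thesis using c by (simp add: scaleR_conv_of_real)
  qed
  ultimately show ?thesis by simp
qed

section \<open>Zeta through the Bose integral and its splitting at 1\<close>

abbreviation zeta_series :: "complex \<Rightarrow> complex" where
  "zeta_series s \<equiv> (\<Sum>n. (of_nat (Suc n)) powr (- s))"

lemma Suc_powr_eq_exp: "(of_nat (Suc n) :: complex) powr (- s) = exp (- s * of_real (ln (real (Suc n))))"
  by (simp add: powr_def Ln_of_nat del: of_nat_Suc)

lemma summable_norm_zeta:
  assumes "Re s > 1"
  shows "summable (\<lambda>n. norm ((of_nat (Suc n)) powr (- s) :: complex))"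
proof -
  have "summable (\<lambda>n. real n powr (- Re s))"
    using assms by (simp add: summable_real_powr_iff)
  hence "summable (\<lambda>n. real (Suc n) powr (- Re s))" by (rule summable_Suc_iff[THEN iffD2])
  thus ?thesis unfolding Suc_powr_eq_exp by (simp add: powr_def)
qed

text \<open>Expanding \<open>1 / (exp x - 1)\<close> as a geometric series in
  \<open>exp (- x)\<close> and integrating termwise gives one rescaled Gamma integral per
  term.\<close>

lemma Gamma_times_zeta_series:
  assumes s: "Re s > 1"
  shows "has_bochner_integral lborel
     (\<lambda>x. if 0 < x then exp ((s - 1) * of_real (ln x)) / of_real (exp x - 1) else 0) (Gamma s * zeta_series s)"
proof -
  define f where "f = (\<lambda>n x. if 0 < x then exp ((s - 1) * of_real (ln x)) * of_real (exp (- real (Suc n) * x)) else 0 :: complex)"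
  have b: "has_bochner_integral lborel (f n) (Gamma s * (of_nat (Suc n)) powr (- s))" for n
    unfolding f_def Suc_powr_eq_exp using s by (intro Gamma_integral_exp_ln) auto
  \<comment> \<open>The norm of the integrand is the same integrand at the real point Re s, so
    summability of the integrated norms is again convergence of a zeta series.\<close>
  have nf: "(LBINT x. norm (f n x)) = norm (Gamma (of_real (Re s)) * (of_nat (Suc n)) powr (- of_real (Re s)) :: complex)" for n
  proof -
    have g: "has_bochner_integral lborel (\<lambda>x. if 0 < x then exp ((of_real (Re s) - 1) * of_real (ln x)) * of_real (exp (- real (Suc n) * x)) else 0)
       (Gamma (of_real (Re s)) * (of_nat (Suc n)) powr (- of_real (Re s)) :: complex)"
      unfolding Suc_powr_eq_exp using s by (intro Gamma_integral_exp_ln) auto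
    have e: "(if 0 < x then exp ((of_real (Re s) - 1) * of_real (ln x)) * of_real (exp (- real (Suc n) * x)) else 0 :: complex)
        = of_real (norm (f n x))" for x
      by (auto simp: f_def norm_mult norm_exp_eq_Re exp_of_real[symmetric])
    have "of_real (LBINT x. norm (f n x)) = Gamma (of_real (Re s)) * (of_nat (Suc n)) powr (- complex_of_real (Re s))"
      using g unfolding e by (simp add: has_bochner_integral_iff)
    hence "norm (complex_of_real (LBINT x. norm (f n x)))
        = norm (Gamma (of_real (Re s)) * (of_nat (Suc n)) powr (- complex_of_real (Re s)))"
      by (rule arg_cong[where f = norm])
    moreover have "(LBINT x. norm (f n x)) \<ge> 0" by simp
    ultimately show ?thesis by (simp only: norm_of_real abs_of_nonneg)
  qed
  have sumi: "summable (\<lambda>n. \<integral>x. norm (f n x) \<partial>lborel)"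
    unfolding nf norm_mult using s summable_norm_zeta[of "of_real (Re s)"] by (intro summable_mult) simp
  have ptw: "(\<lambda>n. f n x) sums (if 0 < x then exp ((s - 1) * of_real (ln x)) / of_real (exp x - 1) else 0)
     \<and> summable (\<lambda>n. norm (f n x))" for x
  proof (cases "0 < x")
    case True
    have "(\<lambda>n. exp (-x) * exp (-x) ^ n) sums (exp (-x) * (1 / (1 - exp (-x))))"
      using True by (intro sums_mult geometric_sums) auto
    hence "(\<lambda>n. exp (-x) ^ Suc n) sums (exp (-x) * (1 / (1 - exp (-x))))" by simp
    moreover have "exp (-x) * (1 / (1 - exp (-x))) = 1 / (exp x - 1)" using True by (simp add: exp_minus field_simps)
    ultimately have g: "(\<lambda>n. exp (- real (Suc n) * x)) sums (1 / (exp x - 1))"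
      by (simp add: exp_of_nat_mult[symmetric] mult.commute del: of_nat_Suc power_Suc)
    have "(\<lambda>n. exp ((s - 1) * of_real (ln x)) * of_real (exp (- real (Suc n) * x))) sums
        (exp ((s - 1) * of_real (ln x)) * of_real (1 / (exp x - 1)))"
      by (intro sums_mult sums_of_real g)
    moreover have "summable (\<lambda>n. norm (exp ((s - 1) * of_real (ln x))) * exp (- real (Suc n) * x))"
      by (intro summable_mult sums_summable[OF g])
    ultimately show ?thesis using True by (simp add: f_def norm_mult divide_inverse del: of_nat_Suc)
  qed (auto simp: f_def)
  have fi: "integrable lborel (f n)" for n using b by (simp add: has_bochner_integral_iff)
  have "AE x in lborel. summable (\<lambda>n. norm (f n x))" using ptw by simp
  hence "integrable lborel (\<lambda>x. \<Sum>n. f n x)" "(\<lambda>n. integral\<^sup>L lborel (f n)) sums (LBINT x. (\<Sum>n. f n x))"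
    using fi sumi by (auto intro: integrable_suminf sums_integral)
  moreover have "(\<Sum>n. f n x) = (if 0 < x then exp ((s - 1) * of_real (ln x)) / of_real (exp x - 1) else 0)" for x
    using ptw[of x] by (simp add: sums_iff)
  moreover have "(\<lambda>n. integral\<^sup>L lborel (f n)) sums (Gamma s * zeta_series s)"
    using b summable_norm_cancel[OF summable_norm_zeta[OF s]]
    by (auto simp: has_bochner_integral_iff intro!: sums_mult summable_sums)
  ultimately show ?thesis by (auto simp: has_bochner_integral_iff sums_iff)
qed

text \<open>Adding \<open>x / 2\<close> to \<open>x / (exp x - 1)\<close> removes the only odd term
  of its Bernoulli expansion. The absence of further odd powers keeps the poles of the continuation
  at places where \<open>rGamma ((s + 1) / 2)\<close> vanishes.\<close>

lemma even_expansion: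
  obtains a :: "nat \<Rightarrow> complex" where "summable (\<lambda>m. norm (a m))"
    "\<forall>x::real. 0 < x \<longrightarrow> x \<le> 1 \<longrightarrow> (\<lambda>m. a m * of_real x ^ (2 * m)) sums of_real (x / (exp x - 1) + x / 2)"
proof -
  define q0 :: "complex \<Rightarrow> complex" where "q0 = (\<lambda>z. z / (exp z - 1) + z / 2)"
  define q where "q = (\<lambda>z. if z = 0 then 1 else q0 z)"
  \<comment> \<open>The zeros of \<open>exp z - 1\<close> are the multiples of 2 pi i, and all but 0
    have norm above 6. The disc of radius 2 avoids them and still reaches beyond 1.\<close>
  have nz: "exp z \<noteq> 1" if "z \<noteq> 0" "norm z < 2" for z :: complex
  proof
    assume "exp z = 1"
    then obtain k :: int where k: "Re z = 0" "Im z = of_int (2 * k) * pi" by (auto simp: exp_eq_1)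
    have "norm z = \<bar>of_int (2 * k) * pi\<bar>" using k by (simp add: cmod_def)
    hence "2 * \<bar>of_int k\<bar> * pi < 2" using that by (simp add: abs_mult)
    moreover have "k \<noteq> 0" using k that by (auto simp: complex_eq_iff)
    hence "\<bar>real_of_int k\<bar> \<ge> 1" by linarith
    hence "2 * 1 * 3 \<le> 2 * \<bar>of_int k\<bar> * pi" using pi_gt3 by (intro mult_mono) auto
    ultimately show False by linarith
  qed
  have "q0 \<midarrow>0\<rightarrow> 1 / 1 + 0 / 2" 
  proof -
    have "(exp has_field_derivative 1) (at (0::complex))" by (auto intro!: derivative_eq_intros)
    hence "((\<lambda>h. (exp h - 1) / h) \<longlongrightarrow> 1) (at (0::complex))" by (simp add: has_field_derivative_iff)
    hence "((\<lambda>z. 1 / ((exp z - 1) / z) + z / 2) \<longlongrightarrow> 1 / 1 + 0 / 2) (at (0::complex))"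
      by (intro tendsto_intros) auto
    thus ?thesis by (simp add: q0_def)
  qed
  hence holq: "q holomorphic_on ball 0 2"
    unfolding q_def
  proof (intro removable_singularity)
    show "q0 holomorphic_on ball 0 2 - {0}"
      unfolding q0_def by (intro holomorphic_intros) (use nz in auto)
  qed auto
  have even: "q (- z) = q z" if "norm z < 2" for z
  proof (cases "z = 0")
    case False
    have "exp z \<noteq> 1" "exp z \<noteq> 0" using nz[OF False that] by auto
    thus ?thesis using False by (simp add: q_def q0_def exp_minus divide_simps) (simp add: algebra_simps)?
  qed simp
  define c where "c = (\<lambda>n. (deriv ^^ n) q 0 / fact n)"
  have ser: "(\<lambda>n. c n * w ^ n) sums q w" if "norm w < 2" for w
    using holomorphic_power_series[OF holq, of w] that by (simp add: c_def)
  have ser2: "(\<lambda>m. c (2 * m) * w ^ (2 * m)) sums q w" if "norm w < 2" for w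
  proof -
    \<comment> \<open>Averaging the series at w and at - w deletes the odd terms.\<close>
    have "(\<lambda>n. (c n * w ^ n + c n * (- w) ^ n) / 2) sums ((q w + q (- w)) / 2)"
      using that by (intro sums_divide sums_add ser) auto
    hence "(\<lambda>n. (c n * w ^ n + c n * (- w) ^ n) / 2) sums q w" using even[OF that] by simp
    moreover have "strict_mono ((*) (2::nat))" by (auto simp: strict_mono_def)
    moreover have "(c n * w ^ n + c n * (- w) ^ n) / 2 = 0" if "n \<notin> range ((*) (2::nat))" for n
    proof -
      have "odd n" using that by (auto elim: evenE)
      thus ?thesis by simp
    qed
    ultimately have "(\<lambda>m. (c (2 * m) * w ^ (2 * m) + c (2 * m) * (- w) ^ (2 * m)) / 2) sums q w"
      using sums_mono_reindex[of "(*) (2::nat)" "\<lambda>n. (c n * w ^ n + c n * (- w) ^ n) / 2" "q w"] by simp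
    thus ?thesis by (simp add: power_mult)
  qed
  show ?thesis
  proof (rule that)
    \<comment> \<open>Convergence at 3/2 forces absolute convergence at 1, which makes the expansion
      usable up to the endpoint x = 1.\<close>
    have "summable (\<lambda>n. norm (c n * 1 ^ n))"
      by (rule powser_insidea[of c "3/2"]) (use ser[of "3/2"] in \<open>auto simp: sums_iff\<close>)
    hence "summable ((\<lambda>n. norm (c n)) \<circ> (*) (2::nat))"
      by (intro summable_reindex) (auto simp: inj_on_def)
    thus "summable (\<lambda>m. norm (c (2 * m)))" by (simp add: o_def)
  next
    show "\<forall>x::real. 0 < x \<longrightarrow> x \<le> 1 \<longrightarrow> (\<lambda>m. c (2 * m) * of_real x ^ (2 * m)) sums of_real (x / (exp x - 1) + x / 2)"
    proof (intro allI impI)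
    fix x :: real assume x: "0 < x" "x \<le> 1"
    have "q (of_real x) = of_real (x / (exp x - 1) + x / 2)"
      using x by (simp add: q_def q0_def flip: exp_of_real)
    thus "(\<lambda>m. c (2 * m) * of_real x ^ (2 * m)) sums of_real (x / (exp x - 1) + x / 2)"
      using ser2[of "of_real x"] x by simp
    qed
  qed
qed

lemma has_bochner_integral_exp_ln_0_1:
  fixes w :: complex
  assumes "Re w > 0"
  shows "has_bochner_integral lborel (\<lambda>x. if 0 < x \<and> x \<le> 1 then exp ((w - 1) * of_real (ln x)) else 0) (1 / w)"
proof -
  have i: "set_integrable lborel {0<..<1} (\<lambda>x::real. x powr (Re w - 1))"
  proof -
    have "(\<lambda>x::real. x powr (Re w - 1)) absolutely_integrable_on {0..1}"
      using assms by (intro nonnegative_absolutely_integrable_1 integrable_on_powr_from_0) auto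
    hence "(\<lambda>x::real. x powr (Re w - 1)) absolutely_integrable_on {0<..<1}"
      by (rule set_integrable_subset) auto
    thus ?thesis by (simp add: set_integrable_def integrable_completion)
  qed
  let ?F = "\<lambda>x. exp (w * of_real (ln x)) / w"
  have w0: "w \<noteq> 0" using assms by auto
  have fi: "set_integrable lborel (einterval 0 1) (\<lambda>x. exp ((w - 1) * of_real (ln x)))"
    using i unfolding set_integrable_def
    by (rule Bochner_Integration.integrable_bound)
       (auto simp: einterval_def indicator_def powr_def zero_ereal_def one_ereal_def)
  have "(LBINT x=0..1. exp ((w - 1) * of_real (ln x))) = 1 / w - 0"
  proof (rule interval_integral_FTC_integrable[OF _ _ _ fi])
    show "(?F has_vector_derivative exp ((w - 1) * of_real (ln x))) (at x)" if "0 < ereal x" "ereal x < 1" for x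
    proof -
      have x: "x > 0" using that by simp
      have "((\<lambda>x. of_real (ln x)) has_vector_derivative complex_of_real (1 / x)) (at x)"
        using x by (intro has_vector_derivative_of_real) (auto intro!: derivative_eq_intros simp flip: has_real_derivative_iff_has_vector_derivative)
      have "((\<lambda>z. exp (w * z) / w) has_field_derivative exp (w * of_real (ln x))) (at (complex_of_real (ln x)))"
        using w0 by (auto intro!: derivative_eq_intros)
      from field_vector_diff_chain_at[OF \<open>((\<lambda>x. of_real (ln x)) has_vector_derivative complex_of_real (1 / x)) (at x)\<close> this]
      have "(?F has_vector_derivative (complex_of_real (1 / x) * exp (w * of_real (ln x)))) (at x)"
        by (simp add: o_def)
      moreover have "exp ((w - 1) * of_real (ln x)) = complex_of_real (1 / x) * exp (w * of_real (ln x))"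
      proof -
        have "exp (complex_of_real (ln x)) = of_real x" using x by (simp add: exp_of_real)
        thus ?thesis using x by (simp add: algebra_simps exp_diff)
      qed
      ultimately show ?thesis by simp
    qed
    show "isCont (\<lambda>x. exp ((w - 1) * of_real (ln x))) x" if "0 < ereal x" "ereal x < 1" for x
      using that by (intro continuous_intros) auto
    show "((?F \<circ> real_of_ereal) \<longlongrightarrow> 0) (at_right 0)"
    proof -
      have "((\<lambda>x. exp (Re w * ln x) / norm w) \<longlongrightarrow> 0) (at_right 0)"
      proof -
        have "filterlim (\<lambda>x::real. Re w * ln x) at_bot (at_right 0)"
          using assms by (intro filterlim_tendsto_pos_mult_at_bot[OF tendsto_const _ ln_at_0]) auto
        hence "((\<lambda>x. exp (Re w * ln x)) \<longlongrightarrow> 0) (at_right 0)" by (rule filterlim_compose[OF exp_at_bot])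
        from tendsto_divide[OF this tendsto_const[of "norm w"]] show ?thesis using w0 by simp
      qed
      hence "(?F \<longlongrightarrow> 0) (at_right 0)"
        by (subst tendsto_norm_zero_iff[symmetric]) (simp add: norm_divide)
      thus ?thesis unfolding zero_ereal_def by (simp add: ereal_tendsto_simps1)
    qed
    show "((?F \<circ> real_of_ereal) \<longlongrightarrow> 1 / w) (at_left 1)"
    proof -
      have "isCont ?F 1" using w0 by (intro continuous_intros) auto
      hence "(?F \<longlongrightarrow> ?F 1) (at_left 1)" by (auto simp: isCont_def filterlim_at_split)
      thus ?thesis unfolding one_ereal_def by (simp add: ereal_tendsto_simps1)
    qed
  qed simp
  hence "has_bochner_integral lborel (\<lambda>x. indicator {0<..<1} x *\<^sub>R exp ((w - 1) * of_real (ln x))) (1 / w)"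
    using fi by (simp add: has_bochner_integral_iff interval_lebesgue_integral_def set_lebesgue_integral_def set_integrable_def
         einterval_def zero_ereal_def one_ereal_def greaterThanLessThan_def greaterThan_def lessThan_def Collect_conj_eq)
  \<comment> \<open>Only the null set {1} separates the open interval from the half-open
    one.\<close>
  moreover have "AE x in lborel. indicator {0<..<1} x *\<^sub>R exp ((w - 1) * of_real (ln x)) =
     (if 0 < x \<and> x \<le> 1 then exp ((w - 1) * of_real (ln x)) else 0)"
    using AE_lborel_singleton[of "1::real"] by eventually_elim (auto simp: indicator_def)
  ultimately show ?thesis by (subst (asm) has_bochner_integral_cong_AE) auto
qed

text \<open>On x \<le> 1 the even expansion is integrated termwise: the power 2 * m gives the pole
  at \<open>1 - 2 * m\<close>, and subtracting \<open>x / 2\<close> gives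
  \<open>- 1 / (2 * s)\<close>. On x > 1 the integrand decays exponentially for every s, so that
  part is entire.\<close>

lemma zeta_integral_split:
  obtains a :: "nat \<Rightarrow> complex" and I2 :: "complex \<Rightarrow> complex" where
    "summable (\<lambda>m. norm (a m))" "I2 holomorphic_on UNIV"
    "\<forall>s. Re s > 1 \<longrightarrow> Gamma s * zeta_series s = (\<Sum>m. a m / (s + 2 * of_nat m - 1)) - 1 / (2 * s) + I2 s"
proof -
  obtain a :: "nat \<Rightarrow> complex" where a: "summable (\<lambda>m. norm (a m))"
    and exp': "\<forall>x::real. 0 < x \<longrightarrow> x \<le> 1 \<longrightarrow> (\<lambda>m. a m * of_real x ^ (2 * m)) sums of_real (x / (exp x - 1) + x / 2)"
    using even_expansion by blast
  note exp = exp'[rule_format]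
  \<comment> \<open>The tail is put in Laplace form with phase \<open>ln x\<close>, which is
    nonnegative for x > 1. The factor \<open>1 / x\<close> in \<phi> belongs to the exponent s - 1,
    and the sign of s is reversed, whence \<open>L (- s)\<close>.\<close>
  define \<phi> :: "real \<Rightarrow> complex" where "\<phi> = (\<lambda>x. if 1 < x then of_real (1 / (x * (exp x - 1))) else 0)"
  define \<tau> where "\<tau> = (\<lambda>x. if 1 < x then ln x else 0 :: real)"
  have [measurable]: "\<phi> \<in> borel_measurable borel" "\<tau> \<in> borel_measurable borel"
    unfolding \<phi>_def \<tau>_def by measurable
  define L :: "complex \<Rightarrow> complex" where "L = (\<lambda>s::complex. \<integral>x. \<phi> x * exp (- s * \<tau> x) \<partial>lborel)"
  have iL: "integrable lborel (\<lambda>x. norm (\<phi> x) * exp (- \<sigma> * \<tau> x))" for \<sigma>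
  proof -
    \<comment> \<open>The tail is dominated by a Gamma integrand with exponent b - 1: b \<ge> -
      \<sigma> makes the power large enough, b \<ge> 1 makes the integral converge at 0.\<close>
    define b where "b = max 1 (- \<sigma>)"
    have "integrable lborel (\<lambda>x. if 0 < x then exp ((of_real b - 1) * of_real (ln x)) * of_real (exp (- 1 * x)) else 0 :: complex)"
      using Gamma_integral_exp_ln[of "of_real b" 1] by (simp add: has_bochner_integral_iff b_def)
    from integrable_mult_right[OF this, of 2] show ?thesis
    proof (rule Bochner_Integration.integrable_bound)
      show "AE x in lborel. norm (norm (\<phi> x) * exp (- \<sigma> * \<tau> x))
          \<le> norm (2 * (if 0 < x then exp ((of_real b - 1) * of_real (ln x)) * of_real (exp (- 1 * x)) else 0 :: complex))"
      proof (rule AE_I2)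
        fix x :: real
        show "norm (norm (\<phi> x) * exp (- \<sigma> * \<tau> x))
          \<le> norm (2 * (if 0 < x then exp ((of_real b - 1) * of_real (ln x)) * of_real (exp (- 1 * x)) else 0 :: complex))"
        proof (cases "1 < x")
          case True
          have e: "exp x \<ge> 2" using exp_ge_add_one_self[of x] True by linarith
          have "exp x * 1 \<le> (exp x - 1) * 2" using e by (simp add: algebra_simps)
          hence "exp x / (exp x - 1) * exp (- x) \<le> 2 * exp (- x)"
            using e True by (intro mult_right_mono) (subst pos_divide_le_eq, auto)
          hence "1 / (exp x - 1) \<le> 2 * exp (- x)" by (simp add: exp_minus)
          have "(- 1 - \<sigma>) * ln x \<le> (b - 1) * ln x" using True by (intro mult_right_mono) (auto simp: b_def)
          hence "exp (- ln x - \<sigma> * ln x) \<le> exp ((b - 1) * ln x)" by (simp add: algebra_simps)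
          with \<open>1 / (exp x - 1) \<le> 2 * exp (- x)\<close> have A: "1 / (exp x - 1) * exp (- ln x - \<sigma> * ln x) \<le> 2 * exp (- x) * exp ((b - 1) * ln x)"
            using e by (intro mult_mono) auto
          have "exp (- ln x - \<sigma> * ln x) = exp (- \<sigma> * ln x) / x" using True by (simp add: exp_diff exp_minus divide_inverse)
          moreover have "norm (\<phi> x) = \<bar>1 / (x * (exp x - 1))\<bar>"
            using True unfolding \<phi>_def by (simp only: if_True norm_of_real)
          ultimately show ?thesis using A True e
            by (simp add: \<tau>_def norm_mult mult_ac)
        next
          case False
          thus ?thesis by (simp add: \<phi>_def)
        qed
      qed
    qed measurable
  qed
  have "L holomorphic_on UNIV"
    unfolding L_def by (rule holomorphic_on_laplace_integral_UNIV) (use iL in \<open>auto simp: \<tau>_def\<close>)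
  hence hol: "(\<lambda>s. L (- s)) holomorphic_on UNIV"
    using holomorphic_on_compose_gen[of uminus UNIV L UNIV] by (simp add: o_def holomorphic_intros)
  have main: "Gamma s * zeta_series s = (\<Sum>m. a m / (s + 2 * of_nat m - 1)) - 1 / (2 * s) + L (- s)" if s: "Re s > 1" for s
  proof -
    define g where "g = (\<lambda>w x. if 0 < x \<and> x \<le> 1 then exp ((w - 1) * of_real (ln x)) else 0 :: complex)"
    have g: "has_bochner_integral lborel (g w) (1 / w)" if "Re w > 0" for w
      unfolding g_def using that by (rule has_bochner_integral_exp_ln_0_1)
    \<comment> \<open>The exponent of the m-th term. Since x \<le> 1, the norms decrease in m, so
      the term m = 0 dominates all others; its exponent s - 1 has positive real part because Re s >
      1.\<close>
    define w where "w = (\<lambda>m::nat. s + 2 * of_nat m - 1)"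
    have w: "Re (w m) > 0" for m using s by (simp add: w_def)
    have gle: "norm (g (w m) x) \<le> norm (g (w 0) x)" for m x
    proof (cases "0 < x \<and> x \<le> 1")
      case True
      have "(Re (w m) - 1) * ln x \<le> (Re (w 0) - 1) * ln x"
        using True by (intro mult_right_mono_neg) (auto simp: w_def)
      thus ?thesis using True by (simp add: g_def)
    qed (auto simp: g_def)
    have S: "(\<lambda>m. a m * g (w m) x) sums ((if 0 < x \<and> x \<le> 1 then exp ((s - 1) * of_real (ln x)) / of_real (exp x - 1) else 0) + g s x / 2)" for x
    proof (cases "0 < x \<and> x \<le> 1")
      case True
      have "(\<lambda>m. exp ((s - 1) * of_real (ln x)) / of_real x * (a m * of_real x ^ (2 * m))) sums
          (exp ((s - 1) * of_real (ln x)) / of_real x * of_real (x / (exp x - 1) + x / 2))"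
        using True by (intro sums_mult exp) auto
      moreover have "exp ((s - 1) * of_real (ln x)) / of_real x * of_real x ^ (2 * m) = g (w m) x" for m
      proof -
        have x: "exp (of_real (ln x)) = complex_of_real x" using True by (simp add: exp_of_real)
        have "(w m - 1) * of_real (ln x) = (s - 1) * of_real (ln x) - of_real (ln x) + of_nat (2 * m) * of_real (ln x)"
          by (simp add: w_def algebra_simps)
        thus ?thesis using True by (simp add: g_def exp_add exp_diff exp_of_nat_mult x del: of_nat_mult)
      qed
      hence "exp ((s - 1) * of_real (ln x)) / of_real x * (a m * of_real x ^ (2 * m)) = a m * g (w m) x" for m
        by (simp add: mult_ac flip: \<open>\<And>m. _ m = g (w m) x\<close>)
      moreover have "exp ((s - 1) * of_real (ln x)) / of_real x * of_real (x / (exp x - 1) + x / 2)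
         = (if 0 < x \<and> x \<le> 1 then exp ((s - 1) * of_real (ln x)) / of_real (exp x - 1) else 0) + g s x / 2"
        using True by (simp add: g_def field_simps)
      ultimately show ?thesis by simp
    qed (auto simp: g_def)
    have iam: "integrable lborel (\<lambda>x. a m * g (w m) x)" for m
      using g[OF w] by (intro integrable_mult_right) (auto simp: has_bochner_integral_iff)
    have sn: "summable (\<lambda>m. norm (a m * g (w m) x))" for x
      by (rule summable_comparison_test'[of "\<lambda>m. norm (a m) * norm (g (w 0) x)" 0])
         (use a gle in \<open>auto simp: norm_mult intro!: mult_left_mono summable_mult2\<close>)
    have si: "summable (\<lambda>m. \<integral>x. norm (a m * g (w m) x) \<partial>lborel)"
    proof (rule summable_comparison_test'[of "\<lambda>m. norm (a m) * (LBINT x. norm (g (w 0) x))" 0])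
      show "norm (LBINT x. norm (a m * g (w m) x)) \<le> norm (a m) * (LBINT x. norm (g (w 0) x))" for m
        unfolding norm_mult using g[OF w] gle
        by (auto simp: has_bochner_integral_iff intro!: mult_left_mono integral_mono integrable_norm)
    qed (use a in \<open>auto intro: summable_mult2\<close>)
    have "(\<lambda>m. \<integral>x. a m * g (w m) x \<partial>lborel) sums (LBINT x. (\<Sum>m. a m * g (w m) x))"
      using iam sn si by (intro sums_integral) auto
    hence I1: "(\<lambda>m. a m / w m) sums (LBINT x. (\<Sum>m. a m * g (w m) x))"
      using g[OF w] by (simp add: has_bochner_integral_iff)
    have i1: "integrable lborel (\<lambda>x. \<Sum>m. a m * g (w m) x)"
      using iam sn si by (intro integrable_suminf) auto
    have iss: "has_bochner_integral lborel (\<lambda>x. g s x / 2) (1 / s / 2)"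
      by (intro has_bochner_integral_divide_zero g) (use s in auto)
    have iLs: "integrable lborel (\<lambda>x. \<phi> x * exp (s * \<tau> x))"
      by (rule Bochner_Integration.integrable_bound[OF iL[of "- Re s"]]) (auto simp: norm_mult)
    have dec: "(if 0 < x then exp ((s - 1) * of_real (ln x)) / of_real (exp x - 1) else 0)
        = (\<Sum>m. a m * g (w m) x) - g s x / 2 + \<phi> x * exp (s * \<tau> x)" for x
    proof (cases "1 < x")
      case True
      have "exp (of_real (ln x)) = complex_of_real x" using True by (simp add: exp_of_real)
      thus ?thesis using S[of x] True by (simp add: sums_iff \<phi>_def \<tau>_def g_def algebra_simps exp_diff)
    next
      case False
      thus ?thesis using sums_unique[OF S[of x], symmetric] by (auto simp: \<phi>_def \<tau>_def)
    qed
    have "Gamma s * zeta_series s = (LBINT x. (\<Sum>m. a m * g (w m) x) - g s x / 2 + \<phi> x * exp (s * \<tau> x))"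
      using Gamma_times_zeta_series[OF s] unfolding dec by (simp add: has_bochner_integral_iff)
    also have "\<dots> = (\<Sum>m. a m / w m) - 1 / s / 2 + L (- s)"
      using i1 iss iLs I1 by (simp add: has_bochner_integral_iff sums_iff L_def)
    finally show ?thesis by (simp add: w_def)
  qed
  show ?thesis using main by (intro that[OF a hol]) blast
qed

text \<open>\<open>rGamma_shift j u = rGamma u / (u + j)\<close>, without the removable singularity. After Legendre duplication the
  factor \<open>rGamma ((s + 1) / 2)\<close> cancels the poles of \<open>Gamma s * zeta s\<close> at \<open>1 - 2 * m\<close>, \<open>m > 0\<close>, in this way.\<close>

definition rGamma_shift :: "nat \<Rightarrow> complex \<Rightarrow> complex" where
  "rGamma_shift j u = pochhammer u j * rGamma (u + of_nat (Suc j))"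

lemma rGamma_shift_mult: "rGamma_shift j u * (u + of_nat j) = rGamma u"
  using pochhammer_rGamma[of u "Suc j"] by (simp add: rGamma_shift_def pochhammer_Suc mult_ac)

text \<open>On the unit ball around x the divisor u + n has norm at least 1 as soon as n \<ge> norm
  x + 2. From then on \<open>rGamma_shift n\<close> is bounded there by a local bound of
  \<open>rGamma\<close> that does not depend on n, and the coefficients supply the summable
  majorant.\<close>

lemma rGamma_shift_series:
  fixes a :: "nat \<Rightarrow> complex"
  assumes a: "summable (\<lambda>j. norm (a j))"
  obtains g where "g holomorphic_on UNIV" "\<forall>u. (\<lambda>j. a j * rGamma_shift j u) sums g u"
proof -
  have bnd: "\<exists>d h. 0 < d \<and> summable h \<and> range h \<subseteq> \<real>\<^sub>\<ge>\<^sub>0 \<and>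
      (\<forall>\<^sub>F n in sequentially. \<forall>y\<in>ball x d \<inter> UNIV. norm (a n * rGamma_shift n y) \<le> norm (h n :: complex))" if "x \<in> UNIV" for x :: complex
  proof -
    have "compact (rGamma ` cball x 1)"
      by (intro compact_continuous_image holomorphic_on_imp_continuous_on[OF holomorphic_rGamma] compact_cball)
    then obtain B where B: "\<And>y. y \<in> cball x 1 \<Longrightarrow> norm (rGamma y) \<le> B"
      using compact_imp_bounded[THEN bounded_iff[THEN iffD1]] by (metis imageI)
    have B0: "B \<ge> 0" using order_trans[OF norm_ge_zero B[of x]] by simp
    have "\<forall>\<^sub>F n in sequentially. \<forall>y\<in>ball x 1. norm (a n * rGamma_shift n y) \<le> norm (complex_of_real (norm (a n) * B))"
      using eventually_ge_at_top[of "nat \<lceil>norm x + 2\<rceil>"]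
    proof eventually_elim
      case (elim n)
      show ?case
      proof
        fix y assume y: "y \<in> ball x 1"
        have "norm (- y) \<le> norm x + 1" using y norm_triangle_ineq[of x "y - x"] by (simp add: dist_norm norm_minus_commute)
        moreover have "real n \<ge> norm x + 2" using elim by linarith
        moreover have "norm (of_nat n - (- y)) \<ge> norm (of_nat n :: complex) - norm (- y)" by (rule norm_triangle_ineq2)
        ultimately have ge: "norm (y + of_nat n) \<ge> 1" by (simp add: add.commute)
        have "norm (rGamma_shift n y) * 1 \<le> norm (rGamma_shift n y) * norm (y + of_nat n)"
          by (intro mult_left_mono ge) auto
        also have "\<dots> = norm (rGamma y)" by (simp add: rGamma_shift_mult flip: norm_mult)
        also have "\<dots> \<le> B" using y by (intro B) auto
        finally show "norm (a n * rGamma_shift n y) \<le> norm (complex_of_real (norm (a n) * B))"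
          using B0 by (simp add: norm_mult mult_left_mono del: of_real_mult)
      qed
    qed
    moreover have "summable (\<lambda>n. complex_of_real (norm (a n) * B))"
      by (intro summable_of_real summable_mult2 a)
    moreover have "range (\<lambda>n. complex_of_real (norm (a n) * B)) \<subseteq> \<real>\<^sub>\<ge>\<^sub>0"
      using B0 by (auto simp: nonneg_Reals_of_real_iff simp del: of_real_mult)
    ultimately show ?thesis by (intro exI[of _ "1::real"] exI[of _ "\<lambda>n. complex_of_real (norm (a n) * B)"]) auto
  qed
  have diff: "(\<lambda>u. a n * rGamma_shift n u) field_differentiable (at x)" if "x \<in> UNIV" for n x
  proof -
    have "(\<lambda>u. pochhammer u n) holomorphic_on UNIV" unfolding pochhammer_prod by (intro holomorphic_intros)
    hence "(\<lambda>u. a n * rGamma_shift n u) holomorphic_on UNIV"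
      unfolding rGamma_shift_def by (intro holomorphic_intros)
    thus ?thesis by (simp add: holomorphic_on_def)
  qed
  obtain g where g: "\<forall>x \<in> UNIV. ((\<lambda>n. a n * rGamma_shift n x) sums g x) \<and> g field_differentiable (at x)"
    by (rule series_differentiable_comparison_complex[OF open_UNIV diff bnd]) (auto intro: that)
  show ?thesis using g by (intro that[of g]) (auto simp: holomorphic_on_def)
qed

definition xi_formula :: "complex \<Rightarrow> complex" where
  "xi_formula s = 1/2 * s * (s - 1) * (of_real pi) powr (- s / 2) * Gamma (s / 2) * zeta_series s"

text \<open>Every pole of the split integral meets a zero: the factor s - 1 cancels m = 0, the
  factor s cancels \<open>- 1 / (2 * s)\<close>, and the \<open>rGamma\<close> from the duplication
  formula cancels all m \<ge> 1, where the quotients are replaced by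
  \<open>rGamma_shift\<close>.\<close>

lemma xi_exists: "\<exists>F. F holomorphic_on UNIV \<and> (\<forall>s. 1 < Re s \<longrightarrow> F s = xi_formula s)"
proof -
  obtain a :: "nat \<Rightarrow> complex" and I2 :: "complex \<Rightarrow> complex" where
    a: "summable (\<lambda>m. norm (a m))" and I2: "I2 holomorphic_on UNIV" and
    eq': "\<forall>s. Re s > 1 \<longrightarrow> Gamma s * zeta_series s = (\<Sum>m. a m / (s + 2 * of_nat m - 1)) - 1 / (2 * s) + I2 s"
    using zeta_integral_split by blast
  note eq = eq'[rule_format]
  have a': "summable (\<lambda>j. norm (a (Suc j) / 2))"
    using a by (auto simp: norm_divide intro!: summable_divide summable_Suc_iff[THEN iffD2])
  obtain g where g: "g holomorphic_on UNIV" and gs: "\<forall>u. (\<lambda>j. a (Suc j) / 2 * rGamma_shift j u) sums g u"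
    using rGamma_shift_series[OF a'] by blast
  \<comment> \<open>This is \<open>xi_formula\<close> with \<open>Gamma (s / 2)\<close> replaced by
    duplication and all divisions carried out symbolically, so that only entire functions
    remain.\<close>
  define F where "F = (\<lambda>s. 1/2 * exp (- s / 2 * Ln (of_real pi)) * (exp ((1 - s) * of_real (ln 2)) * of_real (sqrt pi)) *
     (rGamma ((s + 1) / 2) * (s * (s - 1) * I2 s - (s - 1) / 2 + s * a 0) + s * (s - 1) * g ((s + 1) / 2)))"
  have "(\<lambda>s. g ((s + 1) / 2)) holomorphic_on UNIV"
    using holomorphic_on_compose_gen[of "\<lambda>s. (s + 1) / 2" UNIV g UNIV] g by (simp add: o_def holomorphic_intros)
  hence "F holomorphic_on UNIV"
    unfolding F_def by (intro holomorphic_intros I2) auto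
  moreover have "F s = xi_formula s" if s: "Re s > 1" for s
  proof -
    define u where "u = (s + 1) / 2"
    have nz: "u + of_nat j \<noteq> 0" for j
    proof -
      have "0 < (Re s + 1) / 2 + real j" using s by (intro add_pos_nonneg) auto
      hence "Re (u + of_nat j) \<noteq> 0" by (simp add: u_def)
      thus ?thesis by (metis zero_complex.simps(1))
    qed
    have s0: "s \<noteq> 0" "s \<noteq> 1" using s by auto
    have np: "z \<notin> \<int>\<^sub>\<le>\<^sub>0" if "Re z > 0" for z :: complex using that by (auto elim!: nonpos_Ints_cases)
    \<comment> \<open>The pole term of index Suc j has denominator \<open>2 * (u + j)\<close>: the
      shift by one in the index comes from treating m = 0 separately, and the 2 explains the halved
      coefficients.\<close>
    have sh: "rGamma u * (a (Suc j) / (s + 2 * of_nat (Suc j) - 1)) = a (Suc j) / 2 * rGamma_shift j u" for j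
    proof -
      have "s + 2 * of_nat (Suc j) - 1 = 2 * (u + of_nat j)" by (simp add: u_def field_simps)
      moreover have "(A * v) * (c / (2 * v)) = c / 2 * A" if "v \<noteq> 0" for A v c :: complex using that by simp
      ultimately show ?thesis using nz[of j] rGamma_shift_mult[of j u] by metis
    qed
    have ru: "rGamma u \<noteq> 0" using np[of u] s by (simp add: rGamma_eq_zero_iff u_def)
    have "(\<lambda>j. rGamma u * (a (Suc j) / (s + 2 * of_nat (Suc j) - 1))) sums g u"
      unfolding sh by (rule gs[rule_format])
    hence "(\<lambda>j. a (Suc j) / (s + 2 * of_nat (Suc j) - 1)) sums (g u / rGamma u)"
      using ru sums_divide[of "\<lambda>j. rGamma u * (a (Suc j) / (s + 2 * of_nat (Suc j) - 1))" "g u" "rGamma u"] by simp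
    hence "(\<lambda>m. a m / (s + 2 * of_nat m - 1)) sums (g u / rGamma u + a 0 / (s - 1))"
      using sums_Suc[of "\<lambda>m. a m / (s + 2 * of_nat m - 1)"] by simp
    hence "Gamma s * zeta_series s = g u / rGamma u + a 0 / (s - 1) - 1 / (2 * s) + I2 s"
      using eq[OF s] by (simp add: sums_iff)
    hence key: "s * (s - 1) * rGamma u * (Gamma s * zeta_series s)
        = rGamma u * (s * (s - 1) * I2 s - (s - 1) / 2 + s * a 0) + s * (s - 1) * g u"
      using ru s0 by (simp add: field_simps)
    have "Gamma (s / 2) * Gamma (s / 2 + 1 / 2) = exp ((1 - 2 * (s / 2)) * of_real (ln 2)) * of_real (sqrt pi) * Gamma (2 * (s / 2))"
      using s by (intro Gamma_legendre_duplication np) auto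
    moreover have "s / 2 + 1 / 2 = u" by (simp add: u_def field_simps)
    ultimately have G: "Gamma (s / 2) * Gamma u = exp ((1 - s) * of_real (ln 2)) * of_real (sqrt pi) * Gamma s" by simp
    have "Gamma (s / 2) = Gamma (s / 2) * Gamma u * rGamma u" using ru by (simp add: Gamma_def)
    hence dup: "Gamma (s / 2) = exp ((1 - s) * of_real (ln 2)) * of_real (sqrt pi) * Gamma s * rGamma u"
      unfolding G .
    have "F s = 1/2 * exp (- s / 2 * Ln (of_real pi)) * (exp ((1 - s) * of_real (ln 2)) * of_real (sqrt pi)) *
       (s * (s - 1) * rGamma u * (Gamma s * zeta_series s))"
      unfolding F_def key by (simp only: u_def)
    also have "\<dots> = xi_formula s"
      unfolding xi_formula_def dup by (simp add: powr_def mult_ac)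
    finally show ?thesis .
  qed
  ultimately show ?thesis by blast
qed

lemma xi_holomorphic: "xi holomorphic_on UNIV"
  and xi_eq: "1 < Re s \<Longrightarrow> xi s = xi_formula s"
proof -
  let ?P = "\<lambda>F. F holomorphic_on UNIV \<and> (\<forall>s. 1 < Re s \<longrightarrow> F s = xi_formula s)"
  have uniq: "F = G" if "?P F" "?P G" for F G
  proof
    fix z
    show "F z = G z"
      by (rule analytic_continuation_open[of "{s. Re s > 1}" UNIV F G])
         (use that in \<open>auto simp: open_halfspace_Re_gt intro!: exI[of _ 2]\<close>)
  qed
  have "\<exists>!F. ?P F" using xi_exists uniq by blast
  hence "?P xi" unfolding xi_def xi_formula_def[symmetric] by (rule theI')
  thus "xi holomorphic_on UNIV" "1 < Re s \<Longrightarrow> xi s = xi_formula s" by auto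
qed

section \<open>The Dirichlet series of the coefficients\<close>

text \<open>Multiplication by a fixed prime divisor p of n maps the squarefree divisors prime to p
  bijectively onto the squarefree divisors divisible by p and reverses the sign of
  \<open>moebius\<close>, so the two classes cancel.\<close>

lemma sum_moebius_divisors:
  assumes n: "n > 0"
  shows "(\<Sum>d | d dvd n. moebius d) = (if n = 1 then 1 else 0)"
proof (cases "n = 1")
  case True
  have "{d. d dvd (1::nat)} = {1}" by auto
  thus ?thesis using True by (simp add: moebius_def)
next
  case False
  then obtain p where p: "prime p" "p dvd n" using prime_factor_nat[of n] by auto
  define A where "A = {d. d dvd n \<and> squarefree d \<and> \<not> p dvd d}"
  have fin: "finite {d. d dvd n}" using n by simp
  have finA: "finite A" using fin by (rule rev_finite_subset) (auto simp: A_def)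
  have sqf: "squarefree (p * d) \<longleftrightarrow> squarefree d" if "\<not> p dvd d" for d
  proof -
    have "coprime p d" using p that by (simp add: prime_imp_coprime)
    thus ?thesis using p squarefree_mult_coprime[of p d] squarefree_multD[of p d] squarefree_prime[of p] by auto
  qed
  have img: "{d. d dvd n \<and> squarefree d \<and> p dvd d} = (*) p ` A"
  proof (intro equalityI subsetI)
    fix d assume d: "d \<in> {d. d dvd n \<and> squarefree d \<and> p dvd d}"
    then obtain e where e: "d = p * e" by blast
    have "\<not> p dvd e"
    proof
      assume "p dvd e"
      hence "p ^ 2 dvd d" unfolding e by (auto simp: power2_eq_square)
      hence "p dvd 1" using d by (auto simp: squarefree_def)
      thus False using p by simp
    qed
    moreover have "e dvd n" using d e by (auto elim: dvd_mult_right)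
    ultimately have "e \<in> A" using d sqf[of e] e by (auto simp: A_def)
    thus "d \<in> (*) p ` A" using e by blast
  next
    fix d assume "d \<in> (*) p ` A"
    then obtain e where e: "d = p * e" "e \<in> A" by blast
    hence "coprime p e" using p by (auto simp: A_def prime_imp_coprime)
    hence "p * e dvd n" using p e by (auto simp: A_def intro: divides_mult)
    thus "d \<in> {d. d dvd n \<and> squarefree d \<and> p dvd d}" using e sqf[of e] by (auto simp: A_def)
  qed
  have neg: "moebius (p * e) = - moebius e" if "e \<in> A" for e
  proof -
    have e: "squarefree e" "\<not> p dvd e" "e dvd n" using that by (auto simp: A_def)
    have "e \<noteq> 0" using e n by auto
    hence "prime_factors (p * e) = insert p (prime_factors e)"
      using p by (subst prime_factors_product) (auto simp: prime_prime_factors)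
    moreover have "p \<notin> prime_factors e" using e by auto
    ultimately show ?thesis using e sqf[of e] by (simp add: moebius_def)
  qed
  have "(\<Sum>d | d dvd n. moebius d) = (\<Sum>d | d dvd n \<and> squarefree d. moebius d)"
    using fin by (intro sum.mono_neutral_right) (auto simp: moebius_def)
  also have "{d. d dvd n \<and> squarefree d} = A \<union> {d. d dvd n \<and> squarefree d \<and> p dvd d}"
    by (auto simp: A_def)
  also have "(\<Sum>d\<in>\<dots>. moebius d) = (\<Sum>d\<in>A. moebius d) + (\<Sum>d\<in>(*) p ` A. moebius d)"
    unfolding img[symmetric] using finA fin by (intro sum.union_disjoint) (auto simp: A_def intro: rev_finite_subset)
  also have "(\<Sum>d\<in>(*) p ` A. moebius d) = (\<Sum>e\<in>A. moebius (p * e))"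
    using p by (intro sum.reindex[unfolded o_def]) (auto simp: inj_on_def)
  also have "\<dots> = - (\<Sum>e\<in>A. moebius e)" using neg by (simp add: sum_negf)
  finally show ?thesis using False by simp
qed

text \<open>The pairs (d, m) correspond to the pairs (n, d) with d dividing n through n = d * m;
  absolute summability over the product permits summing in either arrangement.\<close>

lemma dirichlet_product:
  fixes a b :: "nat \<Rightarrow> real"
  assumes a: "(\<lambda>n. \<bar>a n\<bar>) summable_on {1..}" and b: "(\<lambda>n. \<bar>b n\<bar>) summable_on {1..}"
  shows "(\<lambda>n. \<bar>\<Sum>d | d dvd n. a d * b (n div d)\<bar>) summable_on {1..}"
    and "infsum (\<lambda>n. \<Sum>d | d dvd n. a d * b (n div d)) {1..} = infsum a {1..} * infsum b {1..}"
proof -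
  have s: "(\<lambda>(d, m). \<bar>a d * b m\<bar>) summable_on {1..} \<times> {1..}"
    using Infinite_Sum.abs_summable_on_Sigma_iff[of "\<lambda>(d, m). a d * b m" "{1..}" "\<lambda>_. {1..}"] a b by (simp add: abs_mult case_prod_unfold summable_on_cmult_right infsum_cmult_right' summable_on_cmult_left)
  let ?S = "SIGMA n:{1::nat..}. {d. d dvd n}"
  have bij: "bij_betw (\<lambda>(n, d). (d, n div d)) ?S ({1..} \<times> {1..})"
    by (rule bij_betwI[where g = "\<lambda>(d, m). (d * m, d)"])
       (auto simp: Suc_le_eq dvd_div_eq_0_iff elim!: dvdE intro!: Nat.gr0I)
  have S: "(\<lambda>(n, d). \<bar>a d * b (n div d)\<bar>) summable_on ?S"
    using summable_on_reindex_bij_betw[OF bij, of "\<lambda>(d, m). \<bar>a d * b m\<bar>"] s by (simp add: case_prod_unfold)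
  have sS: "(\<lambda>(n, d). a d * b (n div d)) summable_on ?S"
    by (rule abs_summable_summable) (use S in \<open>simp add: case_prod_unfold\<close>)
  have s': "(\<lambda>(d, m). a d * b m) summable_on {1..} \<times> {1..}"
    by (rule abs_summable_summable) (use s in \<open>simp add: case_prod_unfold\<close>)
  have fin: "finite {d. d dvd n}" if "n \<in> {1::nat..}" for n using that by (intro finite_divisors_nat) auto
  have "(\<lambda>n. infsum (\<lambda>d. \<bar>a d * b (n div d)\<bar>) {d. d dvd n}) summable_on {1..}"
    using summable_on_Sigma_banach[OF S] by simp
  thus "(\<lambda>n. \<bar>\<Sum>d | d dvd n. a d * b (n div d)\<bar>) summable_on {1..}"
    by (rule summable_on_comparison_test) (use fin in \<open>auto intro: sum_abs\<close>)
  have "infsum (\<lambda>n. \<Sum>d | d dvd n. a d * b (n div d)) {1..}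
      = infsum (\<lambda>n. infsum (\<lambda>d. a d * b (n div d)) {d. d dvd n}) {1..}"
    using fin by (intro infsum_cong) simp
  also have "\<dots> = infsum (\<lambda>(n, d). a d * b (n div d)) ?S"
    using infsum_Sigma'_banach[of "\<lambda>n d. a d * b (n div d)" "{1..}" "\<lambda>n. {d. d dvd n}"] sS by simp
  also have "\<dots> = infsum (\<lambda>(d, m). a d * b m) ({1..} \<times> {1..})"
    using infsum_reindex_bij_betw[OF bij, of "\<lambda>(d, m). a d * b m"] by (simp add: case_prod_unfold)
  also have "\<dots> = infsum (\<lambda>d. infsum (\<lambda>m. a d * b m) {1..}) {1..}"
    using infsum_Sigma'_banach[of "\<lambda>d m. a d * b m" "{1..}" "\<lambda>_. {1..}"] s' by simp
  also have "\<dots> = infsum a {1..} * infsum b {1..}"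
    by (simp add: infsum_cmult_right' infsum_cmult_left')
  finally show "infsum (\<lambda>n. \<Sum>d | d dvd n. a d * b (n div d)) {1..} = infsum a {1..} * infsum b {1..}" .
qed

section \<open>The real zeta series and its Moebius inverse\<close>

definition zetar :: "real \<Rightarrow> real" where "zetar w = (\<Sum>n. real (Suc n) powr (- w))"

lemma infsum_eq_suminf_Suc:
  fixes f :: "nat \<Rightarrow> real"
  assumes "(\<lambda>n. \<bar>f n\<bar>) summable_on {1..}"
  shows "summable (\<lambda>n. \<bar>f (Suc n)\<bar>)" "infsum f {1..} = (\<Sum>n. f (Suc n))"
proof -
  have bij: "bij_betw Suc UNIV {1..}" by (rule bij_betwI[where g = "\<lambda>n. n - 1"]) auto
  have S: "(\<lambda>n. \<bar>f (Suc n)\<bar>) summable_on UNIV"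
    using summable_on_reindex_bij_betw[OF bij, of "\<lambda>n. \<bar>f n\<bar>"] assms by simp
  thus "summable (\<lambda>n. \<bar>f (Suc n)\<bar>)" by (rule summable_on_imp_summable)
  have "(\<lambda>n. f (Suc n)) summable_on UNIV" by (rule abs_summable_summable) (use S in simp)
  hence "(\<Sum>n. f (Suc n)) = infsum (\<lambda>n. f (Suc n)) UNIV"
    using has_sum_imp_sums[OF has_sum_infsum] sums_unique by metis
  also have "\<dots> = infsum f {1..}" by (rule infsum_reindex_bij_betw[OF bij])
  finally show "infsum f {1..} = (\<Sum>n. f (Suc n))" ..
qed

lemma abs_summable_powr: 
  assumes "w > 1" shows "(\<lambda>n. \<bar>real n powr (- w)\<bar>) summable_on {1..}"
proof -
  have "summable (\<lambda>n. real n powr (- w))" using assms by (simp add: summable_real_powr_iff)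
  hence "(\<lambda>n. real n powr (- w)) summable_on UNIV"
    by (intro norm_summable_imp_summable_on) simp
  thus ?thesis by (auto intro: summable_on_subset_banach)
qed

lemma infsum_powr: "w > 1 \<Longrightarrow> infsum (\<lambda>n. real n powr (- w)) {1..} = zetar w"
  using infsum_eq_suminf_Suc(2)[OF abs_summable_powr] by (simp add: zetar_def)

lemma zetar_pos: "w > 1 \<Longrightarrow> zetar w > 0"
  unfolding zetar_def using infsum_eq_suminf_Suc(1)[OF abs_summable_powr, of w]
  by (intro suminf_pos) auto

lemma abs_moebius_le: "\<bar>real_of_int (moebius d)\<bar> \<le> 1"
  by (simp add: moebius_def power_abs)

text \<open>The Dirichlet convolution of \<open>moebius\<close> with the constant 1 is the unit, and
  the factors d and n div d recombine to the single power of n.\<close>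

lemma
  assumes w: "w > 1"
  shows abs_summable_moebius: "(\<lambda>n. \<bar>moebius n * real n powr (- w)\<bar>) summable_on {1..}"
    and infsum_moebius: "infsum (\<lambda>n. moebius n * real n powr (- w)) {1..} * zetar w = 1"
proof -
  show s: "(\<lambda>n. \<bar>moebius n * real n powr (- w)\<bar>) summable_on {1..}"
    by (rule summable_on_comparison_test[OF abs_summable_powr[OF w]])
       (auto simp: abs_mult intro: mult_left_le_one_le abs_moebius_le)
  have "infsum (\<lambda>n. moebius n * real n powr (- w)) {1..} * zetar w
      = infsum (\<lambda>n. \<Sum>d | d dvd n. moebius d * real d powr (- w) * real (n div d) powr (- w)) {1..}"
    using dirichlet_product(2)[OF s abs_summable_powr[OF w]] infsum_powr[OF w] by simp
  also have "\<dots> = infsum (\<lambda>n. if n = 1 then 1 else 0) {1::nat..}"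
  proof (rule infsum_cong)
    fix n :: nat assume n: "n \<in> {1..}"
    have "(\<Sum>d | d dvd n. moebius d * real d powr (- w) * real (n div d) powr (- w))
        = (\<Sum>d | d dvd n. real_of_int (moebius d) * real n powr (- w))"
    proof (rule sum.cong[OF refl])
      fix d assume "d \<in> {d. d dvd n}"
      hence "real d * real (n div d) = real n" by (simp flip: of_nat_mult)
      thus "moebius d * real d powr (- w) * real (n div d) powr (- w) = real_of_int (moebius d) * real n powr (- w)"
        by (simp add: mult.assoc flip: powr_mult)
    qed
    also have "\<dots> = real_of_int (\<Sum>d | d dvd n. moebius d) * real n powr (- w)"
      by (simp add: sum_distrib_right)
    also have "\<dots> = (if n = 1 then 1 else 0)" using sum_moebius_divisors[of n] n by simp
    finally show "(\<Sum>d | d dvd n. moebius d * real d powr (- w) * real (n div d) powr (- w)) = (if n = 1 then 1 else 0)" .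
  qed
  also have "\<dots> = infsum (\<lambda>n. 1) {1::nat}" by (rule infsum_cong_neutral) auto
  finally show "infsum (\<lambda>n. moebius n * real n powr (- w)) {1..} * zetar w = 1" by simp
qed

text \<open>Rewriting n = d * (n div d) shows \<open>c_coef \<omega>\<close> to be the Dirichlet
  convolution of \<open>moebius d * d powr (- \<omega>)\<close> with \<open>m powr \<omega>\<close>.
  The first factor contributes the reciprocal of zeta at w + \<omega>, the second zeta at w -
  \<omega>.\<close>

lemma
  assumes w: "w > \<omega> + 1" and \<omega>: "\<omega> > 0"
  shows summable_c_coef: "summable (\<lambda>n. \<bar>c_coef \<omega> (Suc n) * real (Suc n) powr (- w)\<bar>)"
    and suminf_c_coef: "(\<Sum>n. c_coef \<omega> (Suc n) * real (Suc n) powr (- w)) = zetar (w - \<omega>) / zetar (w + \<omega>)"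
proof -
  have w': "w - \<omega> > 1" "w + \<omega> > 1" using w \<omega> by auto
  have eq: "c_coef \<omega> n * real n powr (- w)
      = (\<Sum>d | d dvd n. moebius d * real d powr (- (w + \<omega>)) * real (n div d) powr (- (w - \<omega>)))" if "n \<in> {1..}" for n
    unfolding c_coef_def sum_distrib_left sum_distrib_right
  proof (rule sum.cong[OF refl])
    fix d assume d: "d \<in> {d. d dvd n}"
    have n: "real n = real d * real (n div d)" using d by (simp flip: of_nat_mult)
    have d0: "d > 0" "n div d > 0" using d that by (auto intro!: Nat.gr0I simp: dvd_div_eq_0_iff)
    have "real n powr \<omega> * (moebius d * real d powr (- 2 * \<omega>)) * real n powr (- w)
       = moebius d * (real d powr (- 2 * \<omega>) * real n powr (\<omega> - w))"
      using that by (simp add: powr_diff powr_minus divide_inverse mult_ac)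
    also have "real d powr (- 2 * \<omega>) * real n powr (\<omega> - w) = real d powr (- (w + \<omega>)) * real (n div d) powr (- (w - \<omega>))"
    proof -
      have "real n powr (\<omega> - w) = real d powr (\<omega> - w) * real (n div d) powr (\<omega> - w)"
        unfolding n by (rule powr_mult) 
      moreover have "real d powr (- 2 * \<omega>) * real d powr (\<omega> - w) = real d powr (- (w + \<omega>))"
        by (simp add: algebra_simps flip: powr_add)
      ultimately show ?thesis by (simp add: mult.assoc[symmetric])
    qed
    finally show "real n powr \<omega> * (moebius d * real d powr (- 2 * \<omega>)) * real n powr (- w)
       = moebius d * real d powr (- (w + \<omega>)) * real (n div d) powr (- (w - \<omega>))" by simp
  qed
  note dp = dirichlet_product[OF abs_summable_moebius[OF w'(2)] abs_summable_powr[OF w'(1)]]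
  have S: "(\<lambda>n. \<bar>c_coef \<omega> n * real n powr (- w)\<bar>) summable_on {1..}"
    using dp(1) by (subst summable_on_cong[where g = "\<lambda>n. \<bar>\<Sum>d | d dvd n. moebius d * real d powr (- (w + \<omega>)) * real (n div d) powr (- (w - \<omega>))\<bar>"])
      (simp_all only: eq)
  show "summable (\<lambda>n. \<bar>c_coef \<omega> (Suc n) * real (Suc n) powr (- w)\<bar>)"
    by (rule infsum_eq_suminf_Suc(1)[OF S])
  have "(\<Sum>n. c_coef \<omega> (Suc n) * real (Suc n) powr (- w)) = infsum (\<lambda>n. c_coef \<omega> n * real n powr (- w)) {1..}"
    by (rule infsum_eq_suminf_Suc(2)[OF S, symmetric])
  also have "\<dots> = infsum (\<lambda>n. moebius n * real n powr (- (w + \<omega>))) {1..} * zetar (w - \<omega>)"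
    using dp(2) infsum_powr[OF w'(1)] by (simp only: eq cong: infsum_cong)
  also have "\<dots> = zetar (w - \<omega>) / zetar (w + \<omega>)"
    using infsum_moebius[OF w'(2)] zetar_pos[OF w'(2)] by (simp add: field_simps)
  finally show "(\<Sum>n. c_coef \<omega> (Suc n) * real (Suc n) powr (- w)) = zetar (w - \<omega>) / zetar (w + \<omega>)" .
qed

section \<open>Fourier inversion and the Plancherel identity\<close>

abbreviation fourier :: "(real \<Rightarrow> complex) \<Rightarrow> real \<Rightarrow> complex" where
  "fourier H t \<equiv> \<integral>u. H u * exp (\<i> * of_real (u * t)) \<partial>lborel"

lemma integrable_pair_le_mult:
  fixes f :: "real \<Rightarrow> real \<Rightarrow> 'a::{banach, second_countable_topology}"
  assumes [measurable]: "case_prod f \<in> borel_measurable (lborel \<Otimes>\<^sub>M lborel)"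
    and p: "integrable lborel p" and q: "integrable lborel q"
    and le: "\<And>x y. norm (f x y) \<le> p x * q y"
  shows "integrable (lborel \<Otimes>\<^sub>M lborel) (case_prod f)"
proof (rule lborel_pair.Fubini_integrable)
  have i: "integrable lborel (f x)" for x
    by (rule Bochner_Integration.integrable_bound[OF integrable_mult_right[OF q, of "p x"]])
       (auto intro!: AE_I2 order_trans[OF le abs_ge_self])
  show "AE x in lborel. integrable lborel (\<lambda>y. case (x, y) of (x, y) \<Rightarrow> f x y)" using i by simp
  show "integrable lborel (\<lambda>x. LBINT y. norm (case (x, y) of (x, y) \<Rightarrow> f x y))"
  proof (rule Bochner_Integration.integrable_bound[OF integrable_mult_left[OF p, of "\<integral>y. q y \<partial>lborel"]])
    show "AE x in lborel. norm (LBINT y. norm (case (x, y) of (x, y) \<Rightarrow> f x y)) \<le> norm (p x * (LBINT y. q y))"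
    proof (rule AE_I2)
      fix x
      have "(LBINT y. norm (f x y)) \<le> (LBINT y. p x * q y)"
        by (intro integral_mono integrable_norm i integrable_mult_right q le)
      hence "(LBINT y. norm (f x y)) \<le> p x * (LBINT y. q y)" by simp
      moreover have "0 \<le> (LBINT y. norm (f x y))" by (intro integral_nonneg_AE AE_I2) auto
      ultimately show "norm (LBINT y. norm (case (x, y) of (x, y) \<Rightarrow> f x y)) \<le> norm (p x * (LBINT y. q y))"
        by simp
    qed
  qed measurable
qed fact

text \<open>Read off the characteristic function of the standard normal distribution by restoring
  the factor \<open>sqrt (2 * pi)\<close> of its density.\<close>

lemma integrable_gaussian: "integrable lborel (\<lambda>t::real. exp (- t\<^sup>2 / 2))"
  and fourier_gaussian: "fourier (\<lambda>t. of_real (exp (- t\<^sup>2 / 2))) u = of_real (sqrt (2 * pi) * exp (- u\<^sup>2 / 2))"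
proof -
  have "integrable lborel (\<lambda>t. sqrt (2 * pi) * std_normal_density t)"
    by (intro integrable_mult_right) simp
  thus "integrable lborel (\<lambda>t::real. exp (- t\<^sup>2 / 2))"
    by (simp add: std_normal_density_def)
  have "char std_normal_distribution u = (LBINT t. std_normal_density t *\<^sub>R iexp (u * t))"
    unfolding char_def by (subst integral_density) (auto simp: normal_density_nonneg)
  also have "\<dots> = (LBINT t. (1 / sqrt (2 * pi)) *\<^sub>R (of_real (exp (- t\<^sup>2 / 2)) * exp (\<i> * of_real (t * u))))"
    by (intro Bochner_Integration.integral_cong refl) (simp add: std_normal_density_def scaleR_conv_of_real mult_ac)
  also have "\<dots> = (1 / sqrt (2 * pi)) *\<^sub>R fourier (\<lambda>t. of_real (exp (- t\<^sup>2 / 2))) u"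
    by (rule integral_scaleR_right)
  finally show "fourier (\<lambda>t. of_real (exp (- t\<^sup>2 / 2))) u = of_real (sqrt (2 * pi) * exp (- u\<^sup>2 / 2))"
    by (simp add: char_std_normal_distribution scaleR_conv_of_real field_simps)
qed

lemma integrable_gaussian_scaled:
  assumes "c > 0" shows "integrable lborel (\<lambda>t::real. exp (- (t / c)\<^sup>2 / 2))"
  using lborel_integrable_real_affine[OF integrable_gaussian, of "1/c" 0] assms by simp

lemma fourier_gaussian_scaled:
  assumes "c > 0"
  shows "fourier (\<lambda>t. of_real (exp (- (t / c)\<^sup>2 / 2))) u = of_real (c * sqrt (2 * pi) * exp (- (c * u)\<^sup>2 / 2))"
proof -
  have "fourier (\<lambda>t. of_real (exp (- (t / c)\<^sup>2 / 2))) u = \<bar>c\<bar> *\<^sub>R fourier (\<lambda>t. of_real (exp (- t\<^sup>2 / 2))) (c * u)"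
    using assms by (subst lborel_integral_real_affine[where c = c and t = 0]) (auto simp: mult_ac)
  thus ?thesis using assms unfolding fourier_gaussian by (simp add: scaleR_conv_of_real)
qed

lemma borel_measurable_cnj [measurable]: "cnj \<in> borel_measurable borel"
  by (intro borel_measurable_continuous_onI continuous_intros)

lemma fourier_measurable [measurable]:
  assumes [measurable]: "H \<in> borel_measurable borel"
  shows "fourier H \<in> borel_measurable borel"
  by measurable

lemma integrable_mult_iexp:
  fixes H :: "real \<Rightarrow> complex"
  assumes "integrable lborel H"
  shows "integrable lborel (\<lambda>u. H u * exp (\<i> * of_real (u * t)))"
  by (rule Bochner_Integration.integrable_bound[OF assms])
     (use borel_measurable_integrable[OF assms] in \<open>auto simp: norm_mult\<close>)

lemma norm_fourier_le:
  fixes H :: "real \<Rightarrow> complex"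
  assumes "integrable lborel H"
  shows "norm (fourier H t) \<le> (LBINT u. norm (H u))"
  using integral_norm_bound[of lborel "\<lambda>u. H u * exp (\<i> * of_real (u * t))"] by (simp add: norm_mult)

text \<open>Fubini moves the transform from H onto the Gaussian, which becomes a Gaussian
  concentrating at 0 as the cutoff widens. Rescaling it to a fixed Gaussian puts the parameter into
  the argument of H, where continuity at 0 and boundedness give dominated convergence.\<close>

lemma gauss_summability:
  fixes H :: "real \<Rightarrow> complex"
  assumes H: "integrable lborel H" and B: "\<And>u. norm (H u) \<le> B" and cont: "isCont H 0"
  shows "(\<lambda>n. \<integral>t. fourier H t * of_real (exp (- (t / real (Suc n))\<^sup>2 / 2)) \<partial>lborel) \<longlonglongrightarrow> 2 * pi * H 0"
proof -
  have [measurable]: "H \<in> borel_measurable borel" using borel_measurable_integrable[OF H] by simp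
  have eq: "(LBINT t. fourier H t * of_real (exp (- (t / c)\<^sup>2 / 2)))
      = (LBINT v. H (v / c) * of_real (sqrt (2 * pi) * exp (- v\<^sup>2 / 2)))" if c: "c > 0" for c :: real
  proof -
    have "(LBINT t. fourier H t * of_real (exp (- (t / c)\<^sup>2 / 2)))
        = (LBINT t. \<integral>u. H u * exp (\<i> * of_real (u * t)) * of_real (exp (- (t / c)\<^sup>2 / 2)) \<partial>lborel)"
      by simp
    also have "\<dots> = (LBINT u. \<integral>t. H u * exp (\<i> * of_real (u * t)) * of_real (exp (- (t / c)\<^sup>2 / 2)) \<partial>lborel)"
    proof (rule lborel_pair.Fubini_integral[symmetric])
      show "integrable (lborel \<Otimes>\<^sub>M lborel) (\<lambda>(t, u). H u * exp (\<i> * of_real (u * t)) * of_real (exp (- (t / c)\<^sup>2 / 2)))"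
        by (rule integrable_pair_le_mult[OF _ integrable_gaussian_scaled[OF c] integrable_norm[OF H]])
           (auto simp: norm_mult simp flip: of_real_exp)
    qed
    also have "\<dots> = (LBINT u. H u * fourier (\<lambda>t. of_real (exp (- (t / c)\<^sup>2 / 2))) u)"
      by (simp add: mult_ac flip: integral_mult_right_zero)
    also have "\<dots> = (LBINT u. H u * of_real (c * sqrt (2 * pi) * exp (- (c * u)\<^sup>2 / 2)))"
      unfolding fourier_gaussian_scaled[OF c] ..
    also have "\<dots> = (LBINT v. H (v / c) * of_real (sqrt (2 * pi) * exp (- v\<^sup>2 / 2)))"
      using c by (subst lborel_integral_real_affine[where c = "1 / c" and t = 0])
        (auto simp: scaleR_conv_of_real mult_ac simp flip: integral_mult_right_zero)
    finally show ?thesis .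
  qed
  have "(\<lambda>n. \<integral>v. H (v / real (Suc n)) * of_real (sqrt (2 * pi) * exp (- v\<^sup>2 / 2)) \<partial>lborel) \<longlonglongrightarrow>
        (LBINT v. H 0 * of_real (sqrt (2 * pi) * exp (- v\<^sup>2 / 2)))"
  proof (rule integral_dominated_convergence[where w = "\<lambda>v. B * (sqrt (2 * pi) * exp (- v\<^sup>2 / 2))"])
    show "integrable lborel (\<lambda>v. B * (sqrt (2 * pi) * exp (- v\<^sup>2 / 2)))"
      by (intro integrable_mult_right integrable_gaussian)
    show "AE v in lborel. (\<lambda>n. H (v / real (Suc n)) * of_real (sqrt (2 * pi) * exp (- v\<^sup>2 / 2)))
        \<longlonglongrightarrow> H 0 * of_real (sqrt (2 * pi) * exp (- v\<^sup>2 / 2))"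
    proof (intro AE_I2 tendsto_intros)
      fix v :: real
      have "(\<lambda>n. v / real (Suc n)) \<longlonglongrightarrow> 0"
        by (rule LIMSEQ_Suc[OF lim_const_over_n])
      thus "(\<lambda>n. H (v / real (Suc n))) \<longlonglongrightarrow> H 0"
        by (rule isCont_tendsto_compose[OF cont])
    qed
    show "AE v in lborel. norm (H (v / real (Suc n)) * of_real (sqrt (2 * pi) * exp (- v\<^sup>2 / 2)))
        \<le> B * (sqrt (2 * pi) * exp (- v\<^sup>2 / 2))" for n
      using B by (intro AE_I2) (auto simp: norm_mult simp flip: of_real_exp intro!: mult_right_mono)
  qed auto
  moreover have "(LBINT v. H 0 * of_real (sqrt (2 * pi) * exp (- v\<^sup>2 / 2))) = 2 * pi * H 0"
  proof -
    have "(LBINT v. H 0 * of_real (sqrt (2 * pi) * exp (- v\<^sup>2 / 2)))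
        = H 0 * sqrt (2 * pi) * fourier (\<lambda>t. of_real (exp (- t\<^sup>2 / 2))) 0"
      by (subst integral_mult_right_zero[symmetric]) (simp add: mult_ac)
    also have "\<dots> = H 0 * of_real (sqrt (2 * pi) * sqrt (2 * pi))"
      unfolding fourier_gaussian by (simp only: of_real_mult) simp
    also have "\<dots> = 2 * pi * H 0"
      by (subst real_sqrt_mult_self) simp
    finally show ?thesis .
  qed
  ultimately show ?thesis
    by (subst eq) (simp_all only: of_nat_0_less_iff zero_less_Suc)
qed

text \<open>Translating by x reduces to the value at 0. There the Gaussian means have two limits: 2
  pi times the value, by summability, and the plain integral of the transform, by
  domination.\<close>

lemma fourier_inversion:
  fixes H :: "real \<Rightarrow> complex"
  assumes H: "integrable lborel H" and B: "\<And>u. norm (H u) \<le> B" and cont: "isCont H x"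
    and i: "integrable lborel (fourier H)"
  shows "(LBINT t. fourier H t * exp (- \<i> * of_real (x * t))) = 2 * pi * H x"
proof -
  have [measurable]: "H \<in> borel_measurable borel" using borel_measurable_integrable[OF H] by simp
  define G where "G = (\<lambda>u. H (x + u))"
  have FG: "fourier G t = fourier H t * exp (- \<i> * of_real (x * t))" for t
    unfolding G_def
    by (subst (2) lborel_integral_real_affine[where c = 1 and t = x])
       (auto simp: algebra_simps exp_add exp_diff exp_minus field_simps simp flip: integral_mult_right_zero)
  have iG: "integrable lborel (fourier G)"
    unfolding FG by (rule Bochner_Integration.integrable_bound[OF i]) (auto simp: norm_mult)
  have "(\<lambda>n. \<integral>t. fourier G t * of_real (exp (- (t / real (Suc n))\<^sup>2 / 2)) \<partial>lborel) \<longlonglongrightarrow> 2 * pi * G 0"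
  proof (rule gauss_summability)
    show "integrable lborel G" unfolding G_def
      using lborel_integrable_real_affine[OF H, of 1 x] by simp
    show "isCont G 0" unfolding G_def
      by (rule isCont_o2[where f = "\<lambda>u. x + u" and g = H]) (use cont in \<open>auto intro: continuous_intros\<close>)
  qed (use B in \<open>auto simp: G_def\<close>)
  moreover have "(\<lambda>n. \<integral>t. fourier G t * of_real (exp (- (t / real (Suc n))\<^sup>2 / 2)) \<partial>lborel)
      \<longlonglongrightarrow> (LBINT t. fourier G t)"
  proof (rule integral_dominated_convergence[where w = "\<lambda>t. norm (fourier G t)"])
    show "AE t in lborel. (\<lambda>n. fourier G t * of_real (exp (- (t / real (Suc n))\<^sup>2 / 2))) \<longlonglongrightarrow> fourier G t"
    proof (rule AE_I2)
      fix t :: real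
      have "(\<lambda>n. t / real (Suc n)) \<longlonglongrightarrow> 0" by (rule LIMSEQ_Suc[OF lim_const_over_n])
      hence "(\<lambda>n. fourier G t * of_real (exp (- (t / real (Suc n))\<^sup>2 / 2))) \<longlonglongrightarrow> fourier G t * of_real (exp (- 0\<^sup>2 / 2))"
        by (intro tendsto_intros) auto
      thus "(\<lambda>n. fourier G t * of_real (exp (- (t / real (Suc n))\<^sup>2 / 2))) \<longlonglongrightarrow> fourier G t" by simp
    qed
    show "AE t in lborel. norm (fourier G t * of_real (exp (- (t / real (Suc n))\<^sup>2 / 2))) \<le> norm (fourier G t)" for n
      by (intro AE_I2) (auto simp: norm_mult simp flip: of_real_exp intro!: mult_left_le)
  qed (use iG in \<open>auto intro: integrable_norm simp: G_def\<close>)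
  ultimately have "(LBINT t. fourier G t) = 2 * pi * G 0" by (rule LIMSEQ_unique[rotated])
  thus ?thesis unfolding FG by (simp add: G_def)
qed

text \<open>The autocorrelation R of H has the squared modulus of the transform as its Fourier
  transform, and its value at 0 is the squared norm of H. Gaussian summability applied to R
  therefore gives the identity; as the Gaussians increase with n and the transform of R is
  nonnegative, monotone convergence also yields integrability.\<close>

lemma
  fixes H :: "real \<Rightarrow> complex"
  assumes H: "integrable lborel H" and B: "\<And>u. norm (H u) \<le> B"
    and cont: "continuous_on UNIV H"
  shows plancherel_integrable: "integrable lborel (\<lambda>t. (norm (fourier H t))\<^sup>2)"
    and plancherel: "(LBINT t. (norm (fourier H t))\<^sup>2) = 2 * pi * (LBINT u. (norm (H u))\<^sup>2)"
proof -
  have [measurable]: "H \<in> borel_measurable borel" using borel_measurable_integrable[OF H] by simp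
  define R where "R = (\<lambda>w. \<integral>u. H (u + w) * cnj (H u) \<partial>lborel)"
  have [measurable]: "R \<in> borel_measurable borel" unfolding R_def by measurable
  have iH: "integrable lborel (\<lambda>w. H (u + w))" for u
    using lborel_integrable_real_affine[OF H, of 1 u] by simp
  have pint: "integrable (lborel \<Otimes>\<^sub>M lborel) (\<lambda>(u, w). H (u + w) * cnj (H u) * exp (\<i> * of_real (w * t)))" for t
  proof (rule lborel_pair.Fubini_integrable)
    have "(LBINT w. norm (H (u + w) * cnj (H u) * exp (\<i> * of_real (w * t)))) = (LBINT w. norm (H w)) * norm (H u)" for u
    proof -
      have "(LBINT w. norm (H (u + w))) = (LBINT w. norm (H w))"
        by (subst (2) lborel_integral_real_affine[where c = 1 and t = u]) auto
      thus ?thesis by (simp add: norm_mult)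
    qed
    thus "integrable lborel (\<lambda>u. LBINT w. norm (case (u, w) of (u, w) \<Rightarrow> H (u + w) * cnj (H u) * exp (\<i> * of_real (w * t))))"
      using integrable_norm[OF H] by simp
    show "AE u in lborel. integrable lborel (\<lambda>w. case (u, w) of (u, w) \<Rightarrow> H (u + w) * cnj (H u) * exp (\<i> * of_real (w * t)))"
      by (intro AE_I2) (use integrable_mult_iexp[OF integrable_mult_left[OF iH]] in simp)
  qed measurable
  have RF: "fourier R t = of_real ((norm (fourier H t))\<^sup>2)" for t
  proof -
    have "fourier R t = (LBINT w. \<integral>u. H (u + w) * cnj (H u) * exp (\<i> * of_real (w * t)) \<partial>lborel)"
      unfolding R_def by simp
    also have "\<dots> = (LBINT u. \<integral>w. H (u + w) * cnj (H u) * exp (\<i> * of_real (w * t)) \<partial>lborel)"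
      using lborel_pair.Fubini_integral[OF pint] by simp
    also have "\<dots> = (LBINT u. fourier H t * cnj (H u * exp (\<i> * of_real (u * t))))"
    proof (intro Bochner_Integration.integral_cong refl)
      fix u
      have "fourier H t = (LBINT w. H (u + w) * exp (\<i> * of_real ((u + w) * t)))"
        by (subst lborel_integral_real_affine[where c = 1 and t = u]) auto
      also have "\<dots> = (LBINT w. exp (\<i> * of_real (u * t)) * (H (u + w) * exp (\<i> * of_real (w * t))))"
        by (intro Bochner_Integration.integral_cong refl) (simp add: algebra_simps exp_add)
      also have "\<dots> = exp (\<i> * of_real (u * t)) * (LBINT w. H (u + w) * exp (\<i> * of_real (w * t)))"
        by (rule integral_mult_right_zero)
      finally have "fourier H t * cnj (H u * exp (\<i> * of_real (u * t)))
         = cnj (H u) * (LBINT w. H (u + w) * exp (\<i> * of_real (w * t))) * (exp (\<i> * of_real (u * t)) * exp (- (\<i> * of_real (u * t))))"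
        by (simp add: exp_cnj mult_ac)
      also have "\<dots> = cnj (H u) * (LBINT w. H (u + w) * exp (\<i> * of_real (w * t)))"
        by (simp add: exp_minus)
      also have "\<dots> = (LBINT w. H (u + w) * cnj (H u) * exp (\<i> * of_real (w * t)))"
        by (simp add: mult_ac flip: integral_mult_right_zero)
      finally show "(LBINT w. H (u + w) * cnj (H u) * exp (\<i> * of_real (w * t))) = fourier H t * cnj (H u * exp (\<i> * of_real (u * t)))" ..
    qed
    also have "\<dots> = fourier H t * cnj (fourier H t)"
    proof -
      have "(LBINT u. cnj (H u * exp (\<i> * of_real (u * t)))) = cnj (fourier H t)"
        by (rule Bochner_Integration.integral_cnj)
      thus ?thesis by (simp only: integral_mult_right_zero)
    qed
    finally show ?thesis by (simp only: complex_norm_square)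
  qed
  have gs: "(\<lambda>n. \<integral>t. fourier R t * of_real (exp (- (t / real (Suc n))\<^sup>2 / 2)) \<partial>lborel) \<longlonglongrightarrow> 2 * pi * R 0"
  proof (rule gauss_summability)
    show "integrable lborel R"
      using lborel_pair.integrable_snd[OF pint[of 0]] by (simp add: R_def)
    have B0: "B \<ge> 0" using norm_ge_zero[of "H 0"] B[of 0] by linarith
    have dom: "integrable lborel (\<lambda>u. B * norm (H u))" using H by (intro integrable_mult_right integrable_norm)
    have le: "norm (H (u + w) * cnj (H u)) \<le> B * norm (H u)" for u w
      using B B0 by (auto simp: norm_mult intro!: mult_right_mono)
    show "norm (R w) \<le> (LBINT u. B * norm (H u))" for w
      unfolding R_def
      by (rule norm_integral_le_integral[OF dom]) (use le in auto)
    show "isCont R 0"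
      unfolding continuous_at_sequentially o_def
    proof (intro allI impI)
      fix w :: "nat \<Rightarrow> real" assume w: "w \<longlonglongrightarrow> 0"
      show "(\<lambda>n. R (w n)) \<longlonglongrightarrow> R 0" unfolding R_def
      proof (rule integral_dominated_convergence[OF _ _ dom])
        show "AE u in lborel. (\<lambda>n. H (u + w n) * cnj (H u)) \<longlonglongrightarrow> H (u + 0) * cnj (H u)"
        proof (intro AE_I2 tendsto_mult tendsto_const)
          fix u
          have "isCont H (u + 0)" using cont by (simp add: continuous_on_eq_continuous_at)
          thus "(\<lambda>n. H (u + w n)) \<longlonglongrightarrow> H (u + 0)"
            by (rule isCont_tendsto_compose) (intro tendsto_intros w)
        qed
      qed (use le in auto)
    qed
  qed
  have R0: "R 0 = of_real (LBINT u. (norm (H u))\<^sup>2)"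
    unfolding R_def by (simp flip: complex_norm_square integral_complex_of_real of_real_power)
  have conv: "(LBINT t. fourier R t * of_real (exp (- (t / real (Suc n))\<^sup>2 / 2)))
      = complex_of_real (LBINT t. (norm (fourier H t))\<^sup>2 * exp (- (t / real (Suc n))\<^sup>2 / 2))" for n
    unfolding RF of_real_mult[symmetric] by (rule integral_complex_of_real)
  have "2 * pi * R 0 = of_real (2 * pi * (LBINT u. (norm (H u))\<^sup>2))"
    unfolding R0 by simp
  with gs have "(\<lambda>n. complex_of_real (LBINT t. (norm (fourier H t))\<^sup>2 * exp (- (t / real (Suc n))\<^sup>2 / 2)))
      \<longlonglongrightarrow> of_real (2 * pi * (LBINT u. (norm (H u))\<^sup>2))"
    unfolding conv by (simp only:)
  hence lim: "(\<lambda>n. \<integral>t. (norm (fourier H t))\<^sup>2 * exp (- (t / real (Suc n))\<^sup>2 / 2) \<partial>lborel)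
      \<longlonglongrightarrow> 2 * pi * (LBINT u. (norm (H u))\<^sup>2)"
    by (rule tendsto_of_real_iff[THEN iffD1])
  have int: "integrable lborel (\<lambda>t. (norm (fourier H t))\<^sup>2 * exp (- (t / real (Suc n))\<^sup>2 / 2))" for n
  proof (rule Bochner_Integration.integrable_bound[OF integrable_mult_right[OF integrable_gaussian_scaled[of "real (Suc n)"], of "(LBINT u. norm (H u))\<^sup>2"]])
    show "AE t in lborel. norm ((norm (fourier H t))\<^sup>2 * exp (- (t / real (Suc n))\<^sup>2 / 2))
       \<le> norm ((LBINT u. norm (H u))\<^sup>2 * exp (- (t / real (Suc n))\<^sup>2 / 2))"
      using norm_fourier_le[OF H] by (intro AE_I2) (auto simp: abs_mult intro!: mult_right_mono power_mono)
  qed auto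
  have mono: "AE t in lborel. mono (\<lambda>n. (norm (fourier H t))\<^sup>2 * exp (- (t / real (Suc n))\<^sup>2 / 2))"
    by (intro AE_I2 monoI mult_left_mono) (auto intro!: divide_left_mono power_mono simp: power_divide)
  have ptw: "AE t in lborel. (\<lambda>n. (norm (fourier H t))\<^sup>2 * exp (- (t / real (Suc n))\<^sup>2 / 2)) \<longlonglongrightarrow> (norm (fourier H t))\<^sup>2"
  proof (rule AE_I2)
    fix t :: real
    have "(\<lambda>n. t / real (Suc n)) \<longlonglongrightarrow> 0" by (rule LIMSEQ_Suc[OF lim_const_over_n])
    hence "(\<lambda>n. (norm (fourier H t))\<^sup>2 * exp (- (t / real (Suc n))\<^sup>2 / 2)) \<longlonglongrightarrow> (norm (fourier H t))\<^sup>2 * exp (- 0\<^sup>2 / 2)"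
      by (intro tendsto_intros) auto
    thus "(\<lambda>n. (norm (fourier H t))\<^sup>2 * exp (- (t / real (Suc n))\<^sup>2 / 2)) \<longlonglongrightarrow> (norm (fourier H t))\<^sup>2" by simp
  qed
  show "integrable lborel (\<lambda>t. (norm (fourier H t))\<^sup>2)"
    by (rule integrable_monotone_convergence[OF int mono ptw lim]) simp
  show "(LBINT t. (norm (fourier H t))\<^sup>2) = 2 * pi * (LBINT u. (norm (H u))\<^sup>2)"
    by (rule integral_monotone_convergence[OF int mono ptw lim]) simp
qed

section \<open>Laplace transforms of the kernels\<close>

text \<open>The half line is exhausted by the images under \<open>exp\<close> of the intervals from
  - (n + 1) to n + 1. Substitution holds on each of them, and monotone convergence passes to the
  supremum on both sides.\<close>

lemma nn_integral_Ioi_exp: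
  fixes f :: "real \<Rightarrow> ennreal"
  assumes [measurable]: "f \<in> borel_measurable borel"
  shows "(\<integral>\<^sup>+x. f x * indicator {0<..} x \<partial>lborel) = (\<integral>\<^sup>+t. f (exp t) * ennreal (exp t) \<partial>lborel)"
proof -
  let ?g = "\<lambda>n x. f x * indicator {exp (- real (Suc n))..exp (real (Suc n))} x"
  let ?h = "\<lambda>n t. f (exp t) * ennreal (exp t) * indicator {- real (Suc n)..real (Suc n)} t"
  have step: "(\<integral>\<^sup>+x. ?g n x \<partial>lborel) = (\<integral>\<^sup>+t. ?h n t \<partial>lborel)" for n
    by (rule nn_integral_substitution_aux) (auto intro!: derivative_eq_intros continuous_intros)
  have "(\<integral>\<^sup>+x. f x * indicator {0<..} x \<partial>lborel) = (\<integral>\<^sup>+x. (SUP n. ?g n x) \<partial>lborel)"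
  proof (rule nn_integral_cong)
    fix x :: real
    show "f x * indicator {0<..} x = (SUP n. ?g n x)"
    proof (cases "x > 0")
      case True
      obtain n :: nat where n: "\<bar>ln x\<bar> < real n" using reals_Archimedean2 by blast
      hence "- real (Suc n) \<le> ln x" "ln x \<le> real (Suc n)" by auto
      hence "exp (- real (Suc n)) \<le> x" "x \<le> exp (real (Suc n))"
        using True by (metis exp_le_cancel_iff exp_ln)+
      hence "?g n x = f x" by (simp add: indicator_def)
      hence "f x \<le> (SUP n. ?g n x)" by (metis (no_types, lifting) SUP_upper UNIV_I)
      moreover have "(SUP n. ?g n x) \<le> f x" by (intro SUP_least) (auto simp: indicator_def)
      ultimately show ?thesis using True by (simp add: antisym)
    next
      case False
      hence "x < exp y" for y using exp_gt_zero[of y] by linarith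
      hence g0: "?g n x = 0" for n by (auto simp: indicator_def not_le)
      have "(SUP n. ?g n x) = 0" by (simp only: g0) simp
      thus ?thesis using False by simp
    qed
  qed
  also have "\<dots> = (SUP n. \<integral>\<^sup>+x. ?g n x \<partial>lborel)"
  proof (rule nn_integral_monotone_convergence_SUP)
    have sub: "{exp (- real (Suc m))..exp (real (Suc m))} \<subseteq> {exp (- real (Suc n))..exp (real (Suc n))}" if "m \<le> n" for m n
      by (rule atLeastatMost_subset_iff[THEN iffD2]) (use that in simp)
    show "incseq ?g"
      unfolding incseq_def le_fun_def
      by (intro allI impI mult_left_mono indicator_leI) (blast intro: subsetD[OF sub] | simp)+
  qed measurable
  also have "\<dots> = (SUP n. \<integral>\<^sup>+t. ?h n t \<partial>lborel)" unfolding step ..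
  also have "\<dots> = (\<integral>\<^sup>+t. (SUP n. ?h n t) \<partial>lborel)"
    by (rule nn_integral_monotone_convergence_SUP[symmetric])
       (auto simp: incseq_def le_fun_def indicator_def)
  also have "\<dots> = (\<integral>\<^sup>+t. f (exp t) * ennreal (exp t) \<partial>lborel)"
  proof (rule nn_integral_cong)
    fix t :: real
    obtain n :: nat where n: "\<bar>t\<bar> < real n" using reals_Archimedean2 by blast
    hence "?h n t = f (exp t) * ennreal (exp t)" by (auto simp: indicator_def)
    hence "f (exp t) * ennreal (exp t) \<le> (SUP n. ?h n t)" by (metis (no_types, lifting) SUP_upper UNIV_I)
    moreover have "(SUP n. ?h n t) \<le> f (exp t) * ennreal (exp t)" by (intro SUP_least) (auto simp: indicator_def)
    ultimately show "(SUP n. ?h n t) = f (exp t) * ennreal (exp t)" by (rule antisym[rotated])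
  qed
  finally show ?thesis .
qed

text \<open>As an equality of measures the substitution transfers at once to integrability and to
  integrals with values in any Banach space. A signed rate c covers growing as well as decaying
  exponentials; the values 1, - 1 and - 2 occur below.\<close>

lemma distr_exp_lborel:
  assumes c: "c \<noteq> 0"
  shows "distr (density lborel (\<lambda>t. ennreal (\<bar>c\<bar> * exp (c * t)))) borel (\<lambda>t. exp (c * t))
       = density lborel (indicator {0<..})"
proof (rule measure_eqI)
  fix A assume "A \<in> sets (distr (density lborel (\<lambda>t. ennreal (\<bar>c\<bar> * exp (c * t)))) borel (\<lambda>t. exp (c * t)))"
  hence [measurable]: "A \<in> sets borel" by simp
  have [measurable]: "(\<lambda>t. exp (c * t)) -` A \<in> sets borel"
    using measurable_sets_borel[of "\<lambda>t. exp (c * t)" borel A] by simp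
  have "emeasure (distr (density lborel (\<lambda>t. ennreal (\<bar>c\<bar> * exp (c * t)))) borel (\<lambda>t. exp (c * t))) A
      = (\<integral>\<^sup>+t. ennreal \<bar>c\<bar> * (indicator A (exp (0 + c * t)) * ennreal (exp (0 + c * t))) \<partial>lborel)"
    by (subst emeasure_distr, measurable, subst emeasure_density)
       (auto intro!: nn_integral_cong simp: indicator_def ennreal_mult measurable_sets_borel)
  also have "\<dots> = ennreal \<bar>c\<bar> * (\<integral>\<^sup>+t. indicator A (exp (0 + c * t)) * ennreal (exp (0 + c * t)) \<partial>lborel)"
    by (rule nn_integral_cmult) measurable
  also have "\<dots> = (\<integral>\<^sup>+t. indicator A (exp t) * ennreal (exp t) \<partial>lborel)"
    by (rule nn_integral_real_affine[symmetric, OF _ c, where t = 0]) measurable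
  also have "\<dots> = (\<integral>\<^sup>+x. indicator A x * indicator {0<..} x \<partial>lborel)"
    by (rule nn_integral_Ioi_exp[symmetric]) measurable
  also have "\<dots> = emeasure (density lborel (indicator {0<..})) A"
    by (subst emeasure_density) (auto simp: mult.commute)
  finally show "emeasure (distr (density lborel (\<lambda>t. ennreal (\<bar>c\<bar> * exp (c * t)))) borel (\<lambda>t. exp (c * t))) A
      = emeasure (density lborel (indicator {0<..})) A" .
qed simp

lemma
  fixes f :: "real \<Rightarrow> 'a::{banach, second_countable_topology}"
  assumes c: "c \<noteq> 0" and [measurable]: "f \<in> borel_measurable borel"
  shows integrable_exp_substitution: "integrable lborel (\<lambda>x. indicator {0<..} x *\<^sub>R f x) \<longleftrightarrow>
      integrable lborel (\<lambda>t. (\<bar>c\<bar> * exp (c * t)) *\<^sub>R f (exp (c * t)))"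
    and integral_exp_substitution: "(LBINT x. indicator {0<..} x *\<^sub>R f x)
      = (LBINT t. (\<bar>c\<bar> * exp (c * t)) *\<^sub>R f (exp (c * t)))"
proof -
  let ?M = "density lborel (\<lambda>t. ennreal (\<bar>c\<bar> * exp (c * t)))"
  have D: "density lborel (indicator {0<..}) = density lborel (\<lambda>x. ennreal (indicator {0<..} x))"
    by (rule arg_cong[where f = "density lborel"]) (auto simp: indicator_def fun_eq_iff)
  have "integrable (density lborel (indicator {0<..})) f \<longleftrightarrow> integrable ?M (\<lambda>t. f (exp (c * t)))"
    unfolding distr_exp_lborel[OF c, symmetric] by (subst integrable_distr_eq) auto
  thus "integrable lborel (\<lambda>x. indicator {0<..} x *\<^sub>R f x) \<longleftrightarrow>
      integrable lborel (\<lambda>t. (\<bar>c\<bar> * exp (c * t)) *\<^sub>R f (exp (c * t)))"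
    unfolding D by (simp add: integrable_density)
  have "integral\<^sup>L (density lborel (indicator {0<..})) f = integral\<^sup>L ?M (\<lambda>t. f (exp (c * t)))"
    unfolding distr_exp_lborel[OF c, symmetric] by (subst integral_distr) auto
  thus "(LBINT x. indicator {0<..} x *\<^sub>R f x)
      = (LBINT t. (\<bar>c\<bar> * exp (c * t)) *\<^sub>R f (exp (c * t)))"
    unfolding D by (simp add: integral_density)
qed

section \<open>Exponential convolutions and the building blocks g and g1\<close>

lemma has_bochner_integral_exp_Ioi:
  assumes c: "c > 0"
  shows "has_bochner_integral lborel (\<lambda>x::real. if 0 < x then exp (- c * x) else 0) (1 / c)"
proof -
  have "has_bochner_integral lborel (\<lambda>x. if 0 < x then exp ((1 - 1) * of_real (ln x)) * of_real (exp (- c * x)) else 0 :: complex)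
      (Gamma 1 * exp (- 1 * of_real (ln c)))"
    using c by (intro Gamma_integral_exp_ln) auto
  moreover have "Re (Gamma 1 * exp (- 1 * of_real (ln c))) = 1 / c"
    using c by (simp add: exp_minus exp_of_real divide_inverse flip: of_real_inverse)
  ultimately have "has_bochner_integral lborel (\<lambda>x. Re (if 0 < x then exp ((1 - 1) * of_real (ln x)) * of_real (exp (- c * x)) else 0 :: complex)) (1 / c)"
    by (drule_tac has_bochner_integral_Re) (simp only:)
  moreover have "Re (if 0 < x then exp ((1 - 1) * of_real (ln x)) * of_real (exp (- c * x)) else 0 :: complex)
      = (if 0 < x then exp (- c * x) else 0)" for x
    by simp
  ultimately show ?thesis by simp
qed

text \<open>Convolution with \<open>exp (l * t)\<close> on the half line, that is, the inverse of
  the operator d/ds - l with zero initial value; under the Laplace transform it divides by \<sigma>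
  - l. Both the inner integral of \<open>g_fun\<close> (l = 1 - \<omega>) and the average in
  \<open>g1_fun\<close> (l = 1/2) are of this type.\<close>

definition exp_conv :: "real \<Rightarrow> (real \<Rightarrow> real) \<Rightarrow> real \<Rightarrow> real" where
  "exp_conv l p s = (LBINT r. indicator {0<..<s} r * (exp (l * (s - r)) * p r))"

lemma exp_conv_measurable [measurable]:
  assumes [measurable]: "p \<in> borel_measurable borel"
  shows "exp_conv l p \<in> borel_measurable borel"
proof -
  have "(\<lambda>s. \<integral>r. (if 0 < r \<and> r < s then exp (l * (s - r)) * p r else 0) \<partial>lborel) \<in> borel_measurable borel"
    by measurable
  also have "(\<lambda>s. \<integral>r. (if 0 < r \<and> r < s then exp (l * (s - r)) * p r else 0) \<partial>lborel) = exp_conv l p"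
    unfolding exp_conv_def by (intro ext Bochner_Integration.integral_cong) (auto simp: indicator_def)
  finally show ?thesis .
qed

lemma exp_conv_nonpos: "s \<le> 0 \<Longrightarrow> exp_conv l p s = 0"
  unfolding exp_conv_def by (simp add: indicator_def)

lemma has_bochner_integral_exp_conv:
  assumes p0: "\<And>s. s \<le> 0 \<Longrightarrow> p s = 0" and [measurable]: "p \<in> borel_measurable borel"
    and p: "has_bochner_integral lborel (\<lambda>s. p s * exp (- \<sigma> * s)) P" and \<sigma>: "\<sigma> > l"
  shows "has_bochner_integral lborel (\<lambda>s. exp_conv l p s * exp (- \<sigma> * s)) (P / (\<sigma> - l))"
proof -
  define f where "f = (\<lambda>r s. p r * exp (- \<sigma> * r) * (if 0 < s - r then exp (- (\<sigma> - l) * (s - r)) else 0))"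
  have [measurable]: "case_prod f \<in> borel_measurable (lborel \<Otimes>\<^sub>M lborel)" unfolding f_def by measurable
  have E: "has_bochner_integral lborel (\<lambda>s. if 0 < s - r then exp (- (\<sigma> - l) * (s - r)) else 0) (1 / (\<sigma> - l))" for r
  proof -
    have "has_bochner_integral lborel (\<lambda>s. if 0 < - r + 1 * s then exp (- (\<sigma> - l) * (- r + 1 * s)) else 0) ((1 / (\<sigma> - l)) /\<^sub>R \<bar>1\<bar>)"
      using lborel_has_bochner_integral_real_affine_iff[of 1 "\<lambda>x. if 0 < x then exp (- (\<sigma> - l) * x) else 0" "1 / (\<sigma> - l)" "- r"]
        has_bochner_integral_exp_Ioi[of "\<sigma> - l"] \<sigma> by simp
    thus ?thesis by (simp only: mult_1 uminus_add_conv_diff abs_one inverse_1 scaleR_one)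
  qed
  have F: "has_bochner_integral lborel (f r) (p r * exp (- \<sigma> * r) * (1 / (\<sigma> - l)))" for r
    unfolding f_def by (intro has_bochner_integral_mult_right E)
  have nF: "(LBINT s. norm (f r s)) = norm (p r * exp (- \<sigma> * r)) * (1 / (\<sigma> - l))" for r
  proof -
    have "norm (f r s) = norm (p r * exp (- \<sigma> * r)) * (if 0 < s - r then exp (- (\<sigma> - l) * (s - r)) else 0)" for s
      by (simp add: f_def abs_mult)
    thus ?thesis using E[of r] by (simp add: has_bochner_integral_iff)
  qed
  have int: "integrable (lborel \<Otimes>\<^sub>M lborel) (case_prod f)"
  proof (rule lborel_pair.Fubini_integrable)
    show "integrable lborel (\<lambda>r. \<integral>s. norm (case (r, s) of (r, s) \<Rightarrow> f r s) \<partial>lborel)"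
      using p unfolding prod.case nF by (intro integrable_mult_left integrable_norm) (simp add: has_bochner_integral_iff)
    show "AE r in lborel. integrable lborel (\<lambda>s. case (r, s) of (r, s) \<Rightarrow> f r s)"
      using F by (simp add: has_bochner_integral_iff)
  qed fact
  have slice: "(LBINT r. f r s) = exp_conv l p s * exp (- \<sigma> * s)" for s
  proof -
    have "(LBINT r. f r s) = (LBINT r. indicator {0<..<s} r * (exp (l * (s - r)) * p r) * exp (- \<sigma> * s))"
    proof (intro Bochner_Integration.integral_cong refl)
      fix r
      have "exp (- \<sigma> * r) * exp (- (\<sigma> - l) * (s - r)) = exp (l * (s - r)) * exp (- \<sigma> * s)"
        by (simp add: algebra_simps flip: exp_add)
      thus "f r s = indicator {0<..<s} r * (exp (l * (s - r)) * p r) * exp (- \<sigma> * s)"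
        using p0[of r] by (auto simp: f_def indicator_def mult_ac)
    qed
    thus ?thesis unfolding exp_conv_def by simp
  qed
  have "integrable lborel (\<lambda>s. \<integral>r. f r s \<partial>lborel)"
    using lborel_pair.integrable_snd[OF int] by simp
  moreover have "(LBINT s. (LBINT r. f r s)) = P / (\<sigma> - l)"
    using lborel_pair.Fubini_integral[OF int] F p by (simp add: has_bochner_integral_iff)
  ultimately show ?thesis unfolding slice by (simp add: has_bochner_integral_iff)
qed

text \<open>The first term of \<open>g_fun\<close>, without its constant, at x = exp (- s).\<close>

definition B_log :: "real \<Rightarrow> real \<Rightarrow> real" where
  "B_log \<omega> s = (if 0 < s then exp (- (2 - \<omega>) * s) * (1 - exp (- 2 * s)) powr (\<omega> - 1) else 0)"

definition g_log :: "real \<Rightarrow> real \<Rightarrow> real" where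
  "g_log \<omega> s = (if 0 < s then g_fun \<omega> (exp (- s)) else 0)"

definition g1_log :: "real \<Rightarrow> real \<Rightarrow> real" where
  "g1_log \<omega> s = (if 0 < s then g1_fun \<omega> (exp (- s)) else 0)"

lemma B_log_measurable [measurable]: "B_log \<omega> \<in> borel_measurable borel"
  unfolding B_log_def by measurable

text \<open>With t = exp (- 2 * s) the integral becomes Euler's Beta integral; the Jacobian accounts
  for the final division by 2.\<close>

lemma has_bochner_integral_B_log:
  assumes \<omega>: "\<omega> > 0" and \<sigma>: "\<sigma> > \<omega>"
  shows "has_bochner_integral lborel (\<lambda>s. B_log \<omega> s * exp (- \<sigma> * s)) (Beta ((\<sigma> - \<omega>) / 2 + 1) \<omega> / 2)"
proof -
  define a where "a = (\<sigma> - \<omega>) / 2 + 1"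
  have a: "a > 0" unfolding a_def using \<sigma> by (intro add_pos_pos) auto
  let ?f = "\<lambda>t. indicator {0..1} t * (t powr (a - 1) * (1 - t) powr (\<omega> - 1))"
  have [measurable]: "?f \<in> borel_measurable borel" by measurable
  have nn: "(\<integral>\<^sup>+t. ennreal (?f t) \<partial>lborel) = ennreal (Beta a \<omega>)"
    using nn_integral_has_integral_lebesgue[OF _ has_integral_Beta_real[OF a \<omega>]] by simp
  have Bp: "Beta a \<omega> > 0" using a \<omega> by (simp add: Beta_def)
  have hb: "has_bochner_integral lborel ?f (Beta a \<omega>)"
    using nn Bp by (intro has_bochner_integral_nn_integral) auto
  have eq: "indicator {0<..} t *\<^sub>R ?f t = ?f t" for t by (auto simp: indicator_def)
  have "has_bochner_integral lborel (\<lambda>s. (\<bar>- 2\<bar> * exp (- 2 * s)) *\<^sub>R ?f (exp (- 2 * s))) (Beta a \<omega>)"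
    using hb integrable_exp_substitution[of "- 2" ?f] integral_exp_substitution[of "- 2" ?f]
    unfolding eq by (simp add: has_bochner_integral_iff)
  hence "has_bochner_integral lborel (\<lambda>s. (\<bar>- 2\<bar> * exp (- 2 * s)) *\<^sub>R ?f (exp (- 2 * s)) / 2) (Beta a \<omega> / 2)"
    by (rule has_bochner_integral_divide_zero)
  moreover have "AE s in lborel. (\<bar>- 2\<bar> * exp (- 2 * s)) *\<^sub>R ?f (exp (- 2 * s)) / 2 = B_log \<omega> s * exp (- \<sigma> * s)"
    using AE_lborel_singleton[of "0::real"]
  proof eventually_elim
    case (elim s)
    have "exp (- 2 * s) * exp (- 2 * s) powr (a - 1) = exp (- (2 - \<omega>) * s) * exp (- \<sigma> * s)"
    proof -
      have "- 2 * s + (a - 1) * (- 2 * s) = - (2 - \<omega>) * s + - \<sigma> * s" unfolding a_def by (simp add: field_simps)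
      thus ?thesis by (simp add: powr_def flip: exp_add)
    qed
    thus ?case using elim by (auto simp: B_log_def indicator_def mult_ac)
  qed
  ultimately show ?thesis unfolding a_def by (subst (asm) has_bochner_integral_cong_AE) auto
qed

text \<open>Put x = exp (- s) and t = exp (- 2 * r). The range from \<open>x\<^sup>2\<close> to 1
  becomes 0 < r < s, the Jacobian supplies the 2, and the prefactor
  \<open>x powr (\<omega> - 1)\<close> cancels the exponential left over when the integrand is
  written as a convolution in s - r.\<close>

lemma g_log_eq:
  assumes \<omega>: "\<omega> > 0"
  shows "g_log \<omega> = (\<lambda>s. 2 * pi powr \<omega> / Gamma \<omega> * (B_log \<omega> s - 2 * \<omega> * exp_conv (1 - \<omega>) (B_log \<omega>) s))"
proof
  fix s :: real
  show "g_log \<omega> s = 2 * pi powr \<omega> / Gamma \<omega> * (B_log \<omega> s - 2 * \<omega> * exp_conv (1 - \<omega>) (B_log \<omega>) s)"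
  proof (cases "s > 0")
    case True
    define x where "x = exp (- s)"
    have x: "0 < x" "x < 1" using True by (auto simp: x_def)
    have x2: "x\<^sup>2 = exp (- 2 * s)" by (simp add: x_def power2_eq_square flip: exp_add)
    let ?f = "\<lambda>t. indicator {x\<^sup>2..1} t * (t powr (1/2 - \<omega>) * (1 - t) powr (\<omega> - 1))"
    have "set_lebesgue_integral lborel {x\<^sup>2..1} (\<lambda>t. t powr (1/2 - \<omega>) * (1 - t) powr (\<omega> - 1))
       = (LBINT t. indicator {0<..} t *\<^sub>R ?f t)"
      unfolding set_lebesgue_integral_def using x
      by (intro Bochner_Integration.integral_cong refl)
         (auto simp: indicator_def not_less dest: order_trans[of "x\<^sup>2" _ 0])
    also have "\<dots> = (LBINT r. (\<bar>- 2\<bar> * exp (- 2 * r)) *\<^sub>R ?f (exp (- 2 * r)))"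
      by (rule integral_exp_substitution) auto
    also have "\<dots> = (LBINT r. 2 * exp (- (1 - \<omega>) * s) * (indicator {0<..<s} r * (exp ((1 - \<omega>) * (s - r)) * B_log \<omega> r)))"
    proof (rule integral_cong_AE)
      show "AE r in lborel. (\<bar>- 2\<bar> * exp (- 2 * r)) *\<^sub>R ?f (exp (- 2 * r))
         = 2 * exp (- (1 - \<omega>) * s) * (indicator {0<..<s} r * (exp ((1 - \<omega>) * (s - r)) * B_log \<omega> r))"
        \<comment> \<open>The closed range of t and the open range of r differ at the two endpoints
          r = 0 and r = s.\<close>
        using AE_lborel_singleton[of "0::real"] AE_lborel_singleton[of s]
      proof eventually_elim
        case (elim r)
        have "exp (- 2 * r) * exp (- 2 * r) powr (1/2 - \<omega>) = exp (- (1 - \<omega>) * s) * (exp ((1 - \<omega>) * (s - r)) * exp (- (2 - \<omega>) * r))"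
          by (simp add: powr_def algebra_simps flip: exp_add)
        thus ?case using elim by (auto simp: B_log_def indicator_def x2 mult_ac)
      qed
    qed measurable
    also have "\<dots> = 2 * exp (- (1 - \<omega>) * s) * exp_conv (1 - \<omega>) (B_log \<omega>) s"
      unfolding exp_conv_def by (rule integral_mult_right_zero)
    finally have I: "set_lebesgue_integral lborel {x\<^sup>2..1} (\<lambda>t. t powr (1/2 - \<omega>) * (1 - t) powr (\<omega> - 1))
        = 2 * exp (- (1 - \<omega>) * s) * exp_conv (1 - \<omega>) (B_log \<omega>) s" .
    have e1: "x powr (2 - \<omega>) * (1 - x\<^sup>2) powr (\<omega> - 1) = B_log \<omega> s"
      using True by (simp add: B_log_def x2) (simp add: x_def powr_def algebra_simps)
    have e2: "x powr (\<omega> - 1) * exp (- (1 - \<omega>) * s) = 1"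
      by (simp add: x_def powr_def algebra_simps flip: exp_add)
    have "g_log \<omega> s = 2 * pi powr \<omega> / Gamma \<omega> * (x powr (2 - \<omega>) * (1 - x\<^sup>2) powr (\<omega> - 1)
         - \<omega> * x powr (\<omega> - 1) * (2 * exp (- (1 - \<omega>) * s) * exp_conv (1 - \<omega>) (B_log \<omega>) s))"
      using True x unfolding g_log_def x_def[symmetric] g_fun_def I by simp
    also have "\<omega> * x powr (\<omega> - 1) * (2 * exp (- (1 - \<omega>) * s) * exp_conv (1 - \<omega>) (B_log \<omega>) s)
        = 2 * \<omega> * exp_conv (1 - \<omega>) (B_log \<omega>) s * (x powr (\<omega> - 1) * exp (- (1 - \<omega>) * s))"
      by (simp only: mult_ac)
    finally show ?thesis unfolding e1 e2 by simp
  qed (simp add: g_log_def B_log_def exp_conv_nonpos)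
qed

lemma g_log_measurable: "\<omega> > 0 \<Longrightarrow> g_log \<omega> \<in> borel_measurable borel"
  unfolding g_log_eq by measurable

text \<open>The last quotient is \<open>1 - 2 * \<omega> / (\<sigma> - 1 + \<omega>)\<close>, the
  joint effect of the Beta term and its convolution. It will become the quotient of the factors s -
  1 in the two values of \<open>xi\<close>.\<close>

definition g_laplace :: "real \<Rightarrow> real \<Rightarrow> real" where
  "g_laplace \<omega> \<sigma> = pi powr \<omega> / Gamma \<omega> * Beta ((\<sigma> - \<omega>) / 2 + 1) \<omega> * (\<sigma> - 1 - \<omega>) / (\<sigma> - 1 + \<omega>)"

lemma has_bochner_integral_g_log:
  assumes \<omega>: "\<omega> > 0" and \<sigma>: "\<sigma> > \<omega> + 1"
  shows "has_bochner_integral lborel (\<lambda>s. g_log \<omega> s * exp (- \<sigma> * s)) (g_laplace \<omega> \<sigma>)"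
proof -
  have B: "has_bochner_integral lborel (\<lambda>s. B_log \<omega> s * exp (- \<sigma> * s)) (Beta ((\<sigma> - \<omega>) / 2 + 1) \<omega> / 2)" (is "has_bochner_integral _ _ ?P")
    using assms by (intro has_bochner_integral_B_log) auto
  have C: "has_bochner_integral lborel (\<lambda>s. exp_conv (1 - \<omega>) (B_log \<omega>) s * exp (- \<sigma> * s)) (?P / (\<sigma> - (1 - \<omega>)))"
    using \<sigma> \<omega> by (intro has_bochner_integral_exp_conv B) (auto simp: B_log_def)
  have "has_bochner_integral lborel (\<lambda>s. 2 * pi powr \<omega> / Gamma \<omega> * (B_log \<omega> s * exp (- \<sigma> * s) - 2 * \<omega> * (exp_conv (1 - \<omega>) (B_log \<omega>) s * exp (- \<sigma> * s))))
     (2 * pi powr \<omega> / Gamma \<omega> * (?P - 2 * \<omega> * (?P / (\<sigma> - (1 - \<omega>)))))"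
    by (intro has_bochner_integral_mult_right has_bochner_integral_diff B C)
  moreover have "2 * pi powr \<omega> / Gamma \<omega> * (?P - 2 * \<omega> * (?P / (\<sigma> - (1 - \<omega>)))) = g_laplace \<omega> \<sigma>"
  proof -
    have "\<sigma> - 1 + \<omega> \<noteq> 0" using \<sigma> \<omega> by auto
    moreover have "Gamma \<omega> \<noteq> 0" by (metis Gamma_real_pos less_irrefl \<omega>)
    ultimately show ?thesis by (simp add: g_laplace_def divide_simps) (simp add: algebra_simps)?
  qed
  ultimately show ?thesis unfolding g_log_eq[OF \<omega>] by (simp add: algebra_simps)
qed

text \<open>With y = exp (- r) the measure dy / y turns into dr and \<open>sqrt (y / x)\<close> into
  \<open>exp ((s - r) / 2)\<close>. The rate 1/2 is the source of the additional divisor \<sigma> -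
  1/2.\<close>

lemma g1_log_eq:
  assumes \<omega>: "\<omega> > 0"
  shows "g1_log \<omega> = exp_conv (1/2) (g_log \<omega>)"
proof
  fix s :: real
  note [measurable] = g_log_measurable[OF \<omega>]
  show "g1_log \<omega> s = exp_conv (1/2) (g_log \<omega>) s"
  proof (cases "s > 0")
    case True
    define x where "x = exp (- s)"
    have x: "0 < x" "x < 1" using True by (auto simp: x_def)
    let ?f = "\<lambda>y. indicator {x..1} y * (sqrt (y / x) * g_log \<omega> (- ln y) / y)"
    have "g1_log \<omega> s = set_lebesgue_integral lborel {x..1} (\<lambda>y. sqrt (y / x) * g_fun \<omega> y / y)"
      using True x by (simp add: g1_log_def g1_fun_def x_def)
    also have "\<dots> = (LBINT y. indicator {0<..} y *\<^sub>R ?f y)"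
      unfolding set_lebesgue_integral_def
    proof (intro Bochner_Integration.integral_cong refl)
      fix y :: real
      have "g_fun \<omega> y = g_log \<omega> (- ln y)" if "0 < y" "y \<le> 1"
        using that by (cases "y = 1") (auto simp: g_log_def g_fun_def)
      thus "indicator {x..1} y *\<^sub>R (sqrt (y / x) * g_fun \<omega> y / y) = indicator {0<..} y *\<^sub>R ?f y"
        using x by (auto simp: indicator_def)
    qed
    also have "\<dots> = (LBINT r. (\<bar>- 1\<bar> * exp (- 1 * r)) *\<^sub>R ?f (exp (- 1 * r)))"
      by (rule integral_exp_substitution) auto
    also have "\<dots> = exp_conv (1/2) (g_log \<omega>) s"
      unfolding exp_conv_def
    proof (rule integral_cong_AE)
      show "AE r in lborel. (\<bar>- 1\<bar> * exp (- 1 * r)) *\<^sub>R ?f (exp (- 1 * r)) = indicator {0<..<s} r * (exp (1 / 2 * (s - r)) * g_log \<omega> r)"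
        using AE_lborel_singleton[of "0::real"] AE_lborel_singleton[of s]
      proof eventually_elim
        case (elim r)
        have "sqrt (exp (- r) / x) = exp (1 / 2 * (s - r))"
          by (rule real_sqrt_unique) (auto simp: x_def power2_eq_square exp_diff[symmetric] simp flip: exp_add)
        moreover have "x \<le> exp (- r) \<longleftrightarrow> r \<le> s" by (simp add: x_def)
        ultimately show ?case using elim by (auto simp: indicator_def)
      qed
    qed measurable
    finally show ?thesis .
  qed (simp add: g1_log_def exp_conv_nonpos)
qed

lemma g1_log_measurable: "\<omega> > 0 \<Longrightarrow> g1_log \<omega> \<in> borel_measurable borel"
  using g_log_measurable by (simp add: g1_log_eq)

lemma has_bochner_integral_g1_log:
  assumes \<omega>: "\<omega> > 0" and \<sigma>: "\<sigma> > \<omega> + 1"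
  shows "has_bochner_integral lborel (\<lambda>s. g1_log \<omega> s * exp (- \<sigma> * s)) (g_laplace \<omega> \<sigma> / (\<sigma> - 1/2))"
  unfolding g1_log_eq[OF \<omega>]
  using assms by (intro has_bochner_integral_exp_conv has_bochner_integral_g_log g_log_measurable) (auto simp: g_log_def)

text \<open>K is \<open>exp (- t)\<close> times a superposition of the translates of p by ln n, so
  its transform is that of p times the Dirichlet series of \<open>c_coef \<omega>\<close>. Leaving p
  abstract treats h and h1 in one stroke.\<close>

lemma has_bochner_integral_dirichlet_kernel:
  assumes \<omega>: "\<omega> > 0" and \<sigma>: "\<sigma> > \<omega> + 1"
    and p: "has_bochner_integral lborel (\<lambda>s. p s * exp (- \<sigma> * s)) P"
    and p0: "\<And>s. s \<le> 0 \<Longrightarrow> p s = 0" and [measurable]: "p \<in> borel_measurable borel"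
    and K: "\<And>t. K t = (if 0 < t then exp (- t) * (\<Sum>n=1..nat \<lfloor>exp t\<rfloor>. c_coef \<omega> n * p (t - ln (real n))) else 0)"
  shows "K \<in> borel_measurable borel"
    and "has_bochner_integral lborel (\<lambda>t. K t * exp ((1 - \<sigma>) * t)) (zetar (\<sigma> - \<omega>) / zetar (\<sigma> + \<omega>) * P)"
proof -
  define f where "f = (\<lambda>n t. c_coef \<omega> (Suc n) * p (t - ln (real (Suc n))))"
  have K': "K t = exp (- t) * (\<Sum>n. f n t)" and fin: "finite {n. f n t \<noteq> 0}" for t
  proof -
    let ?N = "nat \<lfloor>exp t\<rfloor>"
    \<comment> \<open>For n + 1 \<ge> exp t the argument t - ln (n + 1) is nonpositive, where p
      vanishes. The truncated sum thus equals the full series, which has only finitely many nonzero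
      terms at each t.\<close>
    have z: "f n t = 0" if "n \<notin> {..<?N}" for n
    proof -
      have "real (Suc n) \<ge> exp t" using that by (simp add: not_less) linarith
      hence "ln (real (Suc n)) \<ge> t" by (metis ln_exp ln_le_cancel_iff exp_gt_zero of_nat_0_less_iff zero_less_Suc)
      thus ?thesis using p0 by (simp add: f_def)
    qed
    show "finite {n. f n t \<noteq> 0}" by (rule finite_subset[of _ "{..<?N}"]) (use z in auto)
    have "(\<Sum>n. f n t) = (\<Sum>n<?N. f n t)" by (rule suminf_finite) (use z in auto)
    also have "\<dots> = (\<Sum>n=1..?N. c_coef \<omega> n * p (t - ln (real n)))"
      unfolding f_def by (rule sum.reindex_bij_witness[of _ "\<lambda>n. n - 1" Suc]) auto
    finally show "K t = exp (- t) * (\<Sum>n. f n t)"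
    proof (cases "0 < t")
      case False
      have "f n t = 0" for n
      proof -
        have "0 \<le> ln (real (Suc n))" by (rule ln_ge_zero) simp
        with False have "t - ln (real (Suc n)) \<le> 0" by linarith
        thus ?thesis by (simp add: f_def p0 del: of_nat_Suc)
      qed
      thus ?thesis using False K by simp
    qed (simp add: K)
  qed
  have fm [measurable]: "f n \<in> borel_measurable borel" for n unfolding f_def by measurable
  have "(\<lambda>t. exp (- t) * (\<Sum>n. f n t)) \<in> borel_measurable borel" by measurable
  thus Km: "K \<in> borel_measurable borel" unfolding K'[abs_def] .
  define q where "q = (\<lambda>n t. f n t * exp (- \<sigma> * t))"
  have qb: "has_bochner_integral lborel (\<lambda>t. q n t) (c_coef \<omega> (Suc n) * real (Suc n) powr (- \<sigma>) * P)"
    and qn: "(LBINT t. norm (q n t)) = \<bar>c_coef \<omega> (Suc n) * real (Suc n) powr (- \<sigma>)\<bar> * (LBINT s. norm (p s * exp (- \<sigma> * s)))"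
    and qi: "integrable lborel (\<lambda>t. q n t)" for n
  proof -
    let ?L = "ln (real (Suc n))" and ?d = "c_coef \<omega> (Suc n) * real (Suc n) powr (- \<sigma>)"
    \<comment> \<open>Shifting t by ln (n + 1) extracts the power with exponent - \<sigma> from the
      weight.\<close>
    have e: "q n t = ?d * (p (- ?L + 1 * t) * exp (- \<sigma> * (- ?L + 1 * t)))" for t
    proof -
      have "exp (- \<sigma> * t) = real (Suc n) powr (- \<sigma>) * exp (- \<sigma> * (- ?L + 1 * t))"
        by (simp add: powr_def algebra_simps flip: exp_add)
      thus ?thesis by (simp add: q_def f_def add.commute[of "- ln _"])
    qed
    have "has_bochner_integral lborel (\<lambda>t. p (- ?L + 1 * t) * exp (- \<sigma> * (- ?L + 1 * t))) (P /\<^sub>R \<bar>1\<bar>)"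
      using lborel_has_bochner_integral_real_affine_iff[of 1 "\<lambda>s. p s * exp (- \<sigma> * s)" P "- ?L"] p by simp
    hence h: "has_bochner_integral lborel (\<lambda>t. p (- ?L + 1 * t) * exp (- \<sigma> * (- ?L + 1 * t))) P" by simp
    show 1: "has_bochner_integral lborel (\<lambda>t. q n t) (?d * P)"
      unfolding e by (rule has_bochner_integral_mult_right[OF h])
    show "integrable lborel (\<lambda>t. q n t)" using 1 by (simp add: has_bochner_integral_iff)
    have "(LBINT t. norm (q n t)) = \<bar>?d\<bar> * (LBINT t. norm (p (- ?L + 1 * t) * exp (- \<sigma> * (- ?L + 1 * t))))"
      unfolding e real_norm_def abs_mult[of ?d] by (rule integral_mult_right_zero)
    also have "(LBINT t. norm (p (- ?L + 1 * t) * exp (- \<sigma> * (- ?L + 1 * t)))) = (LBINT s. norm (p s * exp (- \<sigma> * s)))"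
      by (subst lborel_integral_real_affine[of 1 "\<lambda>s. norm (p s * exp (- \<sigma> * s))" "- ?L"]) auto
    finally show "(LBINT t. norm (q n t)) = \<bar>?d\<bar> * (LBINT s. norm (p s * exp (- \<sigma> * s)))" .
  qed
  have sq: "summable (\<lambda>n. norm (q n t))" for t
    by (rule summable_finite[OF fin[of t]]) (auto simp: q_def)
  have S: "summable (\<lambda>n. \<integral>t. norm (q n t) \<partial>lborel)"
    unfolding qn by (intro summable_mult2 summable_c_coef assms)
  have "integrable lborel (\<lambda>t. \<Sum>n. q n t)"
    using qi sq S by (intro integrable_suminf) auto
  moreover have "(\<lambda>n. \<integral>t. q n t \<partial>lborel) sums (LBINT t. (\<Sum>n. q n t))"
    using qi sq S by (intro sums_integral) auto
  moreover have "(\<Sum>n. q n t) = K t * exp ((1 - \<sigma>) * t)" for t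
  proof -
    have "summable (\<lambda>n. f n t)" by (rule summable_finite[OF fin[of t]]) auto
    hence "(\<Sum>n. q n t) = (\<Sum>n. f n t) * exp (- \<sigma> * t)" unfolding q_def by (rule suminf_mult2[symmetric])
    also have "\<dots> = K t * exp ((1 - \<sigma>) * t)"
      unfolding K' by (simp add: algebra_simps flip: exp_add)
    finally show ?thesis .
  qed
  moreover have "(\<lambda>n. \<integral>t. q n t \<partial>lborel) sums (zetar (\<sigma> - \<omega>) / zetar (\<sigma> + \<omega>) * P)"
  proof -
    have "(\<lambda>n. c_coef \<omega> (Suc n) * real (Suc n) powr (- \<sigma>)) sums (zetar (\<sigma> - \<omega>) / zetar (\<sigma> + \<omega>))"
      using suminf_c_coef[OF \<sigma> \<omega>] summable_c_coef[OF \<sigma> \<omega>, THEN summable_rabs_cancel] by (simp add: sums_iff)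
    hence "(\<lambda>n. c_coef \<omega> (Suc n) * real (Suc n) powr (- \<sigma>) * P) sums (zetar (\<sigma> - \<omega>) / zetar (\<sigma> + \<omega>) * P)"
      by (rule sums_mult2)
    moreover have "(LBINT t. q n t) = c_coef \<omega> (Suc n) * real (Suc n) powr (- \<sigma>) * P" for n
      using qb[of n] by (simp only: has_bochner_integral_iff)
    ultimately show ?thesis by simp
  qed
  ultimately show "has_bochner_integral lborel (\<lambda>t. K t * exp ((1 - \<sigma>) * t)) (zetar (\<sigma> - \<omega>) / zetar (\<sigma> + \<omega>) * P)"
    by (auto simp: has_bochner_integral_iff dest: sums_unique2)
qed

section \<open>The kernels on the logarithmic axis and the values of xi at real points\<close>

lemma exp_quotient: "n > 0 \<Longrightarrow> real n / exp t = exp (- (t - ln (real n)))"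
  by (simp add: exp_diff exp_minus divide_inverse)

lemma h_fun_exp:
  "h_fun \<omega> (exp t) = (if 0 < t then exp (- t) * (\<Sum>n=1..nat \<lfloor>exp t\<rfloor>. c_coef \<omega> n * g_log \<omega> (t - ln (real n))) else 0)"
proof -
  have "g_fun \<omega> (real n / exp t) = g_log \<omega> (t - ln (real n))" if "n \<ge> 1" for n
    using that by (simp add: exp_quotient g_log_def) (auto simp: g_fun_def)
  thus ?thesis by (auto simp: h_fun_def exp_minus divide_inverse intro!: sum.cong)
qed

lemma h1_fun_exp:
  "h1_fun \<omega> (exp t) = (if 0 < t then exp (- t) * (\<Sum>n=1..nat \<lfloor>exp t\<rfloor>. c_coef \<omega> n * g1_log \<omega> (t - ln (real n))) else 0)"
proof -
  have "g1_fun \<omega> (real n / exp t) = g1_log \<omega> (t - ln (real n))" if "n \<ge> 1" for n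
    using that by (simp add: exp_quotient g1_log_def) (auto simp: g1_fun_def)
  thus ?thesis by (auto simp: h1_fun_def exp_minus divide_inverse intro!: sum.cong)
qed

lemma xi_of_real:
  assumes "x > 1"
  shows "xi (of_real x) = of_real ((x - 1) * pi powr (- x / 2) * Gamma (x / 2 + 1) * zetar x)"
proof -
  have "(\<Sum>n. complex_of_nat (Suc n) powr (- of_real x)) = (\<Sum>n. of_real (real (Suc n) powr (- x)))"
  proof (rule suminf_cong)
    show "complex_of_nat (Suc n) powr (- of_real x) = of_real (real (Suc n) powr (- x))" for n
      using powr_of_real[of "real (Suc n)" "- x"] by (simp del: of_nat_Suc)
  qed
  also have "\<dots> = of_real (zetar x)"
    unfolding zetar_def using infsum_eq_suminf_Suc(1)[OF abs_summable_powr[OF assms]]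
    by (intro suminf_of_real[symmetric]) (simp add: summable_rabs_cancel)
  finally have Z: "zeta_series (of_real x) = of_real (zetar x)" .
  have G: "x / 2 * Gamma (x / 2) = Gamma (x / 2 + 1)"
    using assms by (subst Gamma_plus1) (auto elim!: nonpos_Ints_cases)
  have "xi (of_real x) = xi_formula (of_real x)" using assms by (intro xi_eq) simp
  also have "\<dots> = of_real ((x / 2 * Gamma (x / 2)) * (x - 1) * pi powr (- x / 2) * zetar x)"
  proof -
    have "complex_of_real pi powr (- complex_of_real x / 2) = of_real (pi powr (- x / 2))"
      using powr_of_real[of pi "- x / 2"] by simp
    moreover have "Gamma (complex_of_real x / 2) = of_real (Gamma (x / 2))"
      using Gamma_complex_of_real[of "x / 2"] by simp
    ultimately show ?thesis unfolding xi_formula_def Z by (simp add: mult_ac)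
  qed
  finally show ?thesis unfolding G by (simp add: mult_ac)
qed

lemma xi_of_real_nonzero: "x > 1 \<Longrightarrow> xi (of_real x) \<noteq> 0"
proof -
  assume x: "x > 1"
  have "Gamma (x / 2 + 1) > 0" using x by (intro Gamma_real_pos add_pos_pos) auto
  hence "Gamma (x / 2 + 1) \<noteq> 0" by (metis less_irrefl)
  thus ?thesis using zetar_pos[of x] x by (simp add: xi_of_real)
qed

text \<open>Since \<open>s / 2 * Gamma (s / 2) = Gamma (s / 2 + 1)\<close>, the two Gamma factors
  form the quotient that Beta divided by \<open>Gamma \<omega>\<close> produces; the powers of pi
  leave \<open>pi powr \<omega>\<close>. At real arguments all divisors are visibly nonzero.\<close>

lemma xi_quotient:
  assumes \<omega>: "\<omega> > 0" and \<sigma>: "\<sigma> > \<omega> + 1"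
  shows "xi (of_real (\<sigma> - \<omega>)) / xi (of_real (\<sigma> + \<omega>)) = of_real (zetar (\<sigma> - \<omega>) / zetar (\<sigma> + \<omega>) * g_laplace \<omega> \<sigma>)"
proof -
  have 1: "Gamma ((\<sigma> + \<omega>) / 2 + 1) > 0" "Gamma \<omega> > 0" "zetar (\<sigma> + \<omega>) > 0"
    using assms by (auto intro!: Gamma_real_pos zetar_pos add_pos_pos)
  have 2: "(\<sigma> - \<omega>) / 2 + 1 + \<omega> = (\<sigma> + \<omega>) / 2 + 1" by (simp add: field_simps)
  have B: "Beta ((\<sigma> - \<omega>) / 2 + 1) \<omega> / Gamma \<omega> = Gamma ((\<sigma> - \<omega>) / 2 + 1) / Gamma ((\<sigma> + \<omega>) / 2 + 1)"
    unfolding Beta_def 2 using 1 by simp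
  have P: "pi powr (- (\<sigma> - \<omega>) / 2) = pi powr \<omega> * pi powr (- (\<sigma> + \<omega>) / 2)"
    by (simp add: field_simps flip: powr_add)
  have "xi (of_real (\<sigma> - \<omega>)) / xi (of_real (\<sigma> + \<omega>))
     = of_real (((\<sigma> - \<omega> - 1) * pi powr (- (\<sigma> - \<omega>) / 2) * Gamma ((\<sigma> - \<omega>) / 2 + 1) * zetar (\<sigma> - \<omega>))
        / ((\<sigma> + \<omega> - 1) * pi powr (- (\<sigma> + \<omega>) / 2) * Gamma ((\<sigma> + \<omega>) / 2 + 1) * zetar (\<sigma> + \<omega>)))"
    using assms by (simp only: xi_of_real of_real_divide)
  also have "((\<sigma> - \<omega> - 1) * pi powr (- (\<sigma> - \<omega>) / 2) * Gamma ((\<sigma> - \<omega>) / 2 + 1) * zetar (\<sigma> - \<omega>))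
        / ((\<sigma> + \<omega> - 1) * pi powr (- (\<sigma> + \<omega>) / 2) * Gamma ((\<sigma> + \<omega>) / 2 + 1) * zetar (\<sigma> + \<omega>))
     = zetar (\<sigma> - \<omega>) / zetar (\<sigma> + \<omega>) * (pi powr \<omega> * (Gamma ((\<sigma> - \<omega>) / 2 + 1) / Gamma ((\<sigma> + \<omega>) / 2 + 1)) * (\<sigma> - 1 - \<omega>) / (\<sigma> - 1 + \<omega>))"
    unfolding P using 1 assms by (simp add: divide_simps) (simp add: algebra_simps)?
  also have "\<dots> = zetar (\<sigma> - \<omega>) / zetar (\<sigma> + \<omega>) * g_laplace \<omega> \<sigma>"
    unfolding B[symmetric] g_laplace_def by simp
  finally show ?thesis .
qed

section \<open>Fourier-Laplace transforms of compactly supported C2 functions\<close>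

lemma integrable_inverse_quadratic: "integrable lborel (\<lambda>t::real. C / (1 + t\<^sup>2))"
proof -
  have "set_integrable lborel (einterval (-\<infinity>) \<infinity>) (\<lambda>x. inverse (1 + x\<^sup>2))"
    by (rule integrable_inverse_1_plus_square)
  hence "integrable lborel (\<lambda>x::real. C * inverse (1 + x\<^sup>2))"
    by (intro integrable_mult_right) (simp add: set_integrable_def einterval_def)
  thus ?thesis by (simp add: divide_inverse)
qed

text \<open>The abstract form of a test function on the logarithmic axis. Two continuous derivatives
  yield quadratic decay of the transform, which is integrable and survives multiplication by a
  bounded function.\<close>

locale compact_C2 =
  fixes a a' a'' :: "real \<Rightarrow> complex" and A B :: real
  assumes AB: "A \<le> B"
    and deriv: "\<And>t. (a has_vector_derivative a' t) (at t)"
    and deriv': "\<And>t. (a' has_vector_derivative a'' t) (at t)"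
    and cont'': "continuous_on UNIV a''"
    and supp: "\<And>t. t \<notin> {A..B} \<Longrightarrow> a t = 0"
begin

lemma cont: "continuous_on UNIV a" and cont': "continuous_on UNIV a'"
  using deriv deriv' by (auto intro!: continuous_at_imp_continuous_on has_vector_derivative_continuous)

lemma supp': "t \<notin> {A..B} \<Longrightarrow> a' t = 0" and supp'': "t \<notin> {A..B} \<Longrightarrow> a'' t = 0"
proof -
  have *: "y t = 0" if t: "t \<notin> {A..B}" and x: "\<And>s. s \<notin> {A..B} \<Longrightarrow> x s = 0"
    and d: "\<And>s. (x has_vector_derivative y s) (at s)" for x y :: "real \<Rightarrow> complex" and t
  proof -
    have "((\<lambda>_. 0) has_vector_derivative y t) (at t)"
      by (rule has_vector_derivative_transform_within_open[OF d, of "- {A..B}"]) (use t x in \<open>auto intro: open_Compl\<close>)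
    thus ?thesis by (metis has_vector_derivative_const vector_derivative_unique_at)
  qed
  show 1: "t \<notin> {A..B} \<Longrightarrow> a' t = 0" for t using * supp deriv by blast
  show "t \<notin> {A..B} \<Longrightarrow> a'' t = 0" using *[OF _ 1 deriv'] by blast
qed

lemma integrable_compact_supp:
  fixes g :: "real \<Rightarrow> 'b::{banach, second_countable_topology}"
  assumes "continuous_on UNIV g" "\<And>t. t \<notin> {A..B} \<Longrightarrow> g t = 0"
  shows "integrable lborel g"
proof -
  have "set_integrable lborel {A..B} g"
    unfolding set_integrable_def
    by (intro borel_integrable_compact compact_Icc continuous_on_subset[OF assms(1)]) auto
  moreover have "indicator {A..B} t *\<^sub>R g t = g t" for t using assms(2)[of t] by (auto simp: indicator_def)
  ultimately show ?thesis by (simp add: set_integrable_def)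
qed

text \<open>For a t = f (exp t) this is the Mellin transform of f at w.\<close>

definition F :: "complex \<Rightarrow> complex" where
  "F w = (LBINT t. a t * exp (w * of_real t))"

lemma measurable_a [measurable]: "a \<in> borel_measurable borel" "a'' \<in> borel_measurable borel"
  using cont cont'' by (auto intro: borel_measurable_continuous_onI)

lemma F_by_parts: "w\<^sup>2 * F w = (LBINT t. a'' t * exp (w * of_real t))"
proof -
  have zero: "(LBINT t. y t * exp (w * of_real t) + x t * (w * exp (w * of_real t))) = 0"
    if x: "\<And>t. t \<notin> {A..B} \<Longrightarrow> x t = 0" and y: "\<And>t. t \<notin> {A..B} \<Longrightarrow> y t = 0"
      and d: "\<And>t. (x has_vector_derivative y t) (at t)" and c: "continuous_on UNIV x" "continuous_on UNIV y" for x y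
  proof -
    let ?z = "\<lambda>t. x t * exp (w * of_real t)" and ?z' = "\<lambda>t. y t * exp (w * of_real t) + x t * (w * exp (w * of_real t))"
    have dz: "(?z has_vector_derivative ?z' t) (at t)" for t
    proof -
      have "((\<lambda>t. exp (w * of_real t)) has_vector_derivative (w * exp (w * of_real t))) (at t)"
      proof -
        have "((\<lambda>z. exp (w * z)) has_field_derivative (w * exp (w * of_real t))) (at (of_real t))"
          by (auto intro!: derivative_eq_intros)
        from has_vector_derivative_real_field[OF this] show ?thesis .
      qed
      from has_vector_derivative_mult[OF d this] show ?thesis by (simp add: add.commute)
    qed
    have cz: "continuous_on UNIV ?z'" by (intro continuous_intros c)
    \<comment> \<open>The interval is enlarged by 1 on either side so that both endpoints lie
      outside the support and the boundary terms vanish.\<close>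
    have "(LBINT t. indicator {A - 1..B + 1} t *\<^sub>R ?z' t) = ?z (B + 1) - ?z (A - 1)"
      by (rule integral_FTC_Icc)
        (use AB in \<open>auto intro: has_vector_derivative_at_within[OF dz] continuous_on_subset[OF cz]\<close>)
    also have "\<dots> = 0" using x[of "B + 1"] x[of "A - 1"] by simp
    also have "(\<lambda>t. indicator {A - 1..B + 1} t *\<^sub>R ?z' t) = ?z'"
      using x y by (auto simp: indicator_def fun_eq_iff)
    finally show ?thesis .
  qed
  have i: "integrable lborel (\<lambda>t. x t * exp (w * of_real t))" if "continuous_on UNIV x" "\<And>t. t \<notin> {A..B} \<Longrightarrow> x t = 0" for x
    using that by (intro integrable_compact_supp continuous_intros) auto
  have 1: "(LBINT t. a' t * exp (w * of_real t)) + w * F w = 0"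
    using zero[of a a', OF supp supp' deriv cont cont'] i[OF cont supp] i[OF cont' supp'] unfolding F_def
    by (simp add: mult.left_commute[of _ w])
  have 2: "(LBINT t. a'' t * exp (w * of_real t)) + w * (LBINT t. a' t * exp (w * of_real t)) = 0"
    using zero[of a' a'', OF supp' supp'' deriv' cont' cont''] i[OF cont'' supp''] i[OF cont' supp']
    by (simp add: mult.left_commute[of _ w])
  have "(LBINT t. a'' t * exp (w * of_real t)) = - w * (LBINT t. a' t * exp (w * of_real t))"
    using 2 by (simp add: eq_neg_iff_add_eq_0)
  also have "(LBINT t. a' t * exp (w * of_real t)) = - w * F w" using 1 by (simp add: eq_neg_iff_add_eq_0)
  finally show ?thesis by (simp add: power2_eq_square)
qed

lemma F_holomorphic: "F holomorphic_on UNIV"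
proof -
  \<comment> \<open>A Laplace phase must be nonnegative, so time is measured from the left end A of
    the support; the factor \<open>exp (w * A)\<close> undoes the shift.\<close>
  define \<tau> where "\<tau> = (\<lambda>t. if t \<in> {A..B} then t - A else 0)"
  have [measurable]: "\<tau> \<in> borel_measurable borel" unfolding \<tau>_def by measurable
  have "(\<lambda>s. \<integral>t. a t * exp (- s * \<tau> t) \<partial>lborel) holomorphic_on UNIV"
  proof (rule holomorphic_on_laplace_integral_UNIV[where \<phi> = a and \<tau> = \<tau>])
    fix \<sigma> :: real
    have "integrable lborel (\<lambda>t. norm (a t) * exp (- \<sigma> * (t - A)))"
      by (intro integrable_compact_supp continuous_intros cont) (use supp in auto)
    moreover have "(\<lambda>t. norm (a t) * exp (- \<sigma> * (t - A))) = (\<lambda>t. norm (a t) * exp (- \<sigma> * \<tau> t))"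
      using supp by (auto simp: \<tau>_def fun_eq_iff)
    ultimately show "integrable lborel (\<lambda>t. norm (a t) * exp (- \<sigma> * \<tau> t))" by (simp only:)
  qed (auto simp: \<tau>_def)
  from holomorphic_on_compose_gen[OF _ this, of uminus UNIV]
  have "(\<lambda>w. \<integral>t. a t * exp (w * \<tau> t) \<partial>lborel) holomorphic_on UNIV"
    by (simp add: o_def holomorphic_intros)
  hence "(\<lambda>w. exp (w * of_real A) * (LBINT t. a t * exp (w * \<tau> t))) holomorphic_on UNIV"
    by (intro holomorphic_intros)
  moreover have "exp (w * of_real A) * (LBINT t. a t * exp (w * \<tau> t)) = F w" for w :: complex
  proof -
    have "exp (w * of_real A) * (LBINT t. a t * exp (w * \<tau> t)) = (LBINT t. exp (w * of_real A) * (a t * exp (w * \<tau> t)))"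
      by (rule integral_mult_right_zero[symmetric])
    also have "\<dots> = F w" unfolding F_def
    proof (intro Bochner_Integration.integral_cong refl)
      fix t
      show "exp (w * of_real A) * (a t * exp (w * \<tau> t)) = a t * exp (w * of_real t)"
        using supp[of t] by (cases "t \<in> {A..B}") (auto simp: \<tau>_def algebra_simps exp_diff)
    qed
    finally show ?thesis .
  qed
  ultimately show ?thesis by simp
qed

text \<open>Two integrations by parts control \<open>w\<^sup>2 * F w\<close>. On a strip that starts
  at 1/2, \<open>\<sigma>\<^sup>2 + \<tau>\<^sup>2\<close> is at least a quarter of
  \<open>1 + \<tau>\<^sup>2\<close>, whence the factor 4, and
  \<open>exp (\<sigma> * t) \<le> 1 + exp (V * t)\<close> makes the constant uniform in
  \<sigma>.\<close>

lemma F_bound: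
  obtains C where "C \<ge> 0" "\<forall>\<sigma> \<tau>. 1/2 \<le> \<sigma> \<longrightarrow> \<sigma> \<le> V \<longrightarrow> norm (F (Complex \<sigma> \<tau>)) \<le> C / (1 + \<tau>\<^sup>2)"
proof -
  define C where "C = (LBINT t. norm (a'' t) * (1 + exp (V * t)))"
  have i: "integrable lborel (\<lambda>t. norm (a'' t) * (1 + exp (V * t)))"
    by (intro integrable_compact_supp continuous_intros cont'') (use supp'' in auto)
  have C0: "4 * C \<ge> 0" unfolding C_def by (intro mult_nonneg_nonneg integral_nonneg_AE AE_I2) (auto simp: add_nonneg_nonneg)
  have "\<forall>\<sigma> \<tau>. 1/2 \<le> \<sigma> \<longrightarrow> \<sigma> \<le> V \<longrightarrow> norm (F (Complex \<sigma> \<tau>)) \<le> 4 * C / (1 + \<tau>\<^sup>2)"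
  proof (intro allI impI)
    fix \<sigma> \<tau> :: real assume \<sigma>: "1/2 \<le> \<sigma>" "\<sigma> \<le> V"
    let ?w = "Complex \<sigma> \<tau>"
    have "norm (?w\<^sup>2 * F ?w) \<le> C" unfolding F_by_parts C_def
    proof (rule norm_integral_le_integral[OF i])
      fix t
      have "exp (\<sigma> * t) \<le> 1 + exp (V * t)"
      proof (cases "t \<ge> 0")
        case True
        hence "\<sigma> * t \<le> V * t" using \<sigma> by (intro mult_right_mono)
        thus ?thesis by (simp add: add_increasing)
      next
        case False
        hence "\<sigma> * t \<le> 0" using \<sigma> by (simp add: mult_nonneg_nonpos)
        hence "exp (\<sigma> * t) \<le> 1" by simp
        thus ?thesis using exp_ge_zero[of "V * t"] by linarith
      qed
      thus "norm (a'' t * exp (?w * of_real t)) \<le> norm (a'' t) * (1 + exp (V * t))"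
        by (simp add: norm_mult mult_left_mono)
    qed
    moreover have "norm (?w\<^sup>2) = \<sigma>\<^sup>2 + \<tau>\<^sup>2" by (simp add: norm_power cmod_power2)
    moreover have "(1 + \<tau>\<^sup>2) / 4 \<le> \<sigma>\<^sup>2 + \<tau>\<^sup>2"
    proof -
      have "1 / 4 \<le> \<sigma>\<^sup>2" using power_mono[of "1/2" \<sigma> 2] \<sigma> by (simp add: power_divide)
      hence "1 / 4 + \<tau>\<^sup>2 / 4 \<le> \<sigma>\<^sup>2 + \<tau>\<^sup>2" by (intro add_mono) auto
      thus ?thesis by (simp only: add_divide_distrib)
    qed
    ultimately have "(1 + \<tau>\<^sup>2) / 4 * norm (F ?w) \<le> C"
      using mult_right_mono[of "(1 + \<tau>\<^sup>2) / 4" "\<sigma>\<^sup>2 + \<tau>\<^sup>2" "norm (F ?w)", OF _ norm_ge_zero] by (simp add: norm_mult)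
    moreover have "0 < 1 + \<tau>\<^sup>2" by (simp add: add_pos_nonneg)
    ultimately show "norm (F ?w) \<le> 4 * C / (1 + \<tau>\<^sup>2)" by (simp add: field_simps)
  qed
  with C0 show ?thesis by (rule that)
qed

lemma fourier_line: "fourier (\<lambda>t. a t * of_real (exp (\<sigma> * t))) \<tau> = F (Complex \<sigma> \<tau>)"
  unfolding F_def
  by (intro Bochner_Integration.integral_cong refl)
     (simp add: Complex_eq exp_of_real[symmetric] algebra_simps flip: exp_add)

lemma F_line_continuous: "continuous_on UNIV (\<lambda>\<tau>. F (Complex \<sigma> \<tau>))"
proof -
  have "continuous_on UNIV (\<lambda>\<tau>. F (of_real \<sigma> + \<i> * of_real \<tau>))"
    by (rule continuous_on_compose2[OF holomorphic_on_imp_continuous_on[OF F_holomorphic]])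
       (auto intro!: continuous_intros)
  thus ?thesis by (simp add: Complex_eq)
qed

lemma integrable_F_line:
  assumes "\<sigma> \<ge> 1/2" shows "integrable lborel (\<lambda>\<tau>. F (Complex \<sigma> \<tau>))"
proof -
  obtain C where C: "\<forall>s \<tau>. 1/2 \<le> s \<longrightarrow> s \<le> \<sigma> \<longrightarrow> norm (F (Complex s \<tau>)) \<le> C / (1 + \<tau>\<^sup>2)"
    using F_bound by blast
  show ?thesis
  proof (rule Bochner_Integration.integrable_bound[OF integrable_inverse_quadratic])
    show "AE \<tau> in lborel. norm (F (Complex \<sigma> \<tau>)) \<le> norm (C / (1 + \<tau>\<^sup>2))"
      unfolding real_norm_def using C assms by (intro AE_I2 order_trans[OF _ abs_ge_self]) blast
  qed (use F_line_continuous in \<open>auto intro: borel_measurable_continuous_onI\<close>)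
qed

lemma exp_weighted_bounded: "\<exists>M. \<forall>t. norm (a t * of_real (exp (\<sigma> * t))) \<le> M"
proof -
  have "compact ((\<lambda>t. a t * of_real (exp (\<sigma> * t))) ` {A..B})"
    by (intro compact_continuous_image continuous_intros continuous_on_subset[OF cont]) auto
  then obtain M where M: "\<And>t. t \<in> {A..B} \<Longrightarrow> norm (a t * of_real (exp (\<sigma> * t))) \<le> M"
    by (meson compact_imp_bounded bounded_iff imageI)
  have "norm (a A * of_real (exp (\<sigma> * A))) \<le> M" using AB by (intro M) auto
  hence "0 \<le> M" by (rule order_trans[OF norm_ge_zero])
  have "norm (a t * of_real (exp (\<sigma> * t))) \<le> M" for t
    using M[of t] supp[of t] \<open>0 \<le> M\<close> by (cases "t \<in> {A..B}") auto
  thus ?thesis by blast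
qed

lemma integrable_exp_weighted: "integrable lborel (\<lambda>t. a t * of_real (exp (\<sigma> * t)))"
  by (intro integrable_compact_supp continuous_intros cont) (use supp in auto)

lemma F_inversion:
  assumes "\<sigma> \<ge> 1/2"
  shows "(LBINT \<tau>. F (Complex \<sigma> \<tau>) * exp (- \<i> * of_real (x * \<tau>))) = 2 * pi * (a x * of_real (exp (\<sigma> * x)))"
proof -
  obtain M where M: "\<And>t. norm (a t * of_real (exp (\<sigma> * t))) \<le> M" using exp_weighted_bounded by blast
  have "continuous_on UNIV (\<lambda>t. a t * of_real (exp (\<sigma> * t)))" by (intro continuous_intros cont)
  hence "isCont (\<lambda>t. a t * of_real (exp (\<sigma> * t))) x" by (simp add: continuous_on_eq_continuous_at)
  from fourier_inversion[OF integrable_exp_weighted M this] show ?thesis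
    unfolding fourier_line using integrable_F_line[OF assms] by simp
qed

lemma F_plancherel:
  "integrable lborel (\<lambda>\<tau>. (norm (F (Complex (1/2) \<tau>)))\<^sup>2)"
  "(LBINT \<tau>. (norm (F (Complex (1/2) \<tau>)))\<^sup>2) = 2 * pi * (LBINT t. (norm (a t))\<^sup>2 * exp t)"
proof -
  obtain M where M: "\<And>t. norm (a t * of_real (exp (1/2 * t))) \<le> M" using exp_weighted_bounded by blast
  have c: "continuous_on UNIV (\<lambda>t. a t * of_real (exp (1/2 * t)))" by (intro continuous_intros cont)
  show "integrable lborel (\<lambda>\<tau>. (norm (F (Complex (1/2) \<tau>)))\<^sup>2)"
    using plancherel_integrable[OF integrable_exp_weighted M c] unfolding fourier_line .
  have e: "(norm (a t * of_real (exp (1/2 * t))))\<^sup>2 = (norm (a t))\<^sup>2 * exp t" for t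
  proof -
    have "(norm (a t * of_real (exp (1/2 * t))))\<^sup>2 = (norm (a t))\<^sup>2 * (exp (1/2 * t))\<^sup>2"
      by (simp add: norm_mult power_mult_distrib)
    also have "(exp (1/2 * t))\<^sup>2 = exp t" by (simp add: power2_eq_square flip: exp_add)
    finally show ?thesis .
  qed
  show "(LBINT \<tau>. (norm (F (Complex (1/2) \<tau>)))\<^sup>2) = 2 * pi * (LBINT t. (norm (a t))\<^sup>2 * exp t)"
    using plancherel[OF integrable_exp_weighted M c] unfolding fourier_line e .
qed

end

section \<open>Contour representation of the operators\<close>

text \<open>For K t = k (exp t) this is the integral of \<open>k x * x powr (- w)\<close>; the 1 in
  the exponent is the Jacobian of x = exp t.\<close>

definition kernel_hat :: "(real \<Rightarrow> real) \<Rightarrow> complex \<Rightarrow> complex" where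
  "kernel_hat K w = (LBINT t. of_real (K t) * exp ((1 - w) * of_real t))"

text \<open>The function a is replaced by its inversion integral on the line \<sigma>. The weight
  \<open>exp (\<sigma> * t)\<close> gained there and the weight
  \<open>exp ((1 - \<sigma>) * t)\<close> that makes K integrable multiply to \<open>exp t\<close>,
  and the integrand in (t, \<tau>) is dominated by a product of integrable functions.\<close>

lemma (in compact_C2) kernel_representation:
  assumes [measurable]: "K \<in> borel_measurable borel" and \<sigma>: "\<sigma> \<ge> 1/2"
    and K: "integrable lborel (\<lambda>t. K t * exp ((1 - \<sigma>) * t))"
  shows "(LBINT t. of_real (K (r + t)) * a t * of_real (exp t))
     = (1 / (2 * pi)) * (LBINT \<tau>. F (Complex \<sigma> \<tau>) * kernel_hat K (Complex \<sigma> \<tau>) * exp ((Complex \<sigma> \<tau> - 1) * of_real r))"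
proof -
  let ?w = "\<lambda>\<tau>. Complex \<sigma> \<tau>"
  define f where "f = (\<lambda>t \<tau>. of_real (K (r + t) * exp ((1 - \<sigma>) * t)) * (F (?w \<tau>) * exp (- \<i> * of_real (t * \<tau>))))"
  have [measurable]: "(\<lambda>\<tau>. F (?w \<tau>)) \<in> borel_measurable borel"
    using F_line_continuous by (rule borel_measurable_continuous_onI)
  have Kr: "integrable lborel (\<lambda>t. K (r + t) * exp ((1 - \<sigma>) * t))"
  proof -
    have "integrable lborel (\<lambda>t. exp (- (1 - \<sigma>) * r) * (K (r + 1 * t) * exp ((1 - \<sigma>) * (r + 1 * t))))"
      by (intro integrable_mult_right lborel_integrable_real_affine[OF K]) auto
    moreover have "exp (- (1 - \<sigma>) * r) * (K (r + 1 * t) * exp ((1 - \<sigma>) * (r + 1 * t))) = K (r + t) * exp ((1 - \<sigma>) * t)" for t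
    proof -
      have "exp (- (1 - \<sigma>) * r) * exp ((1 - \<sigma>) * (r + 1 * t)) = exp ((1 - \<sigma>) * t)"
        by (simp add: algebra_simps flip: exp_add)
      thus ?thesis by (simp only: mult.left_commute[of _ "K _"] mult_1)
    qed
    ultimately show ?thesis by (simp only:)
  qed
  have int: "integrable (lborel \<Otimes>\<^sub>M lborel) (case_prod f)"
    by (rule integrable_pair_le_mult[OF _ integrable_norm[OF Kr] integrable_norm[OF integrable_F_line[OF \<sigma>]]])
       (auto simp: f_def norm_mult abs_mult)
  have "of_real (K (r + t)) * a t * of_real (exp t) = (1 / (2 * pi)) * (LBINT \<tau>. f t \<tau>)" for t
  proof -
    have "(LBINT \<tau>. f t \<tau>) = of_real (K (r + t) * exp ((1 - \<sigma>) * t)) * (2 * pi * (a t * of_real (exp (\<sigma> * t))))"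
      unfolding f_def by (subst integral_mult_right_zero) (simp only: F_inversion[OF \<sigma>])
    also have "\<dots> = 2 * pi * (of_real (K (r + t)) * a t * of_real (exp ((1 - \<sigma>) * t) * exp (\<sigma> * t)))"
      by (simp add: mult_ac)
    also have "exp ((1 - \<sigma>) * t) * exp (\<sigma> * t) = exp t" by (simp add: algebra_simps flip: exp_add)
    finally show ?thesis by simp
  qed
  hence "(LBINT t. of_real (K (r + t)) * a t * of_real (exp t)) = (LBINT t. (1 / (2 * pi)) * (LBINT \<tau>. f t \<tau>))"
    by (simp only:)
  also have "\<dots> = (1 / (2 * pi)) * (LBINT t. (LBINT \<tau>. f t \<tau>))"
    by (rule integral_mult_right_zero)
  also have "(LBINT t. (LBINT \<tau>. f t \<tau>)) = (LBINT \<tau>. (LBINT t. f t \<tau>))"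
    using lborel_pair.Fubini_integral[OF int] by simp
  also have "\<dots> = (LBINT \<tau>. F (?w \<tau>) * kernel_hat K (?w \<tau>) * exp ((?w \<tau> - 1) * of_real r))"
  proof (intro Bochner_Integration.integral_cong refl)
    fix \<tau>
    \<comment> \<open>Translating the transform by r turns its kernel into K (r + t) and is
      compensated by the exponential in r.\<close>
    have kh: "kernel_hat K (?w \<tau>) = (LBINT t. of_real (K (r + 1 * t)) * exp ((1 - ?w \<tau>) * of_real (r + 1 * t)))"
      unfolding kernel_hat_def by (subst lborel_integral_real_affine[where c = 1 and t = r]) auto
    have "F (?w \<tau>) * kernel_hat K (?w \<tau>) * exp ((?w \<tau> - 1) * of_real r) =
      (LBINT t. F (?w \<tau>) * exp ((?w \<tau> - 1) * of_real r) * (of_real (K (r + 1 * t)) * exp ((1 - ?w \<tau>) * of_real (r + 1 * t))))"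
      unfolding kh integral_mult_right_zero by (simp only: mult_ac)
    also have "\<dots> = (LBINT t. f t \<tau>)"
    proof (intro Bochner_Integration.integral_cong refl)
      fix t
      have "exp ((?w \<tau> - 1) * of_real r) * exp ((1 - ?w \<tau>) * of_real (r + 1 * t)) = of_real (exp ((1 - \<sigma>) * t)) * exp (- \<i> * of_real (t * \<tau>))"
        by (simp add: exp_of_real[symmetric] Complex_eq algebra_simps flip: exp_add)
      thus "F (?w \<tau>) * exp ((?w \<tau> - 1) * of_real r) * (of_real (K (r + 1 * t)) * exp ((1 - ?w \<tau>) * of_real (r + 1 * t))) = f t \<tau>"
        by (simp add: f_def mult_ac)
    qed
    finally show "(LBINT t. f t \<tau>) = F (?w \<tau>) * kernel_hat K (?w \<tau>) * exp ((?w \<tau> - 1) * of_real r)" ..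
  qed
  finally show ?thesis .
qed

lemma kernel_hat_holomorphic:
  assumes [measurable]: "K \<in> borel_measurable borel" and K0: "\<And>t. t \<le> 0 \<Longrightarrow> K t = 0"
    and K: "\<And>\<sigma>. \<sigma> > c \<Longrightarrow> integrable lborel (\<lambda>t. K t * exp ((1 - \<sigma>) * t))"
  shows "kernel_hat K holomorphic_on {w. Re w > c}"
proof -
  \<comment> \<open>As K vanishes for t \<le> 0, t may be replaced by max 0 t, which is an
    admissible Laplace phase.\<close>
  have e: "complex_of_real (K t) * exp ((1 - w) * of_real t) = of_real (K t * exp t) * exp (- w * of_real (max 0 t))" for t w
    using K0[of t] by (cases "t > 0") (auto simp: exp_of_real[symmetric] left_diff_distrib exp_diff exp_minus divide_inverse)
  have "(\<lambda>w. \<integral>t. of_real (K t * exp t) * exp (- w * of_real (max 0 t)) \<partial>lborel) holomorphic_on {w. Re w > c}"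
  proof (rule holomorphic_on_laplace_integral)
    fix \<sigma> assume \<sigma>: "\<sigma> > c"
    have "norm (complex_of_real (K t * exp t)) * exp (- \<sigma> * max 0 t) = norm (K t * exp ((1 - \<sigma>) * t))" for t
      using K0[of t] by (cases "t > 0") (auto simp: norm_mult abs_mult algebra_simps exp_add exp_diff exp_minus divide_inverse)
    thus "integrable lborel (\<lambda>t. norm (complex_of_real (K t * exp t)) * exp (- \<sigma> * max 0 t))"
      using integrable_norm[OF K[OF \<sigma>]] by simp
  qed auto
  thus ?thesis unfolding kernel_hat_def e .
qed

section \<open>Passage from the half line to the logarithmic axis\<close>

lemma
  fixes g :: "real \<Rightarrow> 'a::{banach, second_countable_topology}"
  assumes [measurable]: "g \<in> borel_measurable borel"
  shows integrable_posline_iff: "integrable posline g \<longleftrightarrow> integrable lborel (\<lambda>t. exp t *\<^sub>R g (exp t))"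
    and integral_posline: "(\<integral>x. g x \<partial>posline) = (LBINT t. exp t *\<^sub>R g (exp t))"
proof -
  have m: "(\<lambda>x. indicator {0<..} x *\<^sub>R g x) \<in> borel_measurable lborel" by measurable
  have "integrable posline g \<longleftrightarrow> integrable lebesgue (\<lambda>x. indicator {0<..} x *\<^sub>R g x)"
    by (rule integrable_restrict_space) simp
  \<comment> \<open>\<open>posline\<close> restricts the completed measure; for a Borel integrand
    completion changes neither integrability nor the integral.\<close>
  also have "\<dots> \<longleftrightarrow> integrable lborel (\<lambda>x. indicator {0<..} x *\<^sub>R g x)"
    by (rule integrable_completion[OF m])
  also have "\<dots> \<longleftrightarrow> integrable lborel (\<lambda>t. exp t *\<^sub>R g (exp t))"
    using integrable_exp_substitution[of 1 g] by simp
  finally show "integrable posline g \<longleftrightarrow> integrable lborel (\<lambda>t. exp t *\<^sub>R g (exp t))" .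
  have "(\<integral>x. g x \<partial>posline) = (\<integral>x. indicator {0<..} x *\<^sub>R g x \<partial>lebesgue)"
    by (rule integral_restrict_space) simp
  also have "\<dots> = (LBINT x. indicator {0<..} x *\<^sub>R g x)"
    by (rule integral_completion[OF m])
  also have "\<dots> = (LBINT t. exp t *\<^sub>R g (exp t))"
    using integral_exp_substitution[of 1 g] by simp
  finally show "(\<integral>x. g x \<partial>posline) = (LBINT t. exp t *\<^sub>R g (exp t))" .
qed

lemma borel_measurable_of_exp:
  fixes g :: "real \<Rightarrow> 'a::{banach, second_countable_topology}"
  assumes [measurable]: "(\<lambda>t. g (exp t)) \<in> borel_measurable borel" and "\<And>x. x \<le> 0 \<Longrightarrow> g x = 0"
  shows "g \<in> borel_measurable borel"
proof -
  have "(\<lambda>x. if 0 < x then g (exp (ln x)) else 0) \<in> borel_measurable borel" by measurable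
  also have "(\<lambda>x. if 0 < x then g (exp (ln x)) else 0) = g" using assms(2) by (auto simp: fun_eq_iff)
  finally show ?thesis .
qed

lemma int_op_exp:
  assumes [measurable]: "k \<in> borel_measurable borel" "f \<in> borel_measurable borel"
  shows "int_op k f (exp r) = (LBINT t. of_real (k (exp (r + t))) * f (exp t) * of_real (exp t))"
  unfolding int_op_def by (subst integral_posline) (auto simp: exp_add scaleR_conv_of_real mult_ac)

lemma test_fun_compact_C2:
  assumes "test_fun f"
  obtains a' a'' A B where "compact_C2 (\<lambda>t. f (exp t)) a' a'' A B"
proof -
  obtain a b where ab: "0 < a" "a \<le> b" "\<And>x. x \<notin> {a..b} \<Longrightarrow> f x = 0"
    and d: "\<And>n x. x > 0 \<Longrightarrow> (vderiv ^^ n) f differentiable (at x)"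
    using assms unfolding test_fun_def by blast
  define f' f'' where "f' = vderiv f" and "f'' = vderiv f'"
  have d0: "(f has_vector_derivative f' x) (at x)" if "x > 0" for x
    using d[OF that, of 0] by (simp add: f'_def vderiv_def vector_derivative_works)
  have d1: "(f' has_vector_derivative f'' x) (at x)" if "x > 0" for x
    using d[OF that, of 1] by (simp add: f'_def f''_def vderiv_def vector_derivative_works)
  \<comment> \<open>Differentiability of the second iterated derivative supplies the continuity of
    f'' demanded by the locale.\<close>
  have c2: "isCont f'' x" if "x > 0" for x
    using d[OF that, of 2] by (simp add: f'_def f''_def numeral_2_eq_2 differentiable_imp_continuous_within)
  have ch: "((\<lambda>t. g (exp t)) has_vector_derivative exp t *\<^sub>R g' (exp t)) (at t)"
    if "\<And>x. x > 0 \<Longrightarrow> (g has_vector_derivative g' x) (at x)" for g g' :: "real \<Rightarrow> complex" and t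
  proof -
    have "(exp has_vector_derivative exp t) (at t)"
      by (auto intro!: derivative_eq_intros simp flip: has_real_derivative_iff_has_vector_derivative)
    from vector_diff_chain_at[OF this that[of "exp t"]] show ?thesis by (simp add: o_def)
  qed
  show ?thesis
  proof (rule that, unfold_locales)
    show "ln a \<le> ln b" using ab by simp
    show "((\<lambda>t. f (exp t)) has_vector_derivative exp t *\<^sub>R f' (exp t)) (at t)" for t
      using ch[OF d0] .
    show "((\<lambda>t. exp t *\<^sub>R f' (exp t)) has_vector_derivative exp t *\<^sub>R (exp t *\<^sub>R f'' (exp t)) + exp t *\<^sub>R f' (exp t)) (at t)" for t
      by (rule has_vector_derivative_scaleR[OF _ ch[OF d1]]) (auto intro!: derivative_eq_intros)
    have ce: "continuous_on UNIV (exp :: real \<Rightarrow> real)" by (intro continuous_intros)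
    have "continuous_on {0<..} f''" using c2 by (auto intro: continuous_at_imp_continuous_on)
    from continuous_on_compose2[OF this ce] have "continuous_on UNIV (\<lambda>t. f'' (exp t))" by (simp add: image_subset_iff)
    moreover have "continuous_on {0<..} f'"
      using d1 by (auto intro!: continuous_at_imp_continuous_on has_vector_derivative_continuous)
    from continuous_on_compose2[OF this ce] have "continuous_on UNIV (\<lambda>t. f' (exp t))" by (simp add: image_subset_iff)
    ultimately show "continuous_on UNIV (\<lambda>t. exp t *\<^sub>R (exp t *\<^sub>R f'' (exp t)) + exp t *\<^sub>R f' (exp t))"
      by (intro continuous_intros)
    show "f (exp t) = 0" if "t \<notin> {ln a..ln b}" for t
    proof (rule ab(3))
      show "exp t \<notin> {a..b}"
      proof
        assume "exp t \<in> {a..b}"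
        hence "ln a \<le> ln (exp t)" using ab by (subst ln_le_cancel_iff) auto
        moreover have "0 < b" "exp t \<le> b" using ab \<open>exp t \<in> {a..b}\<close> by auto
        hence "t \<le> ln b" by (simp add: ln_ge_iff)
        ultimately show False using that by simp
      qed
    qed
  qed
qed

lemma test_fun_measurable:
  assumes "test_fun f" shows "f \<in> borel_measurable borel"
proof -
  obtain a' a'' A B where "compact_C2 (\<lambda>t. f (exp t)) a' a'' A B" using test_fun_compact_C2[OF assms] by blast
  then interpret compact_C2 "\<lambda>t. f (exp t)" a' a'' A B .
  show ?thesis
  proof (rule borel_measurable_of_exp[OF measurable_a(1)])
    show "f x = 0" if "x \<le> 0" for x
    proof -
      obtain a b where "0 < a" "\<forall>x. x \<notin> {a..b} \<longrightarrow> f x = 0" using assms unfolding test_fun_def by blast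
      thus ?thesis using that by auto
    qed
  qed
qed

section \<open>Differentiation under the integral sign and contour shift\<close>

lemma norm_exp_minus_1_le:
  fixes z :: complex
  assumes "Re z \<le> b" "0 \<le> b"
  shows "norm (exp z - 1) \<le> norm z * exp b"
proof -
  have "norm (exp z - exp 0) \<le> exp b * norm (z - 0)"
  proof (rule field_differentiable_bound[where S = "{w. Re w \<le> b}" and f' = exp])
    show "convex {w. Re w \<le> b}" by (rule convex_halfspace_Re_le)
  qed (use assms in \<open>auto intro!: derivative_eq_intros simp: has_field_derivative_at_within\<close>)
  thus ?thesis by (simp add: mult.commute)
qed

text \<open>Dividing by the frequency beforehand is what permits differentiation under the integral
  for a merely integrable Q. This is the analytic content of integrating \<open>g_fun\<close> to
  \<open>g1_fun\<close> and differentiating afterwards.\<close>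

lemma has_vector_derivative_fourier_primitive:
  assumes Q: "integrable lborel Q" and s: "s > 0"
  defines "S \<equiv> (\<lambda>r. \<integral>\<tau>. Q \<tau> / Complex s \<tau> * exp (Complex s \<tau> * of_real r) \<partial>lborel)"
  shows "(S has_vector_derivative (LBINT \<tau>. Q \<tau> * exp (Complex s \<tau> * of_real r))) (at r)"
proof -
  let ?z = "Complex s"
  have [measurable]: "Q \<in> borel_measurable borel" using borel_measurable_integrable[OF Q] by simp
  have [measurable]: "?z \<in> borel_measurable borel"
    unfolding Complex_eq by measurable
  have z0: "?z \<tau> \<noteq> 0" for \<tau> using s by (auto simp: complex_eq_iff)
  have nz: "norm (?z \<tau>) \<ge> s" for \<tau> using abs_Re_le_cmod[of "?z \<tau>"] s by simp
  have i1: "integrable lborel (\<lambda>\<tau>. Q \<tau> / ?z \<tau> * exp (?z \<tau> * of_real r))" for r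
  proof (rule Bochner_Integration.integrable_bound[OF integrable_mult_right[OF Q, of "exp (s * r) / s"]])
    show "AE \<tau> in lborel. norm (Q \<tau> / ?z \<tau> * exp (?z \<tau> * of_real r)) \<le> norm (of_real (exp (s * r) / s) * Q \<tau>)"
    proof (rule AE_I2)
      fix \<tau>
      have "norm (Q \<tau>) / norm (?z \<tau>) \<le> norm (Q \<tau>) / s" using nz s by (intro divide_left_mono mult_pos_pos) (auto simp: z0)
      hence "norm (Q \<tau>) / norm (?z \<tau>) * exp (s * r) \<le> norm (Q \<tau>) / s * exp (s * r)" by (rule mult_right_mono) simp
      thus "norm (Q \<tau> / ?z \<tau> * exp (?z \<tau> * of_real r)) \<le> norm (of_real (exp (s * r) / s) * Q \<tau>)"
        using s by (simp add: norm_mult norm_divide mult_ac)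
    qed
  qed measurable
  define D where "D = (LBINT \<tau>. Q \<tau> * exp (?z \<tau> * of_real r))"
  have i2: "integrable lborel (\<lambda>\<tau>. Q \<tau> * exp (?z \<tau> * of_real r))"
    by (rule Bochner_Integration.integrable_bound[OF integrable_mult_right[OF Q, of "exp (s * r)"]])
       (auto simp: norm_mult mult_ac)
  have "((\<lambda>h. (S (r + h) - S r) /\<^sub>R h) \<longlongrightarrow> D) (at 0)"
    unfolding tendsto_at_iff_sequentially
  proof (intro allI impI)
    fix X :: "nat \<Rightarrow> real" assume X: "\<forall>i. X i \<in> UNIV - {0}" "X \<longlonglongrightarrow> 0"
    \<comment> \<open>The difference quotient is written through \<open>(exp z - 1) / z\<close>,
      which tends to 1 and is bounded by an exponential of the real part alone, hence uniformly in
      \<tau>.\<close>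
    let ?q = "\<lambda>n \<tau>. Q \<tau> * exp (?z \<tau> * of_real r) * ((exp (?z \<tau> * of_real (X n)) - 1) / (?z \<tau> * of_real (X n)))"
    have X0: "X n \<noteq> 0" for n using X(1) by auto
    have eq: "(S (r + X n) - S r) /\<^sub>R X n = (LBINT \<tau>. ?q n \<tau>)" for n
    proof -
      have "S (r + X n) - S r = (LBINT \<tau>. Q \<tau> / ?z \<tau> * exp (?z \<tau> * of_real (r + X n)) - Q \<tau> / ?z \<tau> * exp (?z \<tau> * of_real r))"
        unfolding S_def using i1[of "r + X n"] i1[of r] by (rule Bochner_Integration.integral_diff[symmetric])
      also have "\<dots> = (LBINT \<tau>. of_real (X n) * ?q n \<tau>)"
      proof (intro Bochner_Integration.integral_cong refl)
        fix \<tau>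
        have "exp (?z \<tau> * of_real (r + X n)) = exp (?z \<tau> * of_real r) * exp (?z \<tau> * of_real (X n))"
          by (simp add: algebra_simps exp_add)
        thus "Q \<tau> / ?z \<tau> * exp (?z \<tau> * of_real (r + X n)) - Q \<tau> / ?z \<tau> * exp (?z \<tau> * of_real r) = of_real (X n) * ?q n \<tau>"
          using X0[of n] z0[of \<tau>] by (simp add: field_simps)
      qed
      also have "\<dots> = of_real (X n) * (LBINT \<tau>. ?q n \<tau>)" by (rule integral_mult_right_zero)
      finally show ?thesis using X0[of n] by (simp add: scaleR_conv_of_real)
    qed
    obtain b where b: "\<And>n. \<bar>X n\<bar> \<le> b"
      using convergent_imp_Bseq[of X] X(2) by (auto simp: convergent_def Bseq_def)
    have b0: "0 \<le> b" using b[of 0] by (auto intro: order_trans[OF abs_ge_zero])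
    have "(\<lambda>n. \<integral>\<tau>. ?q n \<tau> \<partial>lborel) \<longlonglongrightarrow> D" unfolding D_def
    proof (rule integral_dominated_convergence[where w = "\<lambda>\<tau>. norm (Q \<tau> * exp (?z \<tau> * of_real r)) * exp (s * b)"])
      show "integrable lborel (\<lambda>\<tau>. norm (Q \<tau> * exp (?z \<tau> * of_real r)) * exp (s * b))"
        by (intro integrable_mult_left integrable_norm i2)
      show "AE \<tau> in lborel. (\<lambda>n. ?q n \<tau>) \<longlonglongrightarrow> Q \<tau> * exp (?z \<tau> * of_real r)"
      proof (rule AE_I2)
        fix \<tau>
        have "(exp has_field_derivative 1) (at (0::complex))" by (auto intro!: derivative_eq_intros)
        hence "((\<lambda>h. (exp h - 1) / h) \<longlongrightarrow> 1) (at (0::complex))" by (simp add: has_field_derivative_iff)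
        moreover have "filterlim (\<lambda>n. ?z \<tau> * of_real (X n)) (at 0) sequentially"
          unfolding filterlim_at
        proof (intro conjI)
          have "(\<lambda>n. ?z \<tau> * of_real (X n)) \<longlonglongrightarrow> ?z \<tau> * of_real 0" by (intro tendsto_intros X)
          thus "(\<lambda>n. ?z \<tau> * of_real (X n)) \<longlonglongrightarrow> 0" by simp
          show "\<forall>\<^sub>F n in sequentially. ?z \<tau> * of_real (X n) \<in> UNIV \<and> ?z \<tau> * of_real (X n) \<noteq> 0"
            using X0 z0 by simp
        qed
        ultimately have "(\<lambda>n. (exp (?z \<tau> * of_real (X n)) - 1) / (?z \<tau> * of_real (X n))) \<longlonglongrightarrow> 1"
          by (rule filterlim_compose)
        hence "(\<lambda>n. ?q n \<tau>) \<longlonglongrightarrow> Q \<tau> * exp (?z \<tau> * of_real r) * 1" by (intro tendsto_intros)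
        thus "(\<lambda>n. ?q n \<tau>) \<longlonglongrightarrow> Q \<tau> * exp (?z \<tau> * of_real r)" by simp
      qed
      show "AE \<tau> in lborel. norm (?q n \<tau>) \<le> norm (Q \<tau> * exp (?z \<tau> * of_real r)) * exp (s * b)" for n
      proof (rule AE_I2)
        fix \<tau>
        have "s * X n \<le> s * b" using b[of n] s by (intro mult_left_mono) auto
        hence "norm (exp (?z \<tau> * of_real (X n)) - 1) \<le> norm (?z \<tau> * of_real (X n)) * exp (s * b)"
          using s b0 by (intro norm_exp_minus_1_le) auto
        moreover have "norm (?z \<tau> * of_real (X n)) > 0" using X0 z0 by simp
        ultimately have "norm ((exp (?z \<tau> * of_real (X n)) - 1) / (?z \<tau> * of_real (X n))) \<le> exp (s * b)"
          by (simp only: norm_divide pos_divide_le_eq mult.commute)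
        thus "norm (?q n \<tau>) \<le> norm (Q \<tau> * exp (?z \<tau> * of_real r)) * exp (s * b)"
          unfolding norm_mult[of "Q \<tau> * exp (?z \<tau> * of_real r)"] by (rule mult_left_mono) simp
      qed
    qed measurable
    thus "((\<lambda>h. (S (r + h) - S r) /\<^sub>R h) \<circ> X) \<longlonglongrightarrow> D" unfolding o_def eq .
  qed
  hence "((\<lambda>h. norm ((S (r + h) - S r) /\<^sub>R h - D)) \<longlongrightarrow> 0) (at 0)"
    by (intro tendsto_norm_zero) (simp add: LIM_zero)
  moreover have "\<forall>\<^sub>F h in at 0. norm ((S (r + h) - S r) /\<^sub>R h - D) = norm (S (r + h) - S r - h *\<^sub>R D) / norm h"
    unfolding eventually_at_filter
  proof (intro always_eventually allI impI)
    fix h :: real assume "h \<noteq> 0"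
    hence "(S (r + h) - S r) /\<^sub>R h - D = (S (r + h) - S r - h *\<^sub>R D) /\<^sub>R h" by (simp add: scaleR_diff_right)
    thus "norm ((S (r + h) - S r) /\<^sub>R h - D) = norm (S (r + h) - S r - h *\<^sub>R D) / norm h"
      by (simp add: divide_inverse mult.commute)
  qed
  ultimately have "((\<lambda>h. norm (S (r + h) - S r - h *\<^sub>R D) / norm h) \<longlongrightarrow> 0) (at 0)"
    by (rule Lim_transform_eventually)
  thus ?thesis unfolding has_vector_derivative_def has_derivative_at D_def[symmetric]
    by (auto intro: bounded_linear_scaleR_left)
qed

text \<open>Cauchy's theorem on rectangles, obtained by integrating \<open>deriv P\<close> over the
  rectangle in both orders. The horizontal sides vanish in the limit because of the quadratic decay,
  which holds uniformly across the strip.\<close>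

lemma line_integral_shift:
  assumes P: "P holomorphic_on {w. Re w > c}" and \<sigma>: "c < \<sigma>1" "\<sigma>1 \<le> \<sigma>2"
    and bound: "\<And>\<sigma> \<tau>. \<sigma>1 \<le> \<sigma> \<Longrightarrow> \<sigma> \<le> \<sigma>2 \<Longrightarrow> norm (P (Complex \<sigma> \<tau>)) \<le> C / (1 + \<tau>\<^sup>2)"
  shows "(LBINT \<tau>. P (Complex \<sigma>1 \<tau>)) = (LBINT \<tau>. P (Complex \<sigma>2 \<tau>))"
proof -
  let ?H = "{w. Re w > c}"
  have oH: "open ?H" by (rule open_halfspace_Re_gt)
  have dP: "(P has_field_derivative deriv P w) (at w)" if "Re w > c" for w
    using P that oH holomorphic_derivI by blast
  have cP: "continuous_on ?H P" by (rule holomorphic_on_imp_continuous_on[OF P])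
  have cdP: "continuous_on ?H (deriv P)" by (intro holomorphic_on_imp_continuous_on holomorphic_deriv P oH)
  have contline: "continuous_on UNIV (\<lambda>\<tau>. P (Complex \<sigma> \<tau>))" if "\<sigma> > c" for \<sigma>
    by (rule continuous_on_compose2[OF cP]) (use that in \<open>auto simp: Complex_eq intro!: continuous_intros\<close>)
  have controw: "continuous_on {\<sigma>1..\<sigma>2} (\<lambda>\<sigma>. P (Complex \<sigma> \<tau>))" for \<tau>
    by (rule continuous_on_compose2[OF cP]) (use \<sigma> in \<open>auto simp: Complex_eq intro!: continuous_intros\<close>)
  have intline: "integrable lborel (\<lambda>\<tau>. P (Complex \<sigma> \<tau>))" if "\<sigma>1 \<le> \<sigma>" "\<sigma> \<le> \<sigma>2" for \<sigma>
  proof (rule Bochner_Integration.integrable_bound[OF integrable_inverse_quadratic])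
    show "AE \<tau> in lborel. norm (P (Complex \<sigma> \<tau>)) \<le> norm (C / (1 + \<tau>\<^sup>2))"
      unfolding real_norm_def using bound that by (intro AE_I2 order_trans[OF _ abs_ge_self]) blast
    show "(\<lambda>\<tau>. P (Complex \<sigma> \<tau>)) \<in> borel_measurable lborel"
      using contline[of \<sigma>] that \<sigma> by (auto intro: borel_measurable_continuous_onI)
  qed
  have rect: "integral {- R..R} (\<lambda>\<tau>. P (Complex \<sigma>2 \<tau>)) - integral {- R..R} (\<lambda>\<tau>. P (Complex \<sigma>1 \<tau>))
      = integral {\<sigma>1..\<sigma>2} (\<lambda>\<sigma>. (P (Complex \<sigma> R) - P (Complex \<sigma> (- R))) / \<i>)" if R: "R \<ge> 0" for R
  proof -
    have d1: "((\<lambda>\<sigma>. P (Complex \<sigma> \<tau>)) has_vector_derivative deriv P (Complex \<sigma> \<tau>)) (at \<sigma> within S)" if "\<sigma> > c" for \<sigma> \<tau> S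
    proof -
      have "((\<lambda>\<sigma>. of_real \<sigma> + \<i> * of_real \<tau>) has_vector_derivative 1) (at \<sigma>)"
        by (auto intro!: derivative_eq_intros)
      from field_vector_diff_chain_at[OF this dP] show ?thesis
        using that by (simp add: o_def Complex_eq has_vector_derivative_at_within)
    qed
    \<comment> \<open>Along a vertical line the chain rule produces a factor \<i>, so
      \<open>P / \<i>\<close> is the antiderivative of \<open>deriv P\<close> in the direction of
      \<tau>.\<close>
    have d2: "((\<lambda>\<tau>. P (Complex \<sigma> \<tau>) / \<i>) has_vector_derivative deriv P (Complex \<sigma> \<tau>)) (at \<tau> within S)" if "\<sigma> > c" for \<sigma> \<tau> S
    proof -
      have "((\<lambda>\<tau>. of_real \<sigma> + \<i> * of_real \<tau>) has_vector_derivative \<i>) (at \<tau>)"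
        by (auto intro!: derivative_eq_intros)
      from field_vector_diff_chain_at[OF this dP]
      have "((\<lambda>\<tau>. P (Complex \<sigma> \<tau>)) has_vector_derivative \<i> * deriv P (Complex \<sigma> \<tau>)) (at \<tau>)"
        using that by (simp add: o_def Complex_eq)
      from has_vector_derivative_divide[OF this, of \<i>] show ?thesis
        by (simp add: has_vector_derivative_at_within)
    qed
    have "integral {- R..R} (\<lambda>\<tau>. P (Complex \<sigma>2 \<tau>)) - integral {- R..R} (\<lambda>\<tau>. P (Complex \<sigma>1 \<tau>))
        = integral {- R..R} (\<lambda>\<tau>. P (Complex \<sigma>2 \<tau>) - P (Complex \<sigma>1 \<tau>))"
      using \<sigma> by (intro Henstock_Kurzweil_Integration.integral_diff[symmetric] integrable_continuous_real continuous_on_subset[OF contline]) auto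
    also have "\<dots> = integral {- R..R} (\<lambda>\<tau>. integral {\<sigma>1..\<sigma>2} (\<lambda>\<sigma>. deriv P (Complex \<sigma> \<tau>)))"
    proof (rule Henstock_Kurzweil_Integration.integral_cong)
      fix \<tau>
      show "P (Complex \<sigma>2 \<tau>) - P (Complex \<sigma>1 \<tau>) = integral {\<sigma>1..\<sigma>2} (\<lambda>\<sigma>. deriv P (Complex \<sigma> \<tau>))"
        using \<sigma> by (intro integral_unique[symmetric] fundamental_theorem_of_calculus d1) auto
    qed
    also have "\<dots> = integral {\<sigma>1..\<sigma>2} (\<lambda>\<sigma>. integral {- R..R} (\<lambda>\<tau>. deriv P (Complex \<sigma> \<tau>)))"
    proof -
      have "continuous_on (cbox (- R, \<sigma>1) (R, \<sigma>2)) (\<lambda>(\<tau>, \<sigma>). deriv P (Complex \<sigma> \<tau>))"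
        unfolding case_prod_unfold
        by (rule continuous_on_compose2[OF cdP]) (use \<sigma> in \<open>auto simp: Complex_eq cbox_Pair_eq intro!: continuous_intros\<close>)
      from integral_swap_continuous[OF this] show ?thesis by simp
    qed
    also have "\<dots> = integral {\<sigma>1..\<sigma>2} (\<lambda>\<sigma>. (P (Complex \<sigma> R) - P (Complex \<sigma> (- R))) / \<i>)"
    proof (rule Henstock_Kurzweil_Integration.integral_cong)
      fix \<sigma> assume s: "\<sigma> \<in> {\<sigma>1..\<sigma>2}"
      have "((\<lambda>\<tau>. deriv P (Complex \<sigma> \<tau>)) has_integral (P (Complex \<sigma> R) / \<i> - P (Complex \<sigma> (- R)) / \<i>)) {- R..R}"
        using R s \<sigma> by (intro fundamental_theorem_of_calculus d2) auto
      thus "integral {- R..R} (\<lambda>\<tau>. deriv P (Complex \<sigma> \<tau>)) = (P (Complex \<sigma> R) - P (Complex \<sigma> (- R))) / \<i>"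
        by (simp only: integral_unique diff_divide_distrib)
    qed
    finally show ?thesis .
  qed
  have lim: "(\<lambda>n::nat. integral {- real n..real n} (\<lambda>\<tau>. P (Complex \<sigma> \<tau>))) \<longlonglongrightarrow> (LBINT \<tau>. P (Complex \<sigma> \<tau>))"
    if s: "\<sigma>1 \<le> \<sigma>" "\<sigma> \<le> \<sigma>2" for \<sigma>
  proof -
    have "(\<lambda>n::nat. \<integral>\<tau>. indicator {- real n..real n} \<tau> *\<^sub>R P (Complex \<sigma> \<tau>) \<partial>lborel) \<longlonglongrightarrow> (LBINT \<tau>. P (Complex \<sigma> \<tau>))"
    proof (rule integral_dominated_convergence[where w = "\<lambda>\<tau>. norm (P (Complex \<sigma> \<tau>))"])
      show "AE \<tau> in lborel. (\<lambda>n::nat. indicator {- real n..real n} \<tau> *\<^sub>R P (Complex \<sigma> \<tau>)) \<longlonglongrightarrow> P (Complex \<sigma> \<tau>)"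
      proof (intro AE_I2 tendsto_eventually)
        fix \<tau> :: real
        show "\<forall>\<^sub>F n::nat in sequentially. indicator {- real n..real n} \<tau> *\<^sub>R P (Complex \<sigma> \<tau>) = P (Complex \<sigma> \<tau>)"
          using eventually_ge_at_top[of "nat \<lceil>\<bar>\<tau>\<bar>\<rceil>"]
        proof eventually_elim
          case (elim n)
          hence "\<bar>\<tau>\<bar> \<le> real n" by linarith
          thus ?case by (auto simp: indicator_def)
        qed
      qed
    qed (use intline[OF s] in \<open>auto simp: indicator_def intro: borel_measurable_integrable\<close>)
    moreover have "(LBINT \<tau>. indicator {- real n..real n} \<tau> *\<^sub>R P (Complex \<sigma> \<tau>)) = integral {- real n..real n} (\<lambda>\<tau>. P (Complex \<sigma> \<tau>))" for n
    proof -
      have "set_integrable lborel {- real n..real n} (\<lambda>\<tau>. P (Complex \<sigma> \<tau>))"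
        unfolding set_integrable_def using intline[OF s] by (intro integrable_mult_indicator) auto
      from set_borel_integral_eq_integral(2)[OF this] show ?thesis by (simp add: set_lebesgue_integral_def)
    qed
    ultimately show ?thesis by simp
  qed
  have "(\<lambda>n::nat. integral {\<sigma>1..\<sigma>2} (\<lambda>\<sigma>. (P (Complex \<sigma> (real n)) - P (Complex \<sigma> (- real n))) / \<i>)) \<longlonglongrightarrow> 0"
  proof (rule Lim_null_comparison)
    show "\<forall>\<^sub>F n in sequentially. norm (integral {\<sigma>1..\<sigma>2} (\<lambda>\<sigma>. (P (Complex \<sigma> (real n)) - P (Complex \<sigma> (- real n))) / \<i>))
        \<le> (2 * (C / (1 + (real n)\<^sup>2))) * (\<sigma>2 - \<sigma>1)"
    proof (intro always_eventually allI)
      fix n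
      have "norm ((P (Complex \<sigma> (real n)) - P (Complex \<sigma> (- real n))) / \<i>) \<le> 2 * (C / (1 + (real n)\<^sup>2))" if "\<sigma> \<in> {\<sigma>1..\<sigma>2}" for \<sigma>
      proof -
        have "norm (P (Complex \<sigma> (real n)) - P (Complex \<sigma> (- real n))) \<le> norm (P (Complex \<sigma> (real n))) + norm (P (Complex \<sigma> (- real n)))"
          by (rule norm_triangle_ineq4)
        also have "\<dots> \<le> C / (1 + (real n)\<^sup>2) + C / (1 + (- real n)\<^sup>2)"
          using that by (intro add_mono bound) auto
        finally show ?thesis by (simp add: norm_divide norm_mult)
      qed
      thus "norm (integral {\<sigma>1..\<sigma>2} (\<lambda>\<sigma>. (P (Complex \<sigma> (real n)) - P (Complex \<sigma> (- real n))) / \<i>))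
        \<le> (2 * (C / (1 + (real n)\<^sup>2))) * (\<sigma>2 - \<sigma>1)"
        using \<sigma> by (intro integral_bound continuous_intros controw) auto
    qed
    show "(\<lambda>n. (2 * (C / (1 + (real n)\<^sup>2))) * (\<sigma>2 - \<sigma>1)) \<longlonglongrightarrow> 0"
      by real_asymp
  qed
  moreover have "(\<lambda>n::nat. integral {- real n..real n} (\<lambda>\<tau>. P (Complex \<sigma>2 \<tau>)) - integral {- real n..real n} (\<lambda>\<tau>. P (Complex \<sigma>1 \<tau>)))
      \<longlonglongrightarrow> (LBINT \<tau>. P (Complex \<sigma>2 \<tau>)) - (LBINT \<tau>. P (Complex \<sigma>1 \<tau>))"
    using \<sigma> by (intro tendsto_diff lim) auto
  ultimately have "(LBINT \<tau>. P (Complex \<sigma>2 \<tau>)) - (LBINT \<tau>. P (Complex \<sigma>1 \<tau>)) = 0"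
    unfolding rect[OF of_nat_0_le_iff] using LIMSEQ_unique by blast
  thus ?thesis by simp
qed

section \<open>The isometry identity in logarithmic coordinates\<close>

text \<open>The real ray accumulates at the interior point c + 1 and the half plane is connected.
  All transform identities are thereby reduced to real arguments.\<close>

lemma eq_on_halfplane_of_eq_on_reals:
  assumes f: "f holomorphic_on {w. Re w > c}" and g: "g holomorphic_on {w. Re w > c}"
    and eq: "\<And>\<sigma>. \<sigma> > c \<Longrightarrow> f (of_real \<sigma>) = g (of_real \<sigma>)" and w: "Re w > c"
  shows "f w = g w"
proof -
  let ?S = "{w. Re w > c}" and ?\<xi> = "complex_of_real (c + 1)"
  have "(\<lambda>w. f w - g w) w = 0"
  proof (rule analytic_continuation[of "\<lambda>w. f w - g w" ?S "complex_of_real ` {c<..}" ?\<xi>])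
    show "?\<xi> islimpt complex_of_real ` {c<..}"
      unfolding islimpt_sequential
    proof (intro exI[of _ "\<lambda>n. complex_of_real (c + 1 + 1 / real (Suc n))"] conjI allI)
      show "complex_of_real (c + 1 + 1 / real (Suc n)) \<in> complex_of_real ` {c<..} - {?\<xi>}" for n
      proof -
        have "1 / real (Suc n) > 0" by simp
        hence "c + 1 + 1 / real (Suc n) \<in> {c<..}" "c + 1 + 1 / real (Suc n) \<noteq> c + 1" by (simp_all add: add_pos_pos del: of_nat_Suc)
        thus ?thesis by (metis DiffI image_eqI of_real_eq_iff singletonD)
      qed
      have "(\<lambda>n. c + 1 + 1 / real (Suc n)) \<longlonglongrightarrow> c + 1 + 0"
        by (intro tendsto_intros LIMSEQ_Suc[OF lim_const_over_n])
      thus "(\<lambda>n. complex_of_real (c + 1 + 1 / real (Suc n))) \<longlonglongrightarrow> ?\<xi>"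
        by (intro tendsto_of_real) simp
    qed
    show "connected ?S" by (intro convex_connected convex_halfspace_Re_gt)
  qed (use f g eq w in \<open>auto intro!: holomorphic_intros open_halfspace_Re_gt\<close>)
  thus ?thesis by simp
qed

abbreviation "h_log \<omega> \<equiv> \<lambda>t. h_fun \<omega> (exp t)"
abbreviation "h1_log \<omega> \<equiv> \<lambda>t. h1_fun \<omega> (exp t)"

context
  fixes \<omega> :: real
  assumes \<omega>: "\<omega> > 0"
begin

lemma h_log_measurable: "(h_log \<omega>) \<in> borel_measurable borel"
  and h1_log_measurable: "(h1_log \<omega>) \<in> borel_measurable borel"
proof -
  \<comment> \<open>Measurability is drawn from the transform lemma at one sample exponent.\<close>
  have s: "\<omega> + 2 > \<omega> + 1" by simp
  show "(h_log \<omega>) \<in> borel_measurable borel"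
    by (rule has_bochner_integral_dirichlet_kernel(1)[OF \<omega> s has_bochner_integral_g_log[OF \<omega> s] _ g_log_measurable[OF \<omega>] h_fun_exp])
       (simp add: g_log_def)
  show "(h1_log \<omega>) \<in> borel_measurable borel"
    by (rule has_bochner_integral_dirichlet_kernel(1)[OF \<omega> s has_bochner_integral_g1_log[OF \<omega> s] _ g1_log_measurable[OF \<omega>] h1_fun_exp])
       (simp add: g1_log_def)
qed

lemma h_log_laplace:
  assumes "\<sigma> > \<omega> + 1"
  shows "has_bochner_integral lborel (\<lambda>t. h_fun \<omega> (exp t) * exp ((1 - \<sigma>) * t)) (zetar (\<sigma> - \<omega>) / zetar (\<sigma> + \<omega>) * g_laplace \<omega> \<sigma>)"
  by (rule has_bochner_integral_dirichlet_kernel(2)[OF \<omega> assms has_bochner_integral_g_log[OF \<omega> assms] _ g_log_measurable[OF \<omega>] h_fun_exp])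
     (simp add: g_log_def)

lemma h1_log_laplace:
  assumes "\<sigma> > \<omega> + 1"
  shows "has_bochner_integral lborel (\<lambda>t. h1_fun \<omega> (exp t) * exp ((1 - \<sigma>) * t)) (zetar (\<sigma> - \<omega>) / zetar (\<sigma> + \<omega>) * (g_laplace \<omega> \<sigma> / (\<sigma> - 1/2)))"
  by (rule has_bochner_integral_dirichlet_kernel(2)[OF \<omega> assms has_bochner_integral_g1_log[OF \<omega> assms] _ g1_log_measurable[OF \<omega>] h1_fun_exp])
     (simp add: g1_log_def)

lemma h_log_nonpos: "t \<le> 0 \<Longrightarrow> h_fun \<omega> (exp t) = 0" and h1_log_nonpos: "t \<le> 0 \<Longrightarrow> h1_fun \<omega> (exp t) = 0"
  by (simp_all add: h_fun_def h1_fun_def)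

lemma kernel_hat_of_real:
  assumes "has_bochner_integral lborel (\<lambda>t. K t * exp ((1 - \<sigma>) * t)) v"
  shows "kernel_hat K (of_real \<sigma>) = of_real v"
proof -
  have "of_real (K t) * exp ((1 - complex_of_real \<sigma>) * of_real t) = complex_of_real (K t * exp ((1 - \<sigma>) * t))" for t
    by (simp add: exp_of_real[symmetric])
  thus ?thesis using assms unfolding kernel_hat_def by (simp add: has_bochner_integral_iff del: of_real_mult)
qed

lemma kernel_hat_h_holomorphic: "kernel_hat (h_log \<omega>) holomorphic_on {w. Re w > \<omega> + 1}"
  using h_log_laplace by (intro kernel_hat_holomorphic h_log_measurable h_log_nonpos) (auto simp: has_bochner_integral_iff)

lemma kernel_hat_h1:
  assumes "Re w > \<omega> + 1"
  shows "kernel_hat (h1_log \<omega>) w = kernel_hat (h_log \<omega>) w / (w - 1/2)"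
proof (rule eq_on_halfplane_of_eq_on_reals[OF _ _ _ assms])
  show "kernel_hat (h1_log \<omega>) holomorphic_on {w. Re w > \<omega> + 1}"
    using h1_log_laplace by (intro kernel_hat_holomorphic h1_log_measurable h1_log_nonpos) (auto simp: has_bochner_integral_iff)
  show "(\<lambda>w. kernel_hat (h_log \<omega>) w / (w - 1/2)) holomorphic_on {w. Re w > \<omega> + 1}"
  proof (intro holomorphic_intros kernel_hat_h_holomorphic)
    fix w assume "w \<in> {w. Re w > \<omega> + 1}"
    hence "Re (w - 1/2) \<noteq> 0" using \<omega> by simp
    thus "w - 1/2 \<noteq> 0" by (metis zero_complex.simps(1))
  qed
  show "kernel_hat (h1_log \<omega>) (of_real \<sigma>) = kernel_hat (h_log \<omega>) (of_real \<sigma>) / (of_real \<sigma> - 1/2)" if "\<sigma> > \<omega> + 1" for \<sigma>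
    using kernel_hat_of_real[OF h_log_laplace[OF that]] kernel_hat_of_real[OF h1_log_laplace[OF that]]
    by simp
qed

text \<open>The multiplier is the holomorphic representative G from
  \<open>meromorphic_inner\<close>, transported to the half plane Re w > 1/2. It extends the kernel
  transform, which is known only for Re w > \<omega> + 1, with one bound throughout and boundary
  modulus 1.\<close>

lemma inner_multiplier:
  assumes "meromorphic_inner (Theta \<omega>)"
  obtains \<Phi> M where "\<Phi> holomorphic_on {w. Re w > 1/2}" "\<forall>w. Re w > 1/2 \<longrightarrow> norm (\<Phi> w) \<le> M"
    "\<forall>w. Re w > \<omega> + 1 \<longrightarrow> kernel_hat (h_log \<omega>) w = \<Phi> w"
    "AE x in lborel. (\<lambda>n. norm (\<Phi> (Complex (1/2 + 1 / real (Suc n)) (- x)))) \<longlonglongrightarrow> 1"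
proof -
  obtain G where G: "G holomorphic_on upper_half" "bounded (G ` upper_half)"
    and GT: "\<And>z. z \<in> upper_half \<Longrightarrow> \<forall>\<^sub>F w in at z. Theta \<omega> w = G w"
    and bd: "AE x in lborel. \<exists>c. (G \<longlongrightarrow> c) (at (complex_of_real x) within upper_half) \<and> cmod c = 1"
    using assms unfolding meromorphic_inner_def by blast
  \<comment> \<open>The inverse of w = 1/2 - \<i> * z.\<close>
  define m where "m = (\<lambda>w. \<i> * (w - 1/2))"
  define \<Phi> where "\<Phi> = (\<lambda>w. G (m w))"
  have m: "m w \<in> upper_half" if "Re w > 1/2" for w using that by (simp add: m_def upper_half_def)
  obtain M where M: "\<And>z. z \<in> upper_half \<Longrightarrow> norm (G z) \<le> M"
    using G(2) unfolding bounded_iff by auto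
  have hol: "\<Phi> holomorphic_on {w. Re w > 1/2}"
  proof -
    have "m holomorphic_on {w. Re w > 1/2}" unfolding m_def by (intro holomorphic_intros)
    moreover have "m ` {w. Re w > 1/2} \<subseteq> upper_half" using m by blast
    ultimately have "(G \<circ> m) holomorphic_on {w. Re w > 1/2}" using G(1) by (intro holomorphic_on_compose_gen)
    thus ?thesis unfolding \<Phi>_def o_def .
  qed
  have oU: "open upper_half" unfolding upper_half_def by (rule open_halfspace_Im_gt)
  have val: "kernel_hat (h_log \<omega>) (of_real \<sigma>) = \<Phi> (of_real \<sigma>)" if s: "\<sigma> > \<omega> + 1" for \<sigma>
  proof -
    define z where "z = m (of_real \<sigma>)"
    have z: "z \<in> upper_half" using s \<omega> unfolding z_def by (intro m) auto
    have ar: "1/2 - of_real \<omega> - \<i> * z = of_real (\<sigma> - \<omega>)" "1/2 + of_real \<omega> - \<i> * z = of_real (\<sigma> + \<omega>)"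
      by (simp_all add: z_def m_def algebra_simps)
    have xc: "isCont xi w" for w
      using holomorphic_on_imp_continuous_on[OF xi_holomorphic] by (simp add: continuous_on_eq_continuous_at)
    have nz: "xi (1/2 + of_real \<omega> - \<i> * z) \<noteq> 0" unfolding ar using s \<omega> by (intro xi_of_real_nonzero) auto
    \<comment> \<open>G and \<open>Theta \<omega>\<close> are known to agree only on a punctured
      neighbourhood of z. Here the denominator does not vanish, so \<open>Theta \<omega>\<close> is
      continuous and both functions have the same value at z.\<close>
    have "isCont (Theta \<omega>) z"
      unfolding Theta_def using nz
      by (intro continuous_intros isCont_o2[OF _ xc]) auto
    hence "(Theta \<omega> \<longlongrightarrow> Theta \<omega> z) (at z)" by (simp add: isCont_def)
    hence "(G \<longlongrightarrow> Theta \<omega> z) (at z)" by (rule Lim_transform_eventually[OF _ GT[OF z]])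
    moreover have "(G \<longlongrightarrow> G z) (at z)"
      using holomorphic_on_imp_continuous_on[OF G(1)] z oU by (simp add: continuous_on_eq_continuous_at isCont_def)
    ultimately have "G z = Theta \<omega> z" by (intro tendsto_unique[of "at z" G]) auto
    also have "\<dots> = of_real (zetar (\<sigma> - \<omega>) / zetar (\<sigma> + \<omega>) * g_laplace \<omega> \<sigma>)"
      unfolding Theta_def ar by (rule xi_quotient[OF \<omega> s])
    finally show ?thesis using kernel_hat_of_real[OF h_log_laplace[OF s]] by (simp only: \<Phi>_def z_def)
  qed
  have eq: "kernel_hat (h_log \<omega>) w = \<Phi> w" if "Re w > \<omega> + 1" for w
    by (rule eq_on_halfplane_of_eq_on_reals[OF kernel_hat_h_holomorphic _ val that])
       (use \<omega> in \<open>auto intro: holomorphic_on_subset[OF hol]\<close>)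
  have lim: "AE x in lborel. (\<lambda>n. norm (\<Phi> (Complex (1/2 + 1 / real (Suc n)) (- x)))) \<longlonglongrightarrow> 1"
    using bd
  proof eventually_elim
    case (elim x)
    then obtain c where c: "(G \<longlongrightarrow> c) (at (complex_of_real x) within upper_half)" "cmod c = 1" by blast
    have mz: "m (Complex (1/2 + 1 / real (Suc n)) (- x)) = of_real x + \<i> * of_real (1 / real (Suc n))" for n
      by (simp add: m_def Complex_eq algebra_simps del: of_nat_Suc)
    have "(\<lambda>n. of_real x + \<i> * of_real (1 / real (Suc n))) \<longlonglongrightarrow> of_real x + \<i> * of_real 0"
      by (intro tendsto_intros LIMSEQ_Suc[OF lim_const_over_n])
    moreover have "of_real x + \<i> * of_real (1 / real (Suc n)) \<in> upper_half" "of_real x + \<i> * of_real (1 / real (Suc n)) \<noteq> complex_of_real x" for n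
      by (simp_all add: upper_half_def del: of_nat_Suc)
    ultimately have "filterlim (\<lambda>n. of_real x + \<i> * of_real (1 / real (Suc n))) (at (complex_of_real x) within upper_half) sequentially"
      unfolding filterlim_at by simp
    from filterlim_compose[OF c(1) this] have "(\<lambda>n. \<Phi> (Complex (1/2 + 1 / real (Suc n)) (- x))) \<longlonglongrightarrow> c"
      unfolding \<Phi>_def mz .
    from tendsto_norm[OF this] c(2) show ?case by simp
  qed
  show ?thesis
    by (rule that[OF hol _ _ lim]) (use M m eq in \<open>auto simp: \<Phi>_def\<close>)
qed

end

text \<open>On each line \<sigma> slightly to the right of 1/2, I times an exponential is, up to 1 /
  (2 pi), the Fourier transform of F times the multiplier. Plancherel evaluates its norm, and as
  \<sigma> tends to 1/2 the multiplier drops out in modulus.\<close>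

lemma (in compact_C2) isometry_log:
  fixes \<Phi> :: "complex \<Rightarrow> complex"
  assumes [measurable]: "K \<in> borel_measurable borel" and K0: "\<And>t. t \<le> 0 \<Longrightarrow> K t = 0"
    and Kint: "\<And>\<sigma>. \<sigma> > c \<Longrightarrow> integrable lborel (\<lambda>t. K t * exp ((1 - \<sigma>) * t))" and c: "c \<ge> 1/2"
    and \<Phi>: "\<Phi> holomorphic_on {w. Re w > 1/2}" and M: "\<And>w. Re w > 1/2 \<Longrightarrow> norm (\<Phi> w) \<le> M"
    and eq: "\<And>w. Re w > c \<Longrightarrow> kernel_hat K w = \<Phi> w"
    and lim: "AE x in lborel. (\<lambda>n. norm (\<Phi> (Complex (1/2 + 1 / real (Suc n)) (- x)))) \<longlonglongrightarrow> 1"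
  defines "I \<equiv> (\<lambda>r. \<integral>t. of_real (K (r + t)) * a t * of_real (exp t) \<partial>lborel)"
  shows "I \<in> borel_measurable borel"
    and "integrable lborel (\<lambda>r. (norm (I r))\<^sup>2 * exp r)"
    and "(LBINT r. (norm (I r))\<^sup>2 * exp r) = (LBINT t. (norm (a t))\<^sup>2 * exp t)"
proof -
  define V where "V = c + 2"
  obtain C where C0: "C \<ge> 0" and C: "\<forall>\<sigma> \<tau>. 1/2 \<le> \<sigma> \<longrightarrow> \<sigma> \<le> V \<longrightarrow> norm (F (Complex \<sigma> \<tau>)) \<le> C / (1 + \<tau>\<^sup>2)"
    using F_bound by blast
  have M0: "M \<ge> 0" using order_trans[OF norm_ge_zero M[of 1]] by simp
  define Q where "Q = (\<lambda>w. F w * \<Phi> w)"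
  have holF: "F holomorphic_on S" for S using F_holomorphic by (rule holomorphic_on_subset) auto
  have holQ: "Q holomorphic_on {w. Re w > 1/2}" unfolding Q_def by (intro holomorphic_intros holF \<Phi>)
  have Qb: "norm (Q (Complex \<sigma> \<tau>)) \<le> C * M / (1 + \<tau>\<^sup>2)" if "1/2 < \<sigma>" "\<sigma> \<le> V" for \<sigma> \<tau>
  proof -
    have "norm (F (Complex \<sigma> \<tau>)) * norm (\<Phi> (Complex \<sigma> \<tau>)) \<le> C / (1 + \<tau>\<^sup>2) * M"
      using C C0 that by (intro mult_mono M) (auto intro: divide_nonneg_nonneg)
    thus ?thesis by (simp add: Q_def norm_mult)
  qed
  have rep: "I r = (1 / (2 * pi)) * (LBINT \<tau>. Q (Complex \<sigma> \<tau>) * exp ((Complex \<sigma> \<tau> - 1) * of_real r))"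
    if s: "1/2 < \<sigma>" "\<sigma> \<le> c + 1" for \<sigma> r
  proof -
    have "I r = (1 / (2 * pi)) * (LBINT \<tau>. F (Complex (c + 1) \<tau>) * kernel_hat K (Complex (c + 1) \<tau>) * exp ((Complex (c + 1) \<tau> - 1) * of_real r))"
      unfolding I_def using c by (intro kernel_representation Kint) auto
    also have "\<dots> = (1 / (2 * pi)) * (LBINT \<tau>. Q (Complex (c + 1) \<tau>) * exp ((Complex (c + 1) \<tau> - 1) * of_real r))"
      by (simp add: eq Q_def)
    also have "(LBINT \<tau>. Q (Complex (c + 1) \<tau>) * exp ((Complex (c + 1) \<tau> - 1) * of_real r))
       = (LBINT \<tau>. Q (Complex \<sigma> \<tau>) * exp ((Complex \<sigma> \<tau> - 1) * of_real r))"
    \<comment> \<open>The start is the line c + 1, where the kernel transform converges and equals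
      the multiplier; from there only the multiplier is continued to the left.\<close>
    proof (rule line_integral_shift[symmetric, where P = "\<lambda>w. Q w * exp ((w - 1) * of_real r)" and c = "1/2"
          and C = "C * M * exp ((c + 2) * \<bar>r\<bar>)"])
      show "(\<lambda>w. Q w * exp ((w - 1) * of_real r)) holomorphic_on {w. 1/2 < Re w}"
        by (intro holomorphic_intros holQ)
      fix s \<tau> assume s': "\<sigma> \<le> s" "s \<le> c + 1"
      \<comment> \<open>For fixed r the exponential is bounded on the whole strip crossed by the
        shift, uniformly in \<tau>.\<close>
      have "\<bar>s - 1\<bar> \<le> c + 2" using s s' c by auto
      hence "\<bar>(s - 1) * r\<bar> \<le> (c + 2) * \<bar>r\<bar>" unfolding abs_mult by (rule mult_right_mono) simp
      hence "exp ((s - 1) * r) \<le> exp ((c + 2) * \<bar>r\<bar>)" by auto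
      moreover have "norm (Q (Complex s \<tau>)) \<le> C * M / (1 + \<tau>\<^sup>2)" using s s' by (intro Qb) (auto simp: V_def)
      ultimately have "norm (Q (Complex s \<tau>)) * exp ((s - 1) * r) \<le> C * M / (1 + \<tau>\<^sup>2) * exp ((c + 2) * \<bar>r\<bar>)"
        using C0 M0 by (intro mult_mono) (auto intro: divide_nonneg_nonneg)
      thus "norm (Q (Complex s \<tau>) * exp ((Complex s \<tau> - 1) * of_real r)) \<le> C * M * exp ((c + 2) * \<bar>r\<bar>) / (1 + \<tau>\<^sup>2)"
        by (simp add: norm_mult)
    qed (use s in auto)
    finally show ?thesis .
  qed
  define s where "s = (\<lambda>n. 1/2 + 1 / real (Suc n))"
  have s: "1/2 < s n" "s n \<le> c + 1" "s n \<le> V" for n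
  proof -
    have "1 / real (Suc n) \<le> 1" by simp
    with c show "s n \<le> c + 1" unfolding s_def by (rule add_mono)
    thus "s n \<le> V" by (simp add: V_def)
    show "1/2 < s n" by (simp add: s_def add_pos_nonneg)
  qed
  define H where "H = (\<lambda>n \<tau>. Q (Complex (s n) \<tau>))"
  have Hc: "continuous_on UNIV (H n)" for n
    unfolding H_def
    by (rule continuous_on_compose2[OF holomorphic_on_imp_continuous_on[OF holQ]])
       (use s in \<open>auto simp: Complex_eq intro!: continuous_intros\<close>)
  have [measurable]: "H n \<in> borel_measurable borel" for n using Hc by (rule borel_measurable_continuous_onI)
  have Hq: "norm (H n \<tau>) \<le> C * M / (1 + \<tau>\<^sup>2)" for n \<tau> unfolding H_def using s by (intro Qb) auto
  have Hb: "norm (H n \<tau>) \<le> C * M" for n \<tau>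
  proof -
    have "C * M / (1 + \<tau>\<^sup>2) \<le> C * M / 1" using C0 M0 by (intro divide_left_mono) (auto simp: add_pos_nonneg)
    thus ?thesis using Hq[of n \<tau>] by simp
  qed
  have Hi: "integrable lborel (H n)" for n
  proof (rule Bochner_Integration.integrable_bound[OF integrable_inverse_quadratic])
    show "AE \<tau> in lborel. norm (H n \<tau>) \<le> norm (C * M / (1 + \<tau>\<^sup>2))"
      unfolding real_norm_def using Hq by (intro AE_I2 order_trans[OF _ abs_ge_self]) blast
  qed measurable
  have IH: "I r = of_real (1 / (2 * pi)) * of_real (exp ((s n - 1) * r)) * fourier (H n) r" for n r
  proof -
    have "I r = (1 / (2 * pi)) * (LBINT \<tau>. of_real (exp ((s n - 1) * r)) * (H n \<tau> * exp (\<i> * of_real (\<tau> * r))))"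
      unfolding rep[OF s(1,2)[of n]]
    proof (intro arg_cong[where f = "(*) _"] Bochner_Integration.integral_cong refl)
      fix \<tau>
      have "exp ((Complex (s n) \<tau> - 1) * of_real r) = of_real (exp ((s n - 1) * r)) * exp (\<i> * of_real (\<tau> * r))"
        by (simp add: Complex_eq exp_of_real[symmetric] algebra_simps flip: exp_add)
      thus "Q (Complex (s n) \<tau>) * exp ((Complex (s n) \<tau> - 1) * of_real r)
          = of_real (exp ((s n - 1) * r)) * (H n \<tau> * exp (\<i> * of_real (\<tau> * r)))"
        by (simp add: H_def mult_ac)
    qed
    also have "\<dots> = (1 / (2 * pi)) * (of_real (exp ((s n - 1) * r)) * fourier (H n) r)"
      by (subst integral_mult_right_zero) (rule refl)
    finally show ?thesis by (simp only: mult.assoc)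
  qed
  have "(\<lambda>r. of_real (1 / (2 * pi)) * of_real (exp ((s 0 - 1) * r)) * fourier (H 0) r) \<in> borel_measurable borel"
    by measurable
  thus Im [measurable]: "I \<in> borel_measurable borel" unfolding IH[of _ 0, symmetric] .
  \<comment> \<open>If t lies in the support then r + t \<le> 0, where K vanishes; elsewhere a
    vanishes.\<close>
  have I0: "I r = 0" if "r \<le> - B" for r
  proof -
    have z: "of_real (K (r + t)) * a t * of_real (exp t) = 0" for t
      using that K0[of "r + t"] supp[of t] by (cases "t \<le> B") auto
    show ?thesis unfolding I_def z by simp
  qed
  \<comment> \<open>The damping is the defect of the line s n relative to 1/2, recentred at - B.
    Recentring makes the exponent nonpositive wherever I is nonzero, so the damped functions
    increase with n to the undamped one.\<close>
  define \<phi> where "\<phi> = (\<lambda>n r. (norm (I r))\<^sup>2 * exp r * exp (- (2 / real (Suc n)) * (r + B)))"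
  have \<phi>eq: "\<phi> n r = exp (- (2 / real (Suc n)) * B) / (2 * pi)\<^sup>2 * (norm (fourier (H n) r))\<^sup>2" for n r
  proof -
    have x1: "(exp ((s n - 1) * r))\<^sup>2 * exp r * exp (- (2 / real (Suc n)) * (r + B)) = exp (- (2 / real (Suc n)) * B)"
      by (simp add: s_def power2_eq_square algebra_simps add_divide_distrib flip: exp_add)
    have x2: "(norm (I r))\<^sup>2 = (1 / (2 * pi))\<^sup>2 * (exp ((s n - 1) * r))\<^sup>2 * (norm (fourier (H n) r))\<^sup>2"
      unfolding IH[of r n] by (simp add: norm_mult norm_divide power_mult_distrib power_divide)
    have "\<phi> n r = (1 / (2 * pi))\<^sup>2 * (norm (fourier (H n) r))\<^sup>2 * exp (- (2 / real (Suc n)) * B)"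
      unfolding \<phi>_def x2 x1[symmetric] by (simp only: mult_ac)
    thus ?thesis by (simp add: power_divide)
  qed
  have \<phi>i: "integrable lborel (\<phi> n)" for n
    unfolding \<phi>eq[abs_def] by (intro integrable_mult_right plancherel_integrable[OF Hi Hb Hc])
  have \<phi>v: "(LBINT r. \<phi> n r) = exp (- (2 / real (Suc n)) * B) / (2 * pi) * (LBINT \<tau>. (norm (H n \<tau>))\<^sup>2)" for n
    unfolding \<phi>eq using plancherel[OF Hi Hb Hc, of n] by (simp add: power2_eq_square)
  have Hlim: "(\<lambda>n. \<integral>\<tau>. (norm (H n \<tau>))\<^sup>2 \<partial>lborel) \<longlonglongrightarrow> (LBINT \<tau>. (norm (F (Complex (1/2) \<tau>)))\<^sup>2)"
  proof -
    have Fm [measurable]: "(\<lambda>\<tau>. F (Complex \<sigma> \<tau>)) \<in> borel_measurable borel" for \<sigma>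
      using F_line_continuous by (rule borel_measurable_continuous_onI)
    \<comment> \<open>The reflection matches the boundary hypothesis: height - x on the line belongs
      to the boundary point x.\<close>
    have "(\<lambda>n. \<integral>x. (norm (H n (- x)))\<^sup>2 \<partial>lborel) \<longlonglongrightarrow> (LBINT x. (norm (F (Complex (1/2) (- x))))\<^sup>2)"
    proof (rule integral_dominated_convergence[where w = "\<lambda>x. (C * M)\<^sup>2 / (1 + x\<^sup>2)"])
      show "AE x in lborel. (\<lambda>n. (norm (H n (- x)))\<^sup>2) \<longlonglongrightarrow> (norm (F (Complex (1/2) (- x))))\<^sup>2"
        using lim
      proof eventually_elim
        case (elim x)
        have "(\<lambda>n. of_real (1/2 + 1 / real (Suc n)) + \<i> * of_real (- x)) \<longlonglongrightarrow> of_real (1/2 + 0) + \<i> * complex_of_real (- x)"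
          by (intro tendsto_intros LIMSEQ_Suc[OF lim_const_over_n])
        hence "(\<lambda>n. Complex (s n) (- x)) \<longlonglongrightarrow> Complex (1/2) (- x)"
          unfolding Complex_eq s_def by simp
        moreover have "isCont F (Complex (1/2) (- x))"
          using holomorphic_on_imp_continuous_on[OF F_holomorphic] by (simp add: continuous_on_eq_continuous_at)
        ultimately have "(\<lambda>n. F (Complex (s n) (- x))) \<longlonglongrightarrow> F (Complex (1/2) (- x))"
          by (rule isCont_tendsto_compose[rotated])
        hence "(\<lambda>n. (norm (F (Complex (s n) (- x))) * norm (\<Phi> (Complex (s n) (- x))))\<^sup>2) \<longlonglongrightarrow> (norm (F (Complex (1/2) (- x))) * 1)\<^sup>2"
          using elim unfolding s_def by (intro tendsto_intros)
        thus ?case by (simp add: H_def Q_def norm_mult)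
      qed
      show "AE x in lborel. norm ((norm (H n (- x)))\<^sup>2) \<le> (C * M)\<^sup>2 / (1 + x\<^sup>2)" for n
      proof (rule AE_I2)
        fix x :: real
        have p: "1 \<le> 1 + x\<^sup>2" by simp
        have "(norm (H n (- x)))\<^sup>2 \<le> (C * M / (1 + x\<^sup>2))\<^sup>2" using Hq[of n "- x"] by (intro power_mono) auto
        also have "\<dots> = (C * M)\<^sup>2 / (1 + x\<^sup>2)\<^sup>2" by (rule power_divide)
        also have "\<dots> \<le> (C * M)\<^sup>2 / (1 + x\<^sup>2)"
        proof (intro divide_left_mono mult_pos_pos zero_less_power)
          show "1 + x\<^sup>2 \<le> (1 + x\<^sup>2)\<^sup>2" using power_increasing[of 1 2 "1 + x\<^sup>2"] p by simp
        qed (use p in \<open>auto intro: order_less_le_trans[OF zero_less_one]\<close>)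
        finally show "norm ((norm (H n (- x)))\<^sup>2) \<le> (C * M)\<^sup>2 / (1 + x\<^sup>2)" by simp
      qed
      have "(\<lambda>x. F (Complex (1/2) (- x))) \<in> borel_measurable borel"
        by (rule measurable_compose[OF _ Fm[of "1/2"]]) measurable
      thus "(\<lambda>x. (norm (F (Complex (1/2) (- x))))\<^sup>2) \<in> borel_measurable lborel" by simp
    qed (use integrable_inverse_quadratic in auto)
    moreover have reflect: "(LBINT x. g (- x)) = (LBINT x. g x)" for g :: "real \<Rightarrow> real"
      using lborel_integral_real_affine[of "- 1" g 0] by simp
    have "(LBINT x. (norm (H n (- x)))\<^sup>2) = (LBINT x. (norm (H n x))\<^sup>2)" for n by (rule reflect)
    moreover have "(LBINT x. (norm (F (Complex (1/2) (- x))))\<^sup>2) = (LBINT x. (norm (F (Complex (1/2) x)))\<^sup>2)" by (rule reflect)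
    ultimately show ?thesis by (simp only:)
  qed
  have e1: "(\<lambda>n. exp (- (2 / real (Suc n)) * b)) \<longlonglongrightarrow> 1" for b
  proof -
    have "(\<lambda>n. exp (- (2 / real (Suc n)) * b)) \<longlonglongrightarrow> exp (- 0 * b)"
      by (intro tendsto_intros LIMSEQ_Suc[OF lim_const_over_n])
    thus ?thesis by simp
  qed
  have \<phi>lim: "(\<lambda>n. \<integral>r. \<phi> n r \<partial>lborel) \<longlonglongrightarrow> (LBINT t. (norm (a t))\<^sup>2 * exp t)"
  proof -
    have "(\<lambda>n. \<integral>r. \<phi> n r \<partial>lborel) \<longlonglongrightarrow> 1 / (2 * pi) * (LBINT \<tau>. (norm (F (Complex (1/2) \<tau>)))\<^sup>2)"
      unfolding \<phi>v by (intro tendsto_intros e1 Hlim) simp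
    thus ?thesis unfolding F_plancherel by simp
  qed
  have mono: "AE r in lborel. mono (\<lambda>n. \<phi> n r)"
  proof (rule AE_I2)
    fix r
    show "mono (\<lambda>n. \<phi> n r)"
    proof (cases "r \<le> - B")
      case True
      thus ?thesis by (simp add: \<phi>_def I0 mono_def)
    next
      case False
      have "(2 / real (Suc n)) * (r + B) \<le> (2 / real (Suc m)) * (r + B)" if "m \<le> n" for m n
        using that False by (intro mult_right_mono divide_left_mono) auto
      thus ?thesis unfolding \<phi>_def by (intro monoI mult_left_mono) auto
    qed
  qed
  have ptw: "AE r in lborel. (\<lambda>n. \<phi> n r) \<longlonglongrightarrow> (norm (I r))\<^sup>2 * exp r"
  proof (rule AE_I2)
    fix r
    have "(\<lambda>n. \<phi> n r) \<longlonglongrightarrow> (norm (I r))\<^sup>2 * exp r * 1"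
      unfolding \<phi>_def by (intro tendsto_intros e1)
    thus "(\<lambda>n. \<phi> n r) \<longlonglongrightarrow> (norm (I r))\<^sup>2 * exp r" by simp
  qed
  show "integrable lborel (\<lambda>r. (norm (I r))\<^sup>2 * exp r)"
    by (rule integrable_monotone_convergence[OF \<phi>i mono ptw \<phi>lim]) measurable
  show "(LBINT r. (norm (I r))\<^sup>2 * exp r) = (LBINT t. (norm (a t))\<^sup>2 * exp t)"
    by (rule integral_monotone_convergence[OF \<phi>i mono ptw \<phi>lim]) measurable
qed

section \<open>The operators on test functions\<close>

abbreviation sqnorm :: "(real \<Rightarrow> complex) \<Rightarrow> real" where
  "sqnorm g \<equiv> \<integral>x. (cmod (g x))\<^sup>2 \<partial>posline"

lemma borel_measurable_posline: "g \<in> borel_measurable borel \<Longrightarrow> g \<in> borel_measurable posline"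
  by (intro measurable_restrict_space1 measurable_completion) simp

lemma L2pos_borelI:
  assumes [measurable]: "g \<in> borel_measurable borel"
    and "integrable lborel (\<lambda>r. (norm (g (exp r)))\<^sup>2 * exp r)"
  shows "L2pos g" "sqnorm g = (LBINT r. (norm (g (exp r)))\<^sup>2 * exp r)"
proof -
  have m: "(\<lambda>x. (cmod (g x))\<^sup>2) \<in> borel_measurable borel" by measurable
  show "L2pos g" unfolding L2pos_def
    using assms(2) integrable_posline_iff[OF m] by (simp add: borel_measurable_posline mult.commute)
  show "sqnorm g = (LBINT r. (norm (g (exp r)))\<^sup>2 * exp r)"
    unfolding integral_posline[OF m] by (simp add: mult.commute)
qed

lemma L2pos_test_fun:
  assumes "test_fun f"
  shows "L2pos f" "sqnorm f = (LBINT t. (norm (f (exp t)))\<^sup>2 * exp t)"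
proof -
  obtain a' a'' A B where "compact_C2 (\<lambda>t. f (exp t)) a' a'' A B" using test_fun_compact_C2[OF assms] by blast
  then interpret compact_C2 "\<lambda>t. f (exp t)" a' a'' A B .
  have "integrable lborel (\<lambda>t. (norm (f (exp t)))\<^sup>2 * exp t)"
    by (intro integrable_compact_supp continuous_intros cont) (use supp in auto)
  from L2pos_borelI[OF test_fun_measurable[OF assms] this]
  show "L2pos f" "sqnorm f = (LBINT t. (norm (f (exp t)))\<^sup>2 * exp t)" .
qed

context
  fixes \<omega> :: real
  assumes \<omega>: "\<omega> > 0"
begin

lemma h_fun_measurable: "h_fun \<omega> \<in> borel_measurable borel" and h1_fun_measurable: "h1_fun \<omega> \<in> borel_measurable borel"
proof -
  show "h_fun \<omega> \<in> borel_measurable borel"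
    by (rule borel_measurable_of_exp[OF h_log_measurable[OF \<omega>]]) (simp add: h_fun_def)
  show "h1_fun \<omega> \<in> borel_measurable borel"
    by (rule borel_measurable_of_exp[OF h1_log_measurable[OF \<omega>]]) (simp add: h1_fun_def)
qed

lemma int_op_h_exp:
  assumes "test_fun f"
  shows "int_op (h_fun \<omega>) f (exp r) = (LBINT t. of_real (h_fun \<omega> (exp (r + t))) * f (exp t) * of_real (exp t))"
    and "int_op (h1_fun \<omega>) f (exp r) = (LBINT t. of_real (h1_fun \<omega> (exp (r + t))) * f (exp t) * of_real (exp t))"
  by (rule int_op_exp[OF h_fun_measurable test_fun_measurable[OF assms]])
     (rule int_op_exp[OF h1_fun_measurable test_fun_measurable[OF assms]])

text \<open>Off the half line the operator gives 0, so Borel measurability on all of the line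
  follows from measurability along \<open>exp\<close>.\<close>

lemma int_op_h_nonpos: "x \<le> 0 \<Longrightarrow> int_op (h_fun \<omega>) f x = 0"
proof -
  assume x: "x \<le> 0"
  have "int_op (h_fun \<omega>) f x = (\<integral>y. 0 \<partial>posline)"
    unfolding int_op_def
  proof (intro Bochner_Integration.integral_cong refl)
    fix y assume "y \<in> space posline"
    hence "x * y \<le> 0" using x by (simp add: mult_nonpos_nonneg)
    thus "of_real (h_fun \<omega> (x * y)) * f y = 0" by (simp add: h_fun_def)
  qed
  thus ?thesis by simp
qed

lemma int_op_h_isometry:
  assumes inner: "meromorphic_inner (Theta \<omega>)" and f: "test_fun f"
  shows "L2pos (int_op (h_fun \<omega>) f)" "sqnorm (int_op (h_fun \<omega>) f) = sqnorm f"
proof -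
  obtain a' a'' A B where "compact_C2 (\<lambda>t. f (exp t)) a' a'' A B" using test_fun_compact_C2[OF f] by blast
  then interpret compact_C2 "\<lambda>t. f (exp t)" a' a'' A B .
  obtain \<Phi> M where \<Phi>: "\<Phi> holomorphic_on {w. Re w > 1/2}" and M: "\<forall>w. Re w > 1/2 \<longrightarrow> norm (\<Phi> w) \<le> M"
    and eq: "\<forall>w. Re w > \<omega> + 1 \<longrightarrow> kernel_hat (h_log \<omega>) w = \<Phi> w"
    and lim: "AE x in lborel. (\<lambda>n. norm (\<Phi> (Complex (1/2 + 1 / real (Suc n)) (- x)))) \<longlonglongrightarrow> 1"
    using inner_multiplier[OF \<omega> inner] by blast
  have ki: "integrable lborel (\<lambda>t. h_fun \<omega> (exp t) * exp ((1 - \<sigma>) * t))" if "\<sigma> > \<omega> + 1" for \<sigma>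
    using h_log_laplace[OF \<omega> that] by (simp add: has_bochner_integral_iff)
  have c: "\<omega> + 1 \<ge> 1/2" using \<omega> by simp
  note iso = isometry_log[OF h_log_measurable[OF \<omega>] h_log_nonpos[OF \<omega>] ki c \<Phi> M[rule_format] eq[rule_format] lim,
      folded int_op_h_exp(1)[OF f]]
  have m: "int_op (h_fun \<omega>) f \<in> borel_measurable borel"
    by (rule borel_measurable_of_exp[OF iso(1) int_op_h_nonpos])
  show "L2pos (int_op (h_fun \<omega>) f)" by (rule L2pos_borelI(1)[OF m iso(2)])
  show "sqnorm (int_op (h_fun \<omega>) f) = sqnorm f"
    by (rule trans[OF L2pos_borelI(2)[OF m iso(2)] trans[OF iso(3) L2pos_test_fun(2)[OF f, symmetric]]])
qed

text \<open>In the contour representation the factor \<open>sqrt x\<close> raises the exponent w - 1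
  to w - 1/2. Differentiation in r = ln x multiplies by precisely this number and cancels the
  divisor by which the transform of h1 differs from that of h. One fixed line, \<sigma> = \<omega> +
  2, suffices, so the identity holds for every x > 0.\<close>

lemma Htilde_eq:
  assumes f: "test_fun f" and x: "x > 0"
  shows "Htilde_pre \<omega> f differentiable (at x)" "Htilde \<omega> f x = int_op (h_fun \<omega>) f x"
proof -
  obtain a' a'' A B where "compact_C2 (\<lambda>t. f (exp t)) a' a'' A B" using test_fun_compact_C2[OF f] by blast
  then interpret compact_C2 "\<lambda>t. f (exp t)" a' a'' A B .
  define \<sigma> where "\<sigma> = \<omega> + 2"
  have \<sigma>: "\<sigma> > \<omega> + 1" "\<sigma> \<ge> 1/2" "\<sigma> - 1/2 > 0" using \<omega> by (auto simp: \<sigma>_def)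
  let ?K = "kernel_hat (h_log \<omega>)"
  define Q where "Q = (\<lambda>\<tau>. (1 / (2 * pi)) * (F (Complex \<sigma> \<tau>) * ?K (Complex \<sigma> \<tau>)))"
  have ki: "integrable lborel (\<lambda>t. h_fun \<omega> (exp t) * exp ((1 - \<sigma>) * t))"
    using h_log_laplace[OF \<omega> \<sigma>(1)] by (simp add: has_bochner_integral_iff)
  have k1i: "integrable lborel (\<lambda>t. h1_fun \<omega> (exp t) * exp ((1 - \<sigma>) * t))"
    using h1_log_laplace[OF \<omega> \<sigma>(1)] by (simp add: has_bochner_integral_iff)
  have Kc: "continuous_on UNIV (\<lambda>\<tau>. ?K (Complex \<sigma> \<tau>))"
    by (rule continuous_on_compose2[OF holomorphic_on_imp_continuous_on[OF kernel_hat_h_holomorphic[OF \<omega>]]])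
       (use \<sigma> in \<open>auto simp: Complex_eq intro!: continuous_intros\<close>)
  have Kb: "norm (?K (Complex \<sigma> \<tau>)) \<le> (LBINT t. norm (h_fun \<omega> (exp t) * exp ((1 - \<sigma>) * t)))" for \<tau>
    unfolding kernel_hat_def
    by (rule norm_integral_le_integral[OF integrable_norm[OF ki]]) (simp add: norm_mult abs_mult)
  have Q: "integrable lborel Q"
  proof (rule Bochner_Integration.integrable_bound)
    show "integrable lborel (\<lambda>\<tau>. (LBINT t. norm (h_fun \<omega> (exp t) * exp ((1 - \<sigma>) * t))) * norm (F (Complex \<sigma> \<tau>)))"
      by (intro integrable_mult_right integrable_norm integrable_F_line \<sigma>)
    have "continuous_on UNIV Q" unfolding Q_def by (intro continuous_intros F_line_continuous Kc)
    thus "Q \<in> borel_measurable lborel" by (simp add: borel_measurable_continuous_onI)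
    show "AE \<tau> in lborel. norm (Q \<tau>) \<le> norm ((LBINT t. norm (h_fun \<omega> (exp t) * exp ((1 - \<sigma>) * t))) * norm (F (Complex \<sigma> \<tau>)))"
    proof (rule AE_I2)
      fix \<tau>
      let ?b = "\<integral>t. norm (h_fun \<omega> (exp t) * exp ((1 - \<sigma>) * t)) \<partial>lborel"
      have "norm (Q \<tau>) = 1 / (2 * pi) * (norm (F (Complex \<sigma> \<tau>)) * norm (?K (Complex \<sigma> \<tau>)))"
        by (simp add: Q_def norm_mult norm_divide)
      also have "\<dots> \<le> 1 * (norm (F (Complex \<sigma> \<tau>)) * ?b)"
        using pi_gt3 by (intro mult_mono mult_left_mono Kb) auto
      also have "\<dots> \<le> norm (?b * norm (F (Complex \<sigma> \<tau>)))" by (simp add: abs_mult mult_ac)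
      finally show "norm (Q \<tau>) \<le> norm (?b * norm (F (Complex \<sigma> \<tau>)))" .
    qed
  qed
  define S where "S = (\<lambda>r. \<integral>\<tau>. Q \<tau> / Complex (\<sigma> - 1/2) \<tau> * exp (Complex (\<sigma> - 1/2) \<tau> * of_real r) \<partial>lborel)"
  have w: "Complex (\<sigma> - 1/2) \<tau> = Complex \<sigma> \<tau> - 1/2" for \<tau> by (simp add: complex_eq_iff)
  \<comment> \<open>\<open>exp (r / 2)\<close> is \<open>sqrt x\<close> on the logarithmic
    axis.\<close>
  have ex: "exp ((Complex \<sigma> \<tau> - 1) * of_real r) * of_real (exp (r / 2)) = exp (Complex (\<sigma> - 1/2) \<tau> * of_real r)" for \<tau> r
    by (simp add: exp_of_real[symmetric] w algebra_simps flip: exp_add)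
  have pre: "Htilde_pre \<omega> f (exp r) = S r" for r
  proof -
    have sq: "sqrt (exp r) = exp (r / 2)" by (rule real_sqrt_unique) (auto simp: power2_eq_square simp flip: exp_add)
    have "Htilde_pre \<omega> f (exp r) = of_real (exp (r / 2)) * ((1 / (2 * pi)) * (LBINT \<tau>. F (Complex \<sigma> \<tau>) * kernel_hat (h1_log \<omega>) (Complex \<sigma> \<tau>) * exp ((Complex \<sigma> \<tau> - 1) * of_real r)))"
      unfolding Htilde_pre_def sq int_op_h_exp(2)[OF f]
      by (subst kernel_representation[OF h1_log_measurable[OF \<omega>] \<sigma>(2) k1i]) (rule refl)
    also have "\<dots> = (LBINT \<tau>. of_real (exp (r / 2)) * ((1 / (2 * pi)) * (F (Complex \<sigma> \<tau>) * kernel_hat (h1_log \<omega>) (Complex \<sigma> \<tau>) * exp ((Complex \<sigma> \<tau> - 1) * of_real r))))"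
      by (simp only: integral_mult_right_zero)
    also have "\<dots> = S r" unfolding S_def
    proof (intro Bochner_Integration.integral_cong refl)
      fix \<tau>
      have "kernel_hat (h1_log \<omega>) (Complex \<sigma> \<tau>) = ?K (Complex \<sigma> \<tau>) / Complex (\<sigma> - 1/2) \<tau>"
        unfolding w using \<sigma> by (intro kernel_hat_h1 \<omega>) auto
      thus "of_real (exp (r / 2)) * ((1 / (2 * pi)) * (F (Complex \<sigma> \<tau>) * kernel_hat (h1_log \<omega>) (Complex \<sigma> \<tau>) * exp ((Complex \<sigma> \<tau> - 1) * of_real r)))
         = Q \<tau> / Complex (\<sigma> - 1/2) \<tau> * exp (Complex (\<sigma> - 1/2) \<tau> * of_real r)"
        unfolding ex[symmetric] Q_def by (simp add: mult_ac)
    qed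
    finally show ?thesis .
  qed
  define D where "D = (\<lambda>r. \<integral>\<tau>. Q \<tau> * exp (Complex (\<sigma> - 1/2) \<tau> * of_real r) \<partial>lborel)"
  have dS: "(S has_vector_derivative D r) (at r)" for r
    unfolding S_def D_def by (rule has_vector_derivative_fourier_primitive[OF Q \<sigma>(3)])
  have D: "D r = of_real (exp (r / 2)) * int_op (h_fun \<omega>) f (exp r)" for r
  proof -
    have "of_real (exp (r / 2)) * int_op (h_fun \<omega>) f (exp r) = of_real (exp (r / 2)) * ((1 / (2 * pi)) * (LBINT \<tau>. F (Complex \<sigma> \<tau>) * ?K (Complex \<sigma> \<tau>) * exp ((Complex \<sigma> \<tau> - 1) * of_real r)))"
      unfolding int_op_h_exp(1)[OF f]
      by (subst kernel_representation[OF h_log_measurable[OF \<omega>] \<sigma>(2) ki]) (rule refl)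
    also have "\<dots> = (LBINT \<tau>. of_real (exp (r / 2)) * ((1 / (2 * pi)) * (F (Complex \<sigma> \<tau>) * ?K (Complex \<sigma> \<tau>) * exp ((Complex \<sigma> \<tau> - 1) * of_real r))))"
      by (simp only: integral_mult_right_zero)
    also have "\<dots> = D r" unfolding D_def
      unfolding ex[symmetric] Q_def by (intro Bochner_Integration.integral_cong refl) (simp add: mult_ac)
    finally show ?thesis ..
  qed
  have "(ln has_vector_derivative 1 / x) (at x)"
    using x by (auto intro!: derivative_eq_intros simp flip: has_real_derivative_iff_has_vector_derivative)
  from vector_diff_chain_at[OF this dS]
  have "((\<lambda>y. S (ln y)) has_vector_derivative (1 / x) *\<^sub>R D (ln x)) (at x)" by (simp add: o_def)
  hence d: "(Htilde_pre \<omega> f has_vector_derivative (1 / x) *\<^sub>R D (ln x)) (at x)"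
  proof (rule has_vector_derivative_transform_within_open[of _ _ _ "{0<..}"])
    show "S (ln y) = Htilde_pre \<omega> f y" if "y \<in> {0<..}" for y using pre[of "ln y"] that by simp
  qed (use x in auto)
  thus "Htilde_pre \<omega> f differentiable (at x)" by (auto simp: differentiableI_vector)
  have "Htilde \<omega> f x = of_real (sqrt x) * ((1 / x) *\<^sub>R D (ln x))"
    unfolding Htilde_def vderiv_def vector_derivative_at[OF d] ..
  also have "\<dots> = of_real (sqrt x * exp (ln x / 2) / x) * int_op (h_fun \<omega>) f x"
    unfolding D using x by (simp add: scaleR_conv_of_real)
  \<comment> \<open>Both square roots together compensate the 1 / x from differentiating ln
    x.\<close>
  also have "exp (ln x / 2) = sqrt x"
    using x by (intro real_sqrt_unique[symmetric]) (auto simp: power2_eq_square simp flip: exp_add)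
  finally show "Htilde \<omega> f x = int_op (h_fun \<omega>) f x" using x by simp
qed

text \<open>Linearity of the integral requires each summand to be integrable:
  \<open>exp (\<sigma> * t) * f (exp t)\<close> is bounded by compact support, and the complementary
  weight with \<sigma> = \<omega> + 2 makes the kernel integrable.\<close>

lemma int_op_h_linear:
  assumes f: "test_fun f" and g: "test_fun g" and x: "x > 0"
  shows "int_op (h_fun \<omega>) (\<lambda>y. a * f y + b * g y) x = a * int_op (h_fun \<omega>) f x + b * int_op (h_fun \<omega>) g x"
proof -
  have i: "integrable posline (\<lambda>y. complex_of_real (h_fun \<omega> (x * y)) * f y)" if f: "test_fun f" for f
  proof -
    obtain a' a'' A B where "compact_C2 (\<lambda>t. f (exp t)) a' a'' A B" using test_fun_compact_C2[OF f] by blast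
    then interpret compact_C2 "\<lambda>t. f (exp t)" a' a'' A B .
    note [measurable] = h_fun_measurable test_fun_measurable[OF f]
    define \<sigma> where "\<sigma> = \<omega> + 2"
    have "integrable lborel (\<lambda>t. h_fun \<omega> (exp t) * exp ((1 - \<sigma>) * t))"
      using h_log_laplace[OF \<omega>, of \<sigma>] by (simp add: has_bochner_integral_iff \<sigma>_def)
    from lborel_integrable_real_affine[OF this, of 1 "ln x"]
    have k: "integrable lborel (\<lambda>t. h_fun \<omega> (exp (ln x + t)) * exp ((1 - \<sigma>) * (ln x + t)))" by simp
    obtain M where M: "\<And>t. norm (f (exp t) * of_real (exp (\<sigma> * t))) \<le> M" using exp_weighted_bounded by blast
    have "integrable lborel (\<lambda>t. exp t *\<^sub>R (complex_of_real (h_fun \<omega> (x * exp t)) * f (exp t)))"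
    proof (rule Bochner_Integration.integrable_bound[OF integrable_mult_right[OF k, of "M * exp (- (1 - \<sigma>) * ln x)"]])
      show "AE t in lborel. norm (exp t *\<^sub>R (complex_of_real (h_fun \<omega> (x * exp t)) * f (exp t)))
         \<le> norm (M * exp (- (1 - \<sigma>) * ln x) * (h_fun \<omega> (exp (ln x + t)) * exp ((1 - \<sigma>) * (ln x + t))))"
      proof (rule AE_I2)
        fix t
        have M0: "M \<ge> 0" by (rule order_trans[OF norm_ge_zero M])
        have e: "exp (- (1 - \<sigma>) * ln x) * exp ((1 - \<sigma>) * (ln x + t)) * exp (\<sigma> * t) = exp t"
          by (simp add: algebra_simps flip: exp_add)
        have xe: "x * exp t = exp (ln x + t)" using x by (simp add: exp_add)
        have "norm (exp t *\<^sub>R (complex_of_real (h_fun \<omega> (x * exp t)) * f (exp t)))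
            = \<bar>h_fun \<omega> (exp (ln x + t))\<bar> * norm (f (exp t)) * exp t"
          unfolding xe by (simp add: norm_mult mult_ac)
        also have "\<dots> = \<bar>h_fun \<omega> (exp (ln x + t))\<bar> * norm (f (exp t)) * (exp (- (1 - \<sigma>) * ln x) * exp ((1 - \<sigma>) * (ln x + t)) * exp (\<sigma> * t))"
          by (simp only: e)
        also have "\<dots> = \<bar>h_fun \<omega> (exp (ln x + t))\<bar> * (exp (- (1 - \<sigma>) * ln x) * exp ((1 - \<sigma>) * (ln x + t))) * norm (f (exp t) * of_real (exp (\<sigma> * t)))"
          by (simp add: norm_mult mult_ac)
        also have "\<dots> \<le> \<bar>h_fun \<omega> (exp (ln x + t))\<bar> * (exp (- (1 - \<sigma>) * ln x) * exp ((1 - \<sigma>) * (ln x + t))) * M"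
          by (intro mult_left_mono M) auto
        finally show "norm (exp t *\<^sub>R (complex_of_real (h_fun \<omega> (x * exp t)) * f (exp t)))
         \<le> norm (M * exp (- (1 - \<sigma>) * ln x) * (h_fun \<omega> (exp (ln x + t)) * exp ((1 - \<sigma>) * (ln x + t))))"
          using M0 by (simp add: abs_mult mult_ac)
      qed
    qed measurable
    thus ?thesis by (subst integrable_posline_iff) auto
  qed
  have "int_op (h_fun \<omega>) (\<lambda>y. a * f y + b * g y) x
      = (\<integral>y. a * (complex_of_real (h_fun \<omega> (x * y)) * f y) + b * (complex_of_real (h_fun \<omega> (x * y)) * g y) \<partial>posline)"
    unfolding int_op_def by (intro Bochner_Integration.integral_cong refl) (simp add: algebra_simps)
  also have "\<dots> = (\<integral>y. a * (complex_of_real (h_fun \<omega> (x * y)) * f y) \<partial>posline) + (\<integral>y. b * (complex_of_real (h_fun \<omega> (x * y)) * g y) \<partial>posline)"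
    by (intro Bochner_Integration.integral_add integrable_mult_right i f g)
  finally show ?thesis unfolding int_op_def by simp
qed

end

section \<open>Density of test functions\<close>

lemma vderiv_Suc: "(vderiv ^^ Suc n) f x = vector_derivative ((vderiv ^^ n) f) (at x)"
  by (simp add: vderiv_def[of "(vderiv ^^ n) f" x])

lemma vderiv_linear:
  assumes f: "\<And>n x. x > 0 \<Longrightarrow> (vderiv ^^ n) f differentiable (at x)"
    and g: "\<And>n x. x > 0 \<Longrightarrow> (vderiv ^^ n) g differentiable (at x)" and x: "x > 0"
  shows "(vderiv ^^ n) (\<lambda>x. a * f x + b * g x) x = a * (vderiv ^^ n) f x + b * (vderiv ^^ n) g x"
  using x
proof (induction n arbitrary: x)
  case (Suc n)
  let ?F = "(vderiv ^^ n) (\<lambda>x. a * f x + b * g x)"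
  have "((\<lambda>x. a * (vderiv ^^ n) f x + b * (vderiv ^^ n) g x) has_vector_derivative
      (a * (vderiv ^^ Suc n) f x + b * (vderiv ^^ Suc n) g x)) (at x)"
    using f[OF Suc.prems, of n] g[OF Suc.prems, of n] unfolding vector_derivative_works vderiv_Suc
    by (intro has_vector_derivative_add has_vector_derivative_mult_right)
  \<comment> \<open>The induction hypothesis holds only for positive arguments, but that is an open
    set, so derivatives can be transferred.\<close>
  hence "(?F has_vector_derivative (a * (vderiv ^^ Suc n) f x + b * (vderiv ^^ Suc n) g x)) (at x)"
    by (rule has_vector_derivative_transform_within_open[of _ _ _ "{0<..}"]) (use Suc in auto)
  from vector_derivative_at[OF this] show ?case unfolding vderiv_Suc[of n "\<lambda>x. a * f x + b * g x"] .
qed simp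

lemma test_fun_linear:
  assumes f: "test_fun f" and g: "test_fun g"
  shows "test_fun (\<lambda>x. a * f x + b * g x)"
proof -
  obtain p q where pq: "0 < p" "p \<le> q" "\<And>x. x \<notin> {p..q} \<Longrightarrow> f x = 0"
    and df: "\<And>n x. x > 0 \<Longrightarrow> (vderiv ^^ n) f differentiable (at x)"
    using f unfolding test_fun_def by blast
  obtain r s where rs: "0 < r" "r \<le> s" "\<And>x. x \<notin> {r..s} \<Longrightarrow> g x = 0"
    and dg: "\<And>n x. x > 0 \<Longrightarrow> (vderiv ^^ n) g differentiable (at x)"
    using g unfolding test_fun_def by blast
  have supp: "\<exists>u v. 0 < u \<and> u \<le> v \<and> (\<forall>x. x \<notin> {u..v} \<longrightarrow> a * f x + b * g x = 0)"
  proof (intro exI conjI allI impI)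
    show "0 < min p r" "min p r \<le> max q s" using pq rs by auto
    fix x assume "x \<notin> {min p r..max q s}"
    hence "x \<notin> {p..q}" "x \<notin> {r..s}" by auto
    thus "a * f x + b * g x = 0" using pq(3) rs(3) by simp
  qed
  have "(vderiv ^^ n) (\<lambda>x. a * f x + b * g x) differentiable (at x)" if x: "x > 0" for n x
  proof -
    have "((\<lambda>x. a * (vderiv ^^ n) f x + b * (vderiv ^^ n) g x) has_vector_derivative
        (a * vector_derivative ((vderiv ^^ n) f) (at x) + b * vector_derivative ((vderiv ^^ n) g) (at x))) (at x)"
      using df[OF x, of n] dg[OF x, of n] unfolding vector_derivative_works
      by (auto intro!: has_vector_derivative_add has_vector_derivative_mult_right)
    hence "((vderiv ^^ n) (\<lambda>x. a * f x + b * g x) has_vector_derivative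
        (a * vector_derivative ((vderiv ^^ n) f) (at x) + b * vector_derivative ((vderiv ^^ n) g) (at x))) (at x)"
      by (rule has_vector_derivative_transform_within_open[of _ _ _ "{0<..}"])
         (use x vderiv_linear[OF df dg] in auto)
    thus ?thesis by (rule differentiableI_vector)
  qed
  with supp show ?thesis unfolding test_fun_def by blast
qed

lemma test_fun_zero: "test_fun (\<lambda>x. 0)"
proof -
  have "vderiv (\<lambda>x. 0) = (\<lambda>x. 0)"
    by (simp add: vderiv_def fun_eq_iff vector_derivative_at[OF has_vector_derivative_const])
  hence "(vderiv ^^ n) (\<lambda>x. 0) = (\<lambda>x. 0)" for n
    by (induction n) simp_all
  thus ?thesis unfolding test_fun_def by (auto intro!: exI[of _ "1::real"])
qed

text \<open>The derivatives of \<open>exp (- \<epsilon> / ((x - a) * (b - x)))\<close> all lie in the following family.\<close>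

definition bump :: "real \<Rightarrow> real \<Rightarrow> real \<Rightarrow> nat \<Rightarrow> real poly \<Rightarrow> real \<Rightarrow> real" where
  "bump \<epsilon> a b k p x = (if a < x \<and> x < b
     then poly p x / ((x - a) * (b - x)) ^ k * exp (- \<epsilon> / ((x - a) * (b - x))) else 0)"

text \<open>For the two endpoints of a bump: a quadratic bound forces both the value and the
  derivative at x to be 0.\<close>

lemma has_real_derivative_zeroI:
  fixes f :: "real \<Rightarrow> real"
  assumes "\<And>y. \<bar>f y\<bar> \<le> C * \<bar>y - x\<bar>\<^sup>2"
  shows "(f has_real_derivative 0) (at x)"
proof -
  have fx: "f x = 0" using assms[of x] by simp
  have "((\<lambda>h. f (x + h) / h) \<longlongrightarrow> 0) (at 0)"
  proof (rule Lim_null_comparison)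
    show "\<forall>\<^sub>F h in at 0. norm (f (x + h) / h) \<le> C * \<bar>h\<bar>"
      unfolding eventually_at_filter
    proof (intro always_eventually allI impI)
      fix h :: real assume h: "h \<noteq> 0"
      have "\<bar>f (x + h)\<bar> \<le> C * \<bar>h\<bar> * \<bar>h\<bar>" using assms[of "x + h"] by (simp add: power2_eq_square mult_ac)
      thus "norm (f (x + h) / h) \<le> C * \<bar>h\<bar>" using h by (simp add: pos_divide_le_eq)
    qed
    show "((\<lambda>h. C * \<bar>h\<bar>) \<longlongrightarrow> 0) (at (0::real))" by (auto intro!: tendsto_eq_intros)
  qed
  thus ?thesis unfolding DERIV_def by (simp add: fx)
qed

text \<open>With r = (y - a) * (b - y), the exponential outweighs \<open>(1 / r) ^ (k + 2)\<close>.
  The two powers beyond k leave a factor \<open>r\<^sup>2\<close>, and r is at most b - a times the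
  distance to either endpoint.\<close>

lemma bump_le:
  assumes \<epsilon>: "\<epsilon> > 0" and ab: "a < b"
  shows "\<exists>C. \<forall>y. \<bar>bump \<epsilon> a b k p y\<bar> \<le> C * \<bar>y - a\<bar>\<^sup>2 \<and> \<bar>bump \<epsilon> a b k p y\<bar> \<le> C * \<bar>y - b\<bar>\<^sup>2"
proof -
  obtain C where C: "\<And>t. t \<ge> 0 \<Longrightarrow> t ^ (k + 2) \<le> C * exp (\<epsilon> * t)" using exp_ge_power_div[OF \<epsilon>, of "k + 2"] by blast
  have "compact (poly p ` {a..b})" by (intro compact_continuous_image continuous_intros) auto
  then obtain M where M: "\<And>x. x \<in> {a..b} \<Longrightarrow> \<bar>poly p x\<bar> \<le> M"
    by (metis compact_imp_bounded bounded_iff imageI real_norm_def)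
  have M0: "M \<ge> 0" using order_trans[OF abs_ge_zero M[of a]] ab by simp
  have C0: "C \<ge> 0" using C[of 0] by simp
  show ?thesis
  proof (intro exI[of _ "M * C * (b - a)\<^sup>2"] allI)
    fix y
    let ?D = "M * C * (b - a)\<^sup>2"
    have D0: "?D \<ge> 0" using M0 C0 by simp
    show "\<bar>bump \<epsilon> a b k p y\<bar> \<le> ?D * \<bar>y - a\<bar>\<^sup>2 \<and> \<bar>bump \<epsilon> a b k p y\<bar> \<le> ?D * \<bar>y - b\<bar>\<^sup>2"
    proof (cases "a < y \<and> y < b")
      case True
      define r where "r = (y - a) * (b - y)"
      have r: "r > 0" using True by (simp add: r_def)
      have "(1 / r) ^ (k + 2) \<le> C * exp (\<epsilon> * (1 / r))" using r by (intro C) simp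
      hence "(1 / r) ^ k * (1 / r)\<^sup>2 \<le> C * exp (\<epsilon> / r)"
        by (simp only: power_add times_divide_eq_right mult_1_right)
      hence "(1 / r) ^ k * (1 / r)\<^sup>2 * (r\<^sup>2 * exp (- (\<epsilon> / r))) \<le> C * exp (\<epsilon> / r) * (r\<^sup>2 * exp (- (\<epsilon> / r)))"
        by (rule mult_right_mono) simp
      moreover have "(1 / r) ^ k * (1 / r)\<^sup>2 * (r\<^sup>2 * exp (- (\<epsilon> / r))) = (1 / r) ^ k * exp (- (\<epsilon> / r))"
        using r by (simp add: power2_eq_square)
      moreover have "C * exp (\<epsilon> / r) * (r\<^sup>2 * exp (- (\<epsilon> / r))) = C * r\<^sup>2"
        by (simp add: exp_minus)
      ultimately have "(1 / r) ^ k * exp (- (\<epsilon> / r)) \<le> C * r\<^sup>2" by simp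
      hence "\<bar>poly p y\<bar> * ((1 / r) ^ k * exp (- (\<epsilon> / r))) \<le> M * (C * r\<^sup>2)"
        by (rule mult_mono[rotated]) (use M[of y] True M0 r in auto)
      moreover have "\<bar>bump \<epsilon> a b k p y\<bar> = \<bar>poly p y\<bar> * ((1 / r) ^ k * exp (- (\<epsilon> / r)))"
        using True r by (simp add: bump_def r_def[symmetric] abs_mult power_divide)
      ultimately have le: "\<bar>bump \<epsilon> a b k p y\<bar> \<le> M * C * r\<^sup>2" by (simp add: mult_ac)
      have ra: "r\<^sup>2 \<le> (b - a)\<^sup>2 * \<bar>y - a\<bar>\<^sup>2" and rb: "r\<^sup>2 \<le> (b - a)\<^sup>2 * \<bar>y - b\<bar>\<^sup>2"
      proof -
        have "r \<le> (b - a) * \<bar>y - a\<bar>" unfolding r_def using True by (subst mult.commute) (intro mult_mono, auto)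
        from power_mono[OF this, of 2] r show "r\<^sup>2 \<le> (b - a)\<^sup>2 * \<bar>y - a\<bar>\<^sup>2" by (simp add: power_mult_distrib)
        have "r \<le> (b - a) * \<bar>y - b\<bar>" unfolding r_def using True by (intro mult_mono) auto
        from power_mono[OF this, of 2] r show "r\<^sup>2 \<le> (b - a)\<^sup>2 * \<bar>y - b\<bar>\<^sup>2" by (simp add: power_mult_distrib)
      qed
      have MC: "0 \<le> M * C" using M0 C0 by simp
      have "M * C * r\<^sup>2 \<le> ?D * \<bar>y - a\<bar>\<^sup>2" "M * C * r\<^sup>2 \<le> ?D * \<bar>y - b\<bar>\<^sup>2"
        unfolding mult.assoc[of "M * C"] by (rule mult_left_mono[OF ra MC], rule mult_left_mono[OF rb MC])
      with le show ?thesis by (blast intro: order_trans)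
    qed (use D0 in \<open>auto simp: bump_def\<close>)
  qed
qed

lemma bump_derivative:
  assumes \<epsilon>: "\<epsilon> > 0" and ab: "a < b"
  shows "\<exists>k' p'. \<forall>x. (bump \<epsilon> a b k p has_real_derivative bump \<epsilon> a b k' p' x) (at x)"
proof -
  define q :: "real poly" where "q = [:- a, 1:] * [:b, - 1:]"
  define q' :: "real poly" where "q' = pderiv q"
  \<comment> \<open>The numerator left by the product and quotient rules over the common denominator
    of exponent k + 2: the three terms come from differentiating p, the power of q, and the
    exponential.\<close>
  define p' where "p' = pderiv p * q\<^sup>2 - smult (real k) (p * q' * q) + smult \<epsilon> (p * q')"
  have q: "poly q x = (x - a) * (b - x)" for x by (simp add: q_def algebra_simps)
  have "(bump \<epsilon> a b k p has_real_derivative bump \<epsilon> a b (k + 2) p' x) (at x)" for x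
  proof -
    consider "a < x \<and> x < b" | "x = a" | "x = b" | "x < a \<or> b < x" by linarith
    thus ?thesis
    proof cases
      case 1
      define r where "r = poly q x"
      have r: "r > 0" using 1 by (simp add: r_def q)
      have "((\<lambda>x. poly p x / poly q x ^ k * exp (- \<epsilon> / poly q x)) has_real_derivative
         ((poly (pderiv p) x * r ^ k - poly p x * (real k * r ^ (k - 1) * poly q' x)) / (r ^ k * r ^ k)) * exp (- \<epsilon> / r)
          + exp (- \<epsilon> / r) * (\<epsilon> * poly q' x / (r * r)) * (poly p x / r ^ k)) (at x)"
        using r unfolding r_def q'_def by (auto intro!: derivative_eq_intros simp: divide_simps) (simp add: algebra_simps)
      also have "((poly (pderiv p) x * r ^ k - poly p x * (real k * r ^ (k - 1) * poly q' x)) / (r ^ k * r ^ k)) * exp (- \<epsilon> / r)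
          + exp (- \<epsilon> / r) * (\<epsilon> * poly q' x / (r * r)) * (poly p x / r ^ k) = poly p' x / r ^ (k + 2) * exp (- \<epsilon> / r)"
      proof -
        \<comment> \<open>The case k = 0 is separate because of the truncated exponent k - 1; the
          factor \<open>real k\<close> removes that term.\<close>
        have e1: "(poly (pderiv p) x * r ^ k - poly p x * (real k * r ^ (k - 1) * poly q' x)) / (r ^ k * r ^ k)
            = (poly (pderiv p) x * r\<^sup>2 - real k * (poly p x * poly q' x * r)) / r ^ (k + 2)"
          using r by (cases k) (simp_all add: divide_simps power2_eq_square power_add algebra_simps)
        have e2: "poly p' x = (poly (pderiv p) x * r\<^sup>2 - real k * (poly p x * poly q' x * r)) + \<epsilon> * (poly p x * poly q' x)"
          by (simp add: p'_def r_def)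
        have e3: "(\<epsilon> * poly q' x / (r * r)) * (poly p x / r ^ k) = \<epsilon> * (poly p x * poly q' x) / r ^ (k + 2)"
          by (simp add: power_add power2_eq_square mult_ac)
        show ?thesis unfolding e1 e2 mult.assoc[of "exp (- \<epsilon> / r)"] e3
          by (simp only: add_divide_distrib distrib_right mult.commute[of "exp (- \<epsilon> / r)"])
      qed
      also have "\<dots> = bump \<epsilon> a b (k + 2) p' x" using 1 by (simp add: bump_def r_def q)
      finally show ?thesis
        by (rule has_field_derivative_transform_within_open[of _ _ _ "{a<..<b}"]) (use 1 in \<open>auto simp: bump_def q\<close>)
    next
      case 2
      obtain C where "\<And>y. \<bar>bump \<epsilon> a b k p y\<bar> \<le> C * \<bar>y - a\<bar>\<^sup>2" using bump_le[OF \<epsilon> ab] by blast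
      from has_real_derivative_zeroI[OF this] have "(bump \<epsilon> a b k p has_real_derivative 0) (at x)" using 2 by simp
      moreover have "bump \<epsilon> a b (k + 2) p' x = 0" using 2 by (simp add: bump_def)
      ultimately show ?thesis by (simp only:)
    next
      case 3
      obtain C where "\<And>y. \<bar>bump \<epsilon> a b k p y\<bar> \<le> C * \<bar>y - b\<bar>\<^sup>2" using bump_le[OF \<epsilon> ab] by blast
      from has_real_derivative_zeroI[OF this] have "(bump \<epsilon> a b k p has_real_derivative 0) (at x)" using 3 by simp
      moreover have "bump \<epsilon> a b (k + 2) p' x = 0" using 3 by (simp add: bump_def)
      ultimately show ?thesis by (simp only:)
    next
      case 4
      have "((\<lambda>_. 0) has_real_derivative 0) (at x)" by simp
      moreover have "open (- {a..b})" by (intro open_Compl) auto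
      ultimately have "(bump \<epsilon> a b k p has_real_derivative 0) (at x)"
        by (rule has_field_derivative_transform_within_open) (use 4 in \<open>auto simp: bump_def\<close>)
      thus ?thesis using 4 by (auto simp: bump_def)
    qed
  qed
  thus ?thesis by blast
qed

lemma test_fun_bump:
  assumes \<epsilon>: "\<epsilon> > 0" and ab: "0 < a" "a < b"
  shows "test_fun (\<lambda>x. of_real (bump \<epsilon> a b k p x))"
proof -
  have "\<exists>k' p'. (vderiv ^^ n) (\<lambda>x. of_real (bump \<epsilon> a b k p x)) = (\<lambda>x. of_real (bump \<epsilon> a b k' p' x))" for n
  proof (induction n)
    case (Suc n)
    then obtain k' p' where e: "(vderiv ^^ n) (\<lambda>x. of_real (bump \<epsilon> a b k p x)) = (\<lambda>x. of_real (bump \<epsilon> a b k' p' x))" by blast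
    obtain k'' p'' where d: "\<And>x. (bump \<epsilon> a b k' p' has_real_derivative bump \<epsilon> a b k'' p'' x) (at x)"
      using bump_derivative[OF \<epsilon> ab(2)] by blast
    have "((\<lambda>x. of_real (bump \<epsilon> a b k' p' x)) has_vector_derivative complex_of_real (bump \<epsilon> a b k'' p'' x)) (at x)" for x
      using d by (intro has_vector_derivative_of_real) (simp add: has_real_derivative_iff_has_vector_derivative)
    hence "vderiv (\<lambda>x. of_real (bump \<epsilon> a b k' p' x)) = (\<lambda>x. of_real (bump \<epsilon> a b k'' p'' x))"
      by (auto simp: vderiv_def fun_eq_iff intro: vector_derivative_at)
    thus ?case using e by auto
  qed auto
  moreover have "(\<lambda>x. complex_of_real (bump \<epsilon> a b k p x)) differentiable (at x)" for k p x
  proof -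
    obtain k'' p'' where d: "\<And>x. (bump \<epsilon> a b k p has_real_derivative bump \<epsilon> a b k'' p'' x) (at x)"
      using bump_derivative[OF \<epsilon> ab(2)] by blast
    have "((\<lambda>x. of_real (bump \<epsilon> a b k p x)) has_vector_derivative complex_of_real (bump \<epsilon> a b k'' p'' x)) (at x)"
      using d by (intro has_vector_derivative_of_real) (simp add: has_real_derivative_iff_has_vector_derivative)
    thus ?thesis by (rule differentiableI_vector)
  qed
  ultimately have "(vderiv ^^ n) (\<lambda>x. of_real (bump \<epsilon> a b k p x)) differentiable (at x)" for n x by metis
  moreover have "\<exists>u v. 0 < u \<and> u \<le> v \<and> (\<forall>x. x \<notin> {u..v} \<longrightarrow> complex_of_real (bump \<epsilon> a b k p x) = 0)"
    using ab by (intro exI[of _ a] exI[of _ b]) (auto simp: bump_def)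
  ultimately show ?thesis unfolding test_fun_def by blast
qed

section \<open>Squared norms and approximation by test functions\<close>

lemma L2pos_measurable: "L2pos g \<Longrightarrow> g \<in> borel_measurable posline"
  and L2pos_integrable: "L2pos g \<Longrightarrow> integrable posline (\<lambda>x. (cmod (g x))\<^sup>2)"
  by (simp_all add: L2pos_def)

lemma norm_add_square_le:
  fixes x y :: complex
  shows "(norm (x + y))\<^sup>2 \<le> 2 * (norm x)\<^sup>2 + 2 * (norm y)\<^sup>2"
proof -
  have "(norm (x + y))\<^sup>2 \<le> (norm x + norm y)\<^sup>2" by (intro power_mono norm_triangle_ineq) auto
  also have "\<dots> \<le> 2 * (norm x)\<^sup>2 + 2 * (norm y)\<^sup>2"
    using sum_squares_bound[of "norm x" "norm y"] by (simp add: power2_sum)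
  finally show ?thesis .
qed

text \<open>The factor 2 keeps all estimates in squared norms, without roots or Minkowski's
  inequality. It is harmless for density; the isometry itself uses the sharper
  \<open>sqnorm_le_weighted\<close>.\<close>

lemma
  assumes g: "L2pos g" and h: "L2pos h"
  shows L2pos_add: "L2pos (\<lambda>x. g x + h x)"
    and sqnorm_add_le: "sqnorm (\<lambda>x. g x + h x) \<le> 2 * sqnorm g + 2 * sqnorm h"
proof -
  note [measurable] = L2pos_measurable[OF g] L2pos_measurable[OF h]
  have i: "integrable posline (\<lambda>x. 2 * (cmod (g x))\<^sup>2 + 2 * (cmod (h x))\<^sup>2)"
    using L2pos_integrable[OF g] L2pos_integrable[OF h] by simp
  have i2: "integrable posline (\<lambda>x. (cmod (g x + h x))\<^sup>2)"
    by (rule Bochner_Integration.integrable_bound[OF i]) (auto intro!: AE_I2 norm_add_square_le)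
  thus "L2pos (\<lambda>x. g x + h x)" by (simp add: L2pos_def)
  have "sqnorm (\<lambda>x. g x + h x) \<le> (\<integral>x. 2 * (cmod (g x))\<^sup>2 + 2 * (cmod (h x))\<^sup>2 \<partial>posline)"
    by (intro integral_mono i i2 norm_add_square_le)
  also have "\<dots> = 2 * sqnorm g + 2 * sqnorm h"
    using L2pos_integrable[OF g] L2pos_integrable[OF h] by simp
  finally show "sqnorm (\<lambda>x. g x + h x) \<le> 2 * sqnorm g + 2 * sqnorm h" .
qed

lemma L2pos_mult: "L2pos g \<Longrightarrow> L2pos (\<lambda>x. c * g x)"
  and sqnorm_mult: "sqnorm (\<lambda>x. c * g x) = (cmod c)\<^sup>2 * sqnorm g"
  by (auto simp: L2pos_def norm_mult power_mult_distrib)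

lemma L2pos_linear: "L2pos g \<Longrightarrow> L2pos h \<Longrightarrow> L2pos (\<lambda>x. a * g x + b * h x)"
  by (intro L2pos_add L2pos_mult)

lemma L2pos_diff: "L2pos g \<Longrightarrow> L2pos h \<Longrightarrow> L2pos (\<lambda>x. g x - h x)"
  using L2pos_linear[of g h 1 "- 1"] by simp

lemma sqnorm_nonneg: "sqnorm g \<ge> 0" by simp

lemma sqnorm_commute: "sqnorm (\<lambda>x. g x - h x) = sqnorm (\<lambda>x. h x - g x)"
  by (simp add: norm_minus_commute)

lemma sqnorm_triangle:
  assumes "L2pos f" "L2pos g" "L2pos h"
  shows "sqnorm (\<lambda>x. f x - h x) \<le> 2 * sqnorm (\<lambda>x. f x - g x) + 2 * sqnorm (\<lambda>x. g x - h x)"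
  using sqnorm_add_le[OF L2pos_diff[OF assms(1,2)] L2pos_diff[OF assms(2,3)]] by simp

definition approximable :: "(real \<Rightarrow> complex) \<Rightarrow> bool" where
  "approximable g \<longleftrightarrow> L2pos g \<and> (\<forall>\<epsilon>>0. \<exists>f. test_fun f \<and> sqnorm (\<lambda>x. g x - f x) < \<epsilon>)"

lemma approximable_limit:
  assumes g: "L2pos g" and a: "\<And>n. approximable (s n)" and lim: "(\<lambda>n. sqnorm (\<lambda>x. g x - s n x)) \<longlonglongrightarrow> 0"
  shows "approximable g"
  unfolding approximable_def
proof (intro conjI allI impI g)
  fix \<epsilon> :: real assume \<epsilon>: "\<epsilon> > 0"
  hence "\<forall>\<^sub>F n in sequentially. sqnorm (\<lambda>x. g x - s n x) < \<epsilon> / 4"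
    using lim by (intro order_tendstoD) auto
  then obtain n where n: "sqnorm (\<lambda>x. g x - s n x) < \<epsilon> / 4"
    using eventually_happens'[OF sequentially_bot] by blast
  obtain f where f: "test_fun f" "sqnorm (\<lambda>x. s n x - f x) < \<epsilon> / 4"
    using a[of n] \<epsilon> unfolding approximable_def by (meson divide_pos_pos zero_less_numeral)
  have "sqnorm (\<lambda>x. g x - f x) \<le> 2 * sqnorm (\<lambda>x. g x - s n x) + 2 * sqnorm (\<lambda>x. s n x - f x)"
    using a[of n] g L2pos_test_fun(1)[OF f(1)] by (intro sqnorm_triangle) (auto simp: approximable_def)
  also have "\<dots> < \<epsilon>" using n f(2) by simp
  finally show "\<exists>f. test_fun f \<and> sqnorm (\<lambda>x. g x - f x) < \<epsilon>" using f by blast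
qed

text \<open>The summand 1 in the tolerance keeps the denominator positive even for a = b = 0 and
  leaves the slack that makes the final inequality strict.\<close>

lemma sqnorm_linear_less:
  assumes L: "L2pos p" "L2pos q" "L2pos r" "L2pos s" and \<epsilon>: "\<epsilon> > 0"
    and pr: "sqnorm (\<lambda>x. p x - r x) < \<epsilon> / (2 * (cmod a)\<^sup>2 + 2 * (cmod b)\<^sup>2 + 1)"
    and qs: "sqnorm (\<lambda>x. q x - s x) < \<epsilon> / (2 * (cmod a)\<^sup>2 + 2 * (cmod b)\<^sup>2 + 1)"
  shows "sqnorm (\<lambda>x. (a * p x + b * q x) - (a * r x + b * s x)) < \<epsilon>"
proof -
  define K where "K = 2 * (cmod a)\<^sup>2 + 2 * (cmod b)\<^sup>2 + 1"
  have K: "K > 0" unfolding K_def by (intro add_nonneg_pos) auto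
  hence \<epsilon>K: "\<epsilon> / K > 0" using \<epsilon> by simp
  have "sqnorm (\<lambda>x. (a * p x + b * q x) - (a * r x + b * s x)) = sqnorm (\<lambda>x. a * (p x - r x) + b * (q x - s x))"
    by (simp add: algebra_simps)
  also have "\<dots> \<le> 2 * sqnorm (\<lambda>x. a * (p x - r x)) + 2 * sqnorm (\<lambda>x. b * (q x - s x))"
    by (intro sqnorm_add_le L2pos_mult L2pos_diff L)
  also have "\<dots> = 2 * (cmod a)\<^sup>2 * sqnorm (\<lambda>x. p x - r x) + 2 * (cmod b)\<^sup>2 * sqnorm (\<lambda>x. q x - s x)"
    unfolding sqnorm_mult by simp
  also have "\<dots> \<le> 2 * (cmod a)\<^sup>2 * (\<epsilon> / K) + 2 * (cmod b)\<^sup>2 * (\<epsilon> / K)"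
    using pr qs unfolding K_def by (intro add_mono mult_left_mono) auto
  also have "\<dots> = (K - 1) * (\<epsilon> / K)"
  proof -
    have "K - 1 = 2 * (cmod a)\<^sup>2 + 2 * (cmod b)\<^sup>2" by (simp add: K_def)
    thus ?thesis by (simp only: distrib_right)
  qed
  also have "\<dots> < K * (\<epsilon> / K)" using \<epsilon>K by (intro mult_strict_right_mono) auto
  also have "\<dots> = \<epsilon>" using K by simp
  finally show ?thesis .
qed

lemma approximable_linear:
  assumes g: "approximable g" and h: "approximable h"
  shows "approximable (\<lambda>x. a * g x + b * h x)"
  unfolding approximable_def
proof (intro conjI allI impI)
  have L: "L2pos g" "L2pos h" using g h by (auto simp: approximable_def)
  thus "L2pos (\<lambda>x. a * g x + b * h x)" by (rule L2pos_linear)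
  fix \<epsilon> :: real assume \<epsilon>: "\<epsilon> > 0"
  let ?e = "\<epsilon> / (2 * (cmod a)\<^sup>2 + 2 * (cmod b)\<^sup>2 + 1)"
  have "?e > 0" using \<epsilon> by (intro divide_pos_pos add_nonneg_pos) auto
  then obtain u v where u: "test_fun u" "sqnorm (\<lambda>x. g x - u x) < ?e" and v: "test_fun v" "sqnorm (\<lambda>x. h x - v x) < ?e"
    using g h unfolding approximable_def by meson
  show "\<exists>f. test_fun f \<and> sqnorm (\<lambda>x. (a * g x + b * h x) - f x) < \<epsilon>"
    using test_fun_linear[OF u(1) v(1)]
      sqnorm_linear_less[OF L L2pos_test_fun(1)[OF u(1)] L2pos_test_fun(1)[OF v(1)] \<epsilon> u(2) v(2)] by blast
qed

lemma approximable_test_fun: "test_fun f \<Longrightarrow> approximable f"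
  unfolding approximable_def by (auto intro!: L2pos_test_fun exI[of _ f])

lemma approximable_sum:
  assumes "finite S" "\<And>i. i \<in> S \<Longrightarrow> approximable (g i)"
  shows "approximable (\<lambda>x. \<Sum>i\<in>S. c i * g i x)"
  using assms
proof (induction S rule: finite_induct)
  case empty
  show ?case using approximable_test_fun[OF test_fun_zero] by simp
next
  case (insert i S)
  have "approximable (\<lambda>x. c i * g i x + 1 * (\<Sum>i\<in>S. c i * g i x))"
    using insert by (intro approximable_linear) auto
  thus ?case using insert by simp
qed

lemma sqnorm_tendsto_zero:
  assumes g [measurable]: "g \<in> borel_measurable posline" and s [measurable]: "\<And>n. s n \<in> borel_measurable posline"
    and w: "integrable posline w"
    and le: "\<And>n x. x > 0 \<Longrightarrow> (cmod (g x - s n x))\<^sup>2 \<le> w x"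
    and lim: "AE x in posline. (\<lambda>n. s n x) \<longlonglongrightarrow> g x"
  shows "(\<lambda>n. sqnorm (\<lambda>x. g x - s n x)) \<longlonglongrightarrow> 0"
proof -
  have "(\<lambda>n. sqnorm (\<lambda>x. g x - s n x)) \<longlonglongrightarrow> (\<integral>x. 0 \<partial>posline)"
  proof (rule integral_dominated_convergence[OF _ _ w])
    show "AE x in posline. (\<lambda>n. (cmod (g x - s n x))\<^sup>2) \<longlonglongrightarrow> 0"
      using lim
    proof eventually_elim
      case (elim x)
      have "(\<lambda>n. (cmod (g x - s n x))\<^sup>2) \<longlonglongrightarrow> (cmod (g x - g x))\<^sup>2" by (intro tendsto_intros elim)
      thus ?case by simp
    qed
    show "AE x in posline. norm ((cmod (g x - s n x))\<^sup>2) \<le> w x" for n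
      using le by (intro AE_I2) simp
  qed measurable
  thus ?thesis by simp
qed

lemma integrable_posline_indicator:
  assumes "S \<in> sets lebesgue" "S \<subseteq> {u..v}"
  shows "integrable posline (\<lambda>x. c * indicator S x :: real)"
proof -
  have f: "emeasure lebesgue ({0<..} \<inter> S) < \<infinity>"
  proof -
    have "emeasure lebesgue ({0<..} \<inter> S) \<le> emeasure lebesgue {u..v}" using assms by (intro emeasure_mono) auto
    also have "\<dots> < \<infinity>" by (simp add: emeasure_lborel_Icc_eq)
    finally show ?thesis .
  qed
  have "integrable lebesgue (\<lambda>x. indicator ({0<..} \<inter> S) x :: real)"
    using f assms by (intro integrable_real_indicator) auto
  hence "integrable lebesgue (\<lambda>x. c * indicator ({0<..} \<inter> S) x :: real)" by simp
  thus ?thesis by (subst integrable_restrict_space) (simp_all add: indicator_inter_arith mult_ac)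
qed

lemma L2pos_indicator:
  assumes S: "S \<in> sets lebesgue" "S \<subseteq> {u..v}"
  shows "L2pos (indicator S)"
proof -
  have "(\<lambda>x. indicator S x :: complex) \<in> borel_measurable lebesgue" using S(1) by simp
  hence "(\<lambda>x. indicator S x :: complex) \<in> borel_measurable posline" by (rule measurable_restrict_space1)
  moreover have "(cmod (indicator S x))\<^sup>2 = 1 * indicator S x" for x by (simp add: indicator_def)
  ultimately show ?thesis unfolding L2pos_def using integrable_posline_indicator[OF S, of 1] by simp
qed

text \<open>With k = 0, p = 1 and \<epsilon> = 1 / (n + 1) the bumps tend to 1 inside the interval
  and are 0 outside; the error is dominated by the indicator itself.\<close>

lemma approximable_interval:
  assumes "0 < u"
  shows "approximable (indicator {u..v})"
proof -
  have L: "L2pos (indicator {u..v})" by (rule L2pos_indicator[of _ u v]) auto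
  show ?thesis
  proof (cases "u < v")
    case True
    let ?s = "\<lambda>n x. of_real (bump (1 / real (Suc n)) u v 0 1 x) :: complex"
    have t: "test_fun (?s n)" for n using assms True by (intro test_fun_bump) auto
    show ?thesis
    proof (rule approximable_limit[OF L approximable_test_fun[OF t]])
      show "(\<lambda>n. sqnorm (\<lambda>x. indicator {u..v} x - ?s n x)) \<longlonglongrightarrow> 0"
      proof (rule sqnorm_tendsto_zero[OF L2pos_measurable[OF L] L2pos_measurable[OF L2pos_test_fun(1)[OF t]] integrable_posline_indicator[of "{u..v}" u v 1]])
        show "(cmod (indicator {u..v} x - ?s n x))\<^sup>2 \<le> 1 * indicator {u..v} x" for n x
        proof (cases "u < x \<and> x < v")
          case True
          let ?e = "exp (- (1 / real (Suc n)) / ((x - u) * (v - x)))"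
          have "0 \<le> (1 / real (Suc n)) / ((x - u) * (v - x))" using True by (intro divide_nonneg_nonneg) auto
          hence e: "0 \<le> ?e" "?e \<le> 1" by auto
          have "indicator {u..v} x - ?s n x = of_real (1 - ?e)" using True by (simp add: bump_def)
          hence "(cmod (indicator {u..v} x - ?s n x))\<^sup>2 = (1 - ?e)\<^sup>2" by (simp only: norm_of_real power2_abs)
          also have "\<dots> \<le> 1" using e by (intro power_le_one) auto
          finally show ?thesis using True by simp
        qed (auto simp: bump_def indicator_def)
        have ae: "AE x in posline. x \<noteq> u \<and> x \<noteq> v"
          using AE_lborel_singleton[of u] AE_lborel_singleton[of v]
          by (subst AE_restrict_space_iff) (auto intro!: AE_completion)
        thus "AE x in posline. (\<lambda>n. ?s n x) \<longlonglongrightarrow> indicator {u..v} x"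
        proof eventually_elim
          case (elim x)
          show ?case
          proof (cases "u < x \<and> x < v")
            case True
            have "(\<lambda>n. exp (- (1 / real (Suc n)) / ((x - u) * (v - x)))) \<longlonglongrightarrow> exp (- 0 / ((x - u) * (v - x)))"
              using True by (intro tendsto_intros LIMSEQ_Suc[OF lim_const_over_n]) auto
            hence "(\<lambda>n. complex_of_real (exp (- (1 / real (Suc n)) / ((x - u) * (v - x))))) \<longlonglongrightarrow> of_real 1"
              by (intro tendsto_of_real) simp
            thus ?thesis using True by (simp add: bump_def)
          next
            case False
            thus ?thesis using elim by (auto simp: bump_def indicator_def)
          qed
        qed
      qed auto
    qed
  next
    case False
    \<comment> \<open>If v \<le> u, the interval contains at most the point u, and the zero function
      approximates.\<close>
    have "AE x in posline. x \<noteq> u"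
      using AE_lborel_singleton[of u] by (subst AE_restrict_space_iff) (auto intro!: AE_completion)
    hence "AE x in posline. (cmod (indicator {u..v} x - 0))\<^sup>2 = 0"
      by eventually_elim (use False in \<open>auto simp: indicator_def\<close>)
    hence "sqnorm (\<lambda>x. indicator {u..v} x - 0) = 0" by (rule integral_eq_zero_AE)
    thus ?thesis unfolding approximable_def using L test_fun_zero by auto
  qed
qed

lemma approximable_cong_AE:
  assumes g: "approximable g" and h: "h \<in> borel_measurable posline" and eq: "AE x in posline. g x = h x"
  shows "approximable h"
proof -
  have L: "L2pos g" using g by (simp add: approximable_def)
  note [measurable] = h L2pos_measurable[OF L]
  have "integrable posline (\<lambda>x. (cmod (g x))\<^sup>2) \<longleftrightarrow> integrable posline (\<lambda>x. (cmod (h x))\<^sup>2)"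
    by (rule integrable_cong_AE) (use eq in \<open>auto elim: eventually_mono\<close>)
  hence Lh: "L2pos h" using L h by (simp add: L2pos_def)
  have sq: "sqnorm (\<lambda>x. h x - f x) = sqnorm (\<lambda>x. g x - f x)" if "test_fun f" for f
  proof -
    note [measurable] = L2pos_measurable[OF L2pos_test_fun(1)[OF that]]
    show ?thesis by (rule integral_cong_AE) (use eq in \<open>auto elim: eventually_mono\<close>)
  qed
  show ?thesis unfolding approximable_def
  proof (intro conjI allI impI Lh)
    fix \<epsilon> :: real assume "\<epsilon> > 0"
    then obtain f where f: "test_fun f" "sqnorm (\<lambda>x. g x - f x) < \<epsilon>"
      using g unfolding approximable_def by blast
    show "\<exists>f. test_fun f \<and> sqnorm (\<lambda>x. h x - f x) < \<epsilon>"
      by (rule exI[of _ f]) (simp only: sq[OF f(1)] f simp_thms)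
  qed
qed

text \<open>Induction over Borel sets from the intersection-stable generator of closed intervals.
  Intersecting with a fixed bounded interval keeps every indicator square integrable, so complements
  and countable disjoint unions remain under control.\<close>

lemma approximable_indicator_borel:
  assumes A: "A \<in> sets borel" and u: "0 < u"
  shows "approximable (indicator (A \<inter> {u..v}))"
proof -
  let ?G = "range (\<lambda>(a, b). {a..b::real})"
  have gen: "sets borel = sigma_sets UNIV ?G"
    by (subst borel_eq_atLeastAtMost) simp
  have st: "Int_stable ?G"
    unfolding Int_stable_def
  proof (intro ballI)
    fix X Y assume "X \<in> ?G" "Y \<in> ?G"
    then obtain a b c d where "X = {a..b}" "Y = {c..d}" by auto
    hence "X \<inter> Y = (\<lambda>(a, b). {a..b}) (max a c, min b d)" by auto
    thus "X \<inter> Y \<in> ?G" by blast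
  qed
  have "A \<in> sigma_sets UNIV ?G" using A gen by simp
  have cl: "?G \<subseteq> Pow UNIV" by simp
  from st cl \<open>A \<in> sigma_sets UNIV ?G\<close> show ?thesis
  proof (induction rule: sigma_sets_induct_disjoint)
    case (basic A)
    then obtain a b where "A = {a..b}" by auto
    hence "A \<inter> {u..v} = {max a u..min b v}" by auto
    thus ?case using approximable_interval[of "max a u" "min b v"] u by simp
  next
    case empty
    show ?case using approximable_test_fun[OF test_fun_zero] by simp
  next
    case (compl A)
    have "approximable (\<lambda>x. 1 * indicator {u..v} x + (- 1) * indicator (A \<inter> {u..v}) x)"
      by (intro approximable_linear approximable_interval u compl)
    moreover have "(\<lambda>x. 1 * indicator {u..v} x + (- 1) * indicator (A \<inter> {u..v}) x) = (indicator ((UNIV - A) \<inter> {u..v}) :: real \<Rightarrow> complex)"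
      by (auto simp: indicator_def fun_eq_iff)
    ultimately show ?case by (simp only:)
  next
    case (union A)
    have Ab: "A i \<in> sets borel" for i using union(2) gen by auto
    let ?s = "\<lambda>n x. (\<Sum>i<n. 1 * indicator (A i \<inter> {u..v}) x) :: complex"
    have seq: "?s n x = indicator ((\<Union>i<n. A i) \<inter> {u..v}) x" for n x
    proof -
      have "(indicator (\<Union>i<n. A i \<inter> {u..v}) x :: complex) = (\<Sum>i<n. indicator (A i \<inter> {u..v}) x)"
        using union(1) by (intro indicator_UN_disjoint) (auto simp: disjoint_family_on_def)
      moreover have "(\<Union>i<n. A i) \<inter> {u..v} = (\<Union>i<n. A i \<inter> {u..v})" by blast
      ultimately show ?thesis by (simp only: mult_1)
    qed
    have L: "L2pos (indicator ((\<Union>i. A i) \<inter> {u..v}))"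
      using Ab by (intro L2pos_indicator[of _ u v]) (auto intro!: sets.countable_UN)
    have ap: "approximable (?s n)" for n using union by (intro approximable_sum) auto
    show ?case
    proof (rule approximable_limit[OF L ap])
      show "(\<lambda>n. sqnorm (\<lambda>x. indicator ((\<Union>i. A i) \<inter> {u..v}) x - ?s n x)) \<longlonglongrightarrow> 0"
      proof (rule sqnorm_tendsto_zero[OF L2pos_measurable[OF L] _ integrable_posline_indicator[of "{u..v}" u v 1]])
        show "?s n \<in> borel_measurable posline" for n using ap[of n] by (intro L2pos_measurable) (simp add: approximable_def)
        show "(cmod (indicator ((\<Union>i. A i) \<inter> {u..v}) x - ?s n x))\<^sup>2 \<le> 1 * indicator {u..v} x" for n x
          unfolding seq by (auto simp: indicator_def)
        show "AE x in posline. (\<lambda>n. ?s n x) \<longlonglongrightarrow> indicator ((\<Union>i. A i) \<inter> {u..v}) x"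
        proof (intro AE_I2 tendsto_eventually)
          fix x
          show "\<forall>\<^sub>F n in sequentially. ?s n x = indicator ((\<Union>i. A i) \<inter> {u..v}) x"
          proof (cases "x \<in> (\<Union>i. A i)")
            case True
            then obtain i where i: "x \<in> A i" by blast
            show ?thesis using eventually_gt_at_top[of i] unfolding seq
              by eventually_elim (use i in \<open>auto simp: indicator_def\<close>)
          next
            case False
            thus ?thesis by (auto simp: seq indicator_def)
          qed
        qed
      qed auto
    qed
  qed
qed

text \<open>\<open>posline\<close> carries the completed measure: a Lebesgue set differs from a
  Borel set by a subset of a null set, which the norm does not see.\<close>

lemma approximable_indicator:
  assumes A: "A \<in> sets lebesgue" and u: "0 < u"
  shows "approximable (indicator (A \<inter> {u..v}))"
proof -
  obtain S N N' where S: "A = S \<union> N" "N \<subseteq> N'" "N' \<in> null_sets lborel" "S \<in> sets lborel"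
    using sets_completionE[OF A] by blast
  have "AE x in lebesgue. x \<notin> N'" using AE_not_in[OF S(3)] by (rule AE_completion)
  hence "AE x in posline. x \<notin> N'" by (subst AE_restrict_space_iff) auto
  hence "AE x in posline. (indicator (S \<inter> {u..v}) x :: complex) = indicator (A \<inter> {u..v}) x"
    by eventually_elim (use S in \<open>auto simp: indicator_def\<close>)
  moreover have "approximable (indicator (S \<inter> {u..v}))" using S u by (intro approximable_indicator_borel) auto
  moreover have "(indicator (A \<inter> {u..v}) :: real \<Rightarrow> complex) \<in> borel_measurable posline"
    using A by (intro L2pos_measurable L2pos_indicator[of _ u v]) auto
  ultimately show ?thesis by (rule_tac approximable_cong_AE)
qed

text \<open>Simple functions bounded by 2 * norm (g x) converge pointwise to g, but their level sets
  may reach 0 or infinity. Cutting off to a growing compact interval brings them within the scope of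
  the indicator lemma.\<close>

lemma L2pos_approximable:
  assumes g: "L2pos g"
  shows "approximable g"
proof -
  note [measurable] = L2pos_measurable[OF g]
  obtain \<phi> where F: "\<forall>i. simple_function posline (\<phi> i)" "\<forall>x\<in>space posline. (\<lambda>i. \<phi> i x) \<longlonglongrightarrow> g x"
    "\<forall>i. \<forall>x\<in>space posline. dist (\<phi> i x) 0 \<le> 2 * dist (g x) 0"
    using borel_measurable_implies_sequence_metric[OF L2pos_measurable[OF g], of 0] by blast
  have \<phi>: "simple_function posline (\<phi> i)" for i using F(1) by blast
  have lim: "(\<lambda>i. \<phi> i x) \<longlonglongrightarrow> g x" and bd: "norm (\<phi> i x) \<le> 2 * norm (g x)" if "x > 0" for i x
    using F(2,3) that by auto
  let ?J = "\<lambda>n::nat. {1 / real (Suc n)..real (Suc n)}"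
  let ?V = "\<lambda>i. \<phi> i ` space posline"
  let ?S = "\<lambda>i y. \<phi> i -` {y} \<inter> space posline"
  define s where "s = (\<lambda>i x. \<Sum>y\<in>?V i. y * indicator (?S i y \<inter> ?J i) x)"
  have fin: "finite (?V i)" for i using \<phi>[of i] by (rule simple_functionD)
  have s_eq: "s i x = (if x \<in> ?J i then \<phi> i x else 0)" if x: "x > 0" for i x
  proof -
    have "s i x = (\<Sum>y\<in>?V i. if y = \<phi> i x then (if x \<in> ?J i then \<phi> i x else 0) else 0)"
      unfolding s_def using x by (intro sum.cong refl) (auto simp: indicator_def)
    also have "\<dots> = (if x \<in> ?J i then \<phi> i x else 0)" using fin x by (simp add: sum.delta)
    finally show ?thesis .
  qed
  have ap: "approximable (s i)" for i
    unfolding s_def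
  proof (intro approximable_sum fin)
    fix y
    have "?S i y \<in> sets posline" using \<phi>[of i] by (rule simple_functionD)
    hence "?S i y \<in> sets lebesgue" by (subst (asm) sets_restrict_space_iff) auto
    thus "approximable (indicator (?S i y \<inter> ?J i))" by (rule approximable_indicator) simp
  qed
  show ?thesis
  proof (rule approximable_limit[OF g ap])
    show "(\<lambda>n. sqnorm (\<lambda>x. g x - s n x)) \<longlonglongrightarrow> 0"
    proof (rule sqnorm_tendsto_zero[OF L2pos_measurable[OF g]])
      show "s n \<in> borel_measurable posline" for n using ap[of n] by (intro L2pos_measurable) (simp add: approximable_def)
      \<comment> \<open>9 is the square of 1 + 2, from g itself and from the bound on the simple
        functions.\<close>
      show "integrable posline (\<lambda>x. 9 * (cmod (g x))\<^sup>2)" using L2pos_integrable[OF g] by simp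
      show "(cmod (g x - s n x))\<^sup>2 \<le> 9 * (cmod (g x))\<^sup>2" if x: "x > 0" for n x
      proof -
        have "cmod (g x - s n x) \<le> cmod (g x) + cmod (s n x)" by (rule norm_triangle_ineq4)
        also have "\<dots> \<le> cmod (g x) + 2 * cmod (g x)" using bd[OF x, of n] by (simp add: s_eq[OF x])
        finally have "(cmod (g x - s n x))\<^sup>2 \<le> (3 * cmod (g x))\<^sup>2" by (intro power_mono) auto
        thus ?thesis by (simp add: power_mult_distrib)
      qed
      show "AE x in posline. (\<lambda>n. s n x) \<longlonglongrightarrow> g x"
      proof (rule AE_I2)
        fix x assume "x \<in> space posline"
        hence x: "x > 0" by simp
        have "\<forall>\<^sub>F n in sequentially. \<phi> n x = s n x"
          using eventually_ge_at_top[of "nat \<lceil>max x (1 / x)\<rceil>"]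
        proof eventually_elim
          case (elim n)
          hence n: "max x (1 / x) \<le> real (Suc n)" by linarith
          hence "1 / x \<le> real (Suc n)" by simp
          hence "1 / real (Suc n) \<le> x" using x by (simp add: field_simps del: of_nat_Suc)
          thus ?case using n x by (simp add: s_eq)
        qed
        with lim[OF x] show "(\<lambda>n. s n x) \<longlonglongrightarrow> g x" by (rule Lim_transform_eventually)
      qed
    qed
  qed
qed

section \<open>Completeness and isometric extension\<close>

text \<open>Young's inequality with a free weight \<eta>. The coefficient of the main term can be
  brought arbitrarily close to 1, as is necessary for an exact equality of norms to survive a
  limit.\<close>

lemma sqnorm_le_weighted:
  assumes u: "L2pos u" and v: "L2pos v" and \<eta>: "\<eta> > 0"
  shows "sqnorm u \<le> (1 + \<eta>) * sqnorm v + (1 + 1 / \<eta>) * sqnorm (\<lambda>x. u x - v x)"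
proof -
  have le: "(cmod (u x))\<^sup>2 \<le> (1 + \<eta>) * (cmod (v x))\<^sup>2 + (1 + 1 / \<eta>) * (cmod (u x - v x))\<^sup>2" for x
  proof -
    let ?p = "cmod (v x)" and ?q = "cmod (u x - v x)"
    have "cmod (u x) \<le> ?p + ?q" using norm_triangle_ineq[of "v x" "u x - v x"] by simp
    hence "(cmod (u x))\<^sup>2 \<le> (?p + ?q)\<^sup>2" by (intro power_mono) auto
    also have "\<dots> = ?p\<^sup>2 + 2 * (sqrt \<eta> * ?p) * (?q / sqrt \<eta>) + ?q\<^sup>2" using \<eta> by (simp add: power2_sum)
    also have "2 * (sqrt \<eta> * ?p) * (?q / sqrt \<eta>) \<le> (sqrt \<eta> * ?p)\<^sup>2 + (?q / sqrt \<eta>)\<^sup>2"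
      by (rule sum_squares_bound)
    also have "(sqrt \<eta> * ?p)\<^sup>2 = \<eta> * ?p\<^sup>2" using \<eta> by (simp add: power_mult_distrib)
    also have "(?q / sqrt \<eta>)\<^sup>2 = 1 / \<eta> * ?q\<^sup>2" using \<eta> by (simp add: power_divide)
    finally show ?thesis by (simp add: algebra_simps)
  qed
  have i: "integrable posline (\<lambda>x. (1 + \<eta>) * (cmod (v x))\<^sup>2)" "integrable posline (\<lambda>x. (1 + 1 / \<eta>) * (cmod (u x - v x))\<^sup>2)"
    by (intro integrable_mult_right L2pos_integrable v L2pos_diff u)+
  have "sqnorm u \<le> (\<integral>x. (1 + \<eta>) * (cmod (v x))\<^sup>2 + (1 + 1 / \<eta>) * (cmod (u x - v x))\<^sup>2 \<partial>posline)"
    by (intro integral_mono le L2pos_integrable u Bochner_Integration.integrable_add i)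
  also have "\<dots> = (1 + \<eta>) * sqnorm v + (1 + 1 / \<eta>) * sqnorm (\<lambda>x. u x - v x)"
    using Bochner_Integration.integral_add[OF i] by simp
  finally show ?thesis .
qed

lemma sqnorm_zero_AE:
  assumes g: "L2pos g" and z: "sqnorm g = 0"
  shows "AE x in posline. g x = 0"
proof -
  have "AE x in posline. (cmod (g x))\<^sup>2 = 0"
    using integral_nonneg_eq_0_iff_AE[OF L2pos_integrable[OF g]] z by simp
  thus ?thesis by eventually_elim simp
qed

text \<open>The hypothesis is the outcome of two weighted inequalities in succession. Because of the
  1 / \<eta>, first \<epsilon> tends to 0 with \<eta> fixed, then \<eta> tends to 0.\<close>

lemma nonneg_le_of_perturbation:
  fixes X Y :: real
  assumes "\<And>\<eta> \<epsilon>. \<eta> > 0 \<Longrightarrow> \<epsilon> > 0 \<Longrightarrow> X \<le> (1 + \<eta>) * ((1 + \<eta>) * Y + (1 + 1 / \<eta>) * \<epsilon>) + (1 + 1 / \<eta>) * \<epsilon>"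
  shows "X \<le> Y"
proof -
  have 1: "X \<le> (1 + \<eta>) * ((1 + \<eta>) * Y)" if \<eta>: "\<eta> > 0" for \<eta>
  proof (rule tendsto_lowerbound)
    show "((\<lambda>\<epsilon>. (1 + \<eta>) * ((1 + \<eta>) * Y + (1 + 1 / \<eta>) * \<epsilon>) + (1 + 1 / \<eta>) * \<epsilon>) \<longlongrightarrow> (1 + \<eta>) * ((1 + \<eta>) * Y)) (at_right 0)"
      by (auto intro!: tendsto_eq_intros)
    show "\<forall>\<^sub>F \<epsilon> in at_right 0. X \<le> (1 + \<eta>) * ((1 + \<eta>) * Y + (1 + 1 / \<eta>) * \<epsilon>) + (1 + 1 / \<eta>) * \<epsilon>"
      unfolding eventually_at_right_field using assms[OF \<eta>] by (intro exI[of _ 1]) auto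
  qed auto
  show ?thesis
  proof (rule tendsto_lowerbound)
    show "((\<lambda>\<eta>. (1 + \<eta>) * ((1 + \<eta>) * Y)) \<longlongrightarrow> Y) (at_right 0)" by (auto intro!: tendsto_eq_intros)
    show "\<forall>\<^sub>F \<eta> in at_right 0. X \<le> (1 + \<eta>) * ((1 + \<eta>) * Y)"
      unfolding eventually_at_right_field using 1 by (intro exI[of _ 1]) auto
  qed auto
qed

lemma sqnorm_le_of_close:
  assumes L: "L2pos X" "L2pos Y"
    and close: "\<And>\<epsilon>. \<epsilon> > 0 \<Longrightarrow> \<exists>u v. L2pos u \<and> L2pos v \<and> sqnorm u = sqnorm v \<and>
      sqnorm (\<lambda>x. X x - u x) < \<epsilon> \<and> sqnorm (\<lambda>x. Y x - v x) < \<epsilon>"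
  shows "sqnorm X \<le> sqnorm Y"
proof (rule nonneg_le_of_perturbation)
  fix \<eta> \<epsilon> :: real assume e: "\<eta> > 0" "\<epsilon> > 0"
  obtain u v where uv: "L2pos u" "L2pos v" "sqnorm u = sqnorm v"
    and Xu: "sqnorm (\<lambda>x. X x - u x) < \<epsilon>" and Yv: "sqnorm (\<lambda>x. Y x - v x) < \<epsilon>"
    using close[OF e(2)] by blast
  have 1: "sqnorm X \<le> (1 + \<eta>) * sqnorm v + (1 + 1 / \<eta>) * sqnorm (\<lambda>x. X x - u x)"
    using sqnorm_le_weighted[OF L(1) uv(1) e(1)] uv(3) by simp
  have 2: "sqnorm v \<le> (1 + \<eta>) * sqnorm Y + (1 + 1 / \<eta>) * sqnorm (\<lambda>x. v x - Y x)"
    by (intro sqnorm_le_weighted L uv e)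
  have p: "0 \<le> 1 + \<eta>" "0 \<le> 1 + 1 / \<eta>" using e by (auto simp: add_nonneg_nonneg)
  have "sqnorm v \<le> (1 + \<eta>) * sqnorm Y + (1 + 1 / \<eta>) * \<epsilon>"
    using Yv by (intro order_trans[OF 2] add_left_mono mult_left_mono p) (simp add: sqnorm_commute[of v Y])
  hence "(1 + \<eta>) * sqnorm v + (1 + 1 / \<eta>) * sqnorm (\<lambda>x. X x - u x)
      \<le> (1 + \<eta>) * ((1 + \<eta>) * sqnorm Y + (1 + 1 / \<eta>) * \<epsilon>) + (1 + 1 / \<eta>) * \<epsilon>"
    using Xu by (intro add_mono mult_left_mono p) auto
  with 1 show "sqnorm X \<le> (1 + \<eta>) * ((1 + \<eta>) * sqnorm Y + (1 + 1 / \<eta>) * \<epsilon>) + (1 + 1 / \<eta>) * \<epsilon>"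
    by (rule order_trans)
qed

text \<open>Riesz-Fischer for a geometrically fast Cauchy sequence: the increments decay pointwise
  almost everywhere, the limit exists there, and Fatou's lemma carries the rate over to it.\<close>

lemma L2pos_complete:
  fixes u :: "nat \<Rightarrow> real \<Rightarrow> complex"
  assumes u: "\<And>n. L2pos (u n)" and C: "\<And>m n. n \<le> m \<Longrightarrow> sqnorm (\<lambda>x. u m x - u n x) \<le> C * (1/4) ^ n"
  obtains F where "L2pos F" "\<forall>n. sqnorm (\<lambda>x. F x - u n x) \<le> C * (1/4) ^ n"
proof -
  note um [measurable] = L2pos_measurable[OF u]
  have nn: "(\<integral>\<^sup>+x. ennreal ((cmod (g x))\<^sup>2) \<partial>posline) = ennreal (sqnorm g)" if "L2pos g" for g
    by (rule nn_integral_eq_integral[OF L2pos_integrable[OF that]]) simp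
  have C0: "C \<ge> 0" using order_trans[OF sqnorm_nonneg C[of 0 0]] by simp
  define \<Delta> where "\<Delta> = (\<lambda>n x. u (Suc n) x - u n x)"
  have L\<Delta>: "L2pos (\<Delta> n)" for n unfolding \<Delta>_def by (intro L2pos_diff u)
  note [measurable] = L2pos_measurable[OF L\<Delta>]
  \<comment> \<open>The weight \<open>2 ^ n\<close> spends half of the available rate: the integrals
    still sum like \<open>(1/2) ^ n\<close>, while finiteness at a point forces geometric decay of
    the increments there.\<close>
  have "(\<integral>\<^sup>+x. (\<Sum>n. ennreal (2 ^ n * (cmod (\<Delta> n x))\<^sup>2)) \<partial>posline) = (\<Sum>n. \<integral>\<^sup>+x. ennreal (2 ^ n * (cmod (\<Delta> n x))\<^sup>2) \<partial>posline)"
    by (rule nn_integral_suminf) measurable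
  also have "\<dots> \<le> (\<Sum>n. ennreal (C * (1/2) ^ n))"
  proof (intro suminf_le)
    fix n
    have "(\<integral>\<^sup>+x. ennreal (2 ^ n * (cmod (\<Delta> n x))\<^sup>2) \<partial>posline) = ennreal (2 ^ n) * ennreal (sqnorm (\<Delta> n))"
      unfolding nn[OF L\<Delta>, symmetric] by (subst nn_integral_cmult[symmetric]) (auto simp: ennreal_mult)
    also have "\<dots> = ennreal (2 ^ n * sqnorm (\<Delta> n))" by (simp add: ennreal_mult)
    also have "\<dots> \<le> ennreal (2 ^ n * (C * (1/4) ^ n))"
      using C[of n "Suc n"] unfolding \<Delta>_def by (intro ennreal_leI mult_left_mono) auto
    also have "2 ^ n * (C * (1/4) ^ n) = C * (1/2) ^ n" by (simp add: power_mult_distrib[symmetric])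
    finally show "(\<integral>\<^sup>+x. ennreal (2 ^ n * (cmod (\<Delta> n x))\<^sup>2) \<partial>posline) \<le> ennreal (C * (1/2) ^ n)" .
  qed auto
  also have "\<dots> < \<infinity>"
  proof -
    have "summable (\<lambda>n. C * (1/2) ^ n)" by (intro summable_mult) auto
    hence "(\<Sum>n. ennreal (C * (1/2) ^ n)) = ennreal (\<Sum>n. C * (1/2) ^ n)" using C0 by (intro suminf_ennreal2) auto
    thus ?thesis by simp
  qed
  finally have "(\<integral>\<^sup>+x. (\<Sum>n. ennreal (2 ^ n * (cmod (\<Delta> n x))\<^sup>2)) \<partial>posline) \<noteq> \<infinity>" by simp
  moreover have "(\<lambda>x. \<Sum>n. ennreal (2 ^ n * (cmod (\<Delta> n x))\<^sup>2)) \<in> borel_measurable posline" by measurable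
  ultimately have "AE x in posline. (\<Sum>n. ennreal (2 ^ n * (cmod (\<Delta> n x))\<^sup>2)) \<noteq> \<infinity>"
    by (rule nn_integral_PInf_AE[rotated])
  hence conv: "AE x in posline. convergent (\<lambda>n. u n x)"
  proof eventually_elim
    case (elim x)
    have "0 \<le> 2 ^ n * (cmod (\<Delta> n x))\<^sup>2" for n by simp
    moreover have "(\<Sum>n. ennreal (2 ^ n * (cmod (\<Delta> n x))\<^sup>2)) \<noteq> top" using elim unfolding infinity_ennreal_def .
    ultimately have "summable (\<lambda>n. 2 ^ n * (cmod (\<Delta> n x))\<^sup>2)" by (rule summable_suminf_not_top)
    hence "(\<lambda>n. 2 ^ n * (cmod (\<Delta> n x))\<^sup>2) \<longlonglongrightarrow> 0" by (rule summable_LIMSEQ_zero)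
    hence "\<forall>\<^sub>F n in sequentially. 2 ^ n * (cmod (\<Delta> n x))\<^sup>2 < 1" by (rule order_tendstoD) simp
    \<comment> \<open>Terms of a convergent series are eventually below 1; the root of
      \<open>(1/2) ^ n\<close> is a summable geometric majorant.\<close>
    hence ev: "\<forall>\<^sub>F n in sequentially. norm (\<Delta> n x) \<le> (1 / sqrt 2) ^ n"
    proof eventually_elim
      case (elim n)
      hence "(cmod (\<Delta> n x))\<^sup>2 \<le> (1 / 2) ^ n" by (simp add: power_divide field_simps)
      hence "(cmod (\<Delta> n x))\<^sup>2 \<le> ((1 / sqrt 2) ^ n)\<^sup>2" by (simp add: power_divide power_mult[symmetric] mult.commute real_sqrt_power[symmetric]) (simp add: power_mult)?
      thus ?case by (rule power2_le_imp_le) simp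
    qed
    have "summable (\<lambda>n. (1 / sqrt 2) ^ n :: real)" by (intro summable_geometric) simp
    hence "summable (\<lambda>n. \<Delta> n x)" by (rule summable_comparison_test_ev[OF ev])
    hence "convergent (\<lambda>n. \<Sum>k<n. \<Delta> k x)" by (simp add: summable_iff_convergent)
    moreover have "(\<Sum>k<n. \<Delta> k x) = u n x - u 0 x" for n unfolding \<Delta>_def by (rule sum_lessThan_telescope)
    ultimately have "convergent (\<lambda>n. (u n x - u 0 x) + u 0 x)" by (intro convergent_add convergent_const) simp
    thus ?case by simp
  qed
  define F where "F = (\<lambda>x. lim (\<lambda>n. u n x))"
  have [measurable]: "F \<in> borel_measurable posline" unfolding F_def by (intro borel_measurable_lim_metric um)
  have lim: "AE x in posline. (\<lambda>n. u n x) \<longlonglongrightarrow> F x"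
    using conv by eventually_elim (simp add: F_def convergent_LIMSEQ_iff)
  have fat: "(\<integral>\<^sup>+x. ennreal ((cmod (F x - u n x))\<^sup>2) \<partial>posline) \<le> ennreal (C * (1/4) ^ n)" for n
  proof -
    have "(\<integral>\<^sup>+x. ennreal ((cmod (F x - u n x))\<^sup>2) \<partial>posline) = (\<integral>\<^sup>+x. liminf (\<lambda>m. ennreal ((cmod (u m x - u n x))\<^sup>2)) \<partial>posline)"
    proof (rule nn_integral_cong_AE)
      show "AE x in posline. ennreal ((cmod (F x - u n x))\<^sup>2) = liminf (\<lambda>m. ennreal ((cmod (u m x - u n x))\<^sup>2))"
        using lim
      proof eventually_elim
        case (elim x)
        have "(\<lambda>m. ennreal ((cmod (u m x - u n x))\<^sup>2)) \<longlonglongrightarrow> ennreal ((cmod (F x - u n x))\<^sup>2)"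
          by (intro tendsto_ennrealI tendsto_intros elim)
        from lim_imp_Liminf[OF _ this] show ?case by simp
      qed
    qed
    also have "\<dots> \<le> liminf (\<lambda>m. \<integral>\<^sup>+x. ennreal ((cmod (u m x - u n x))\<^sup>2) \<partial>posline)"
      by (rule nn_integral_liminf) measurable
    also have "\<dots> = liminf (\<lambda>m. ennreal (sqnorm (\<lambda>x. u m x - u n x)))"
      by (simp add: nn L2pos_diff u)
    also have "\<dots> \<le> ennreal (C * (1/4) ^ n)"
    proof (rule Liminf_le)
      show "\<forall>\<^sub>F m in sequentially. ennreal (sqnorm (\<lambda>x. u m x - u n x)) \<le> ennreal (C * (1/4) ^ n)"
        using eventually_ge_at_top[of n] by eventually_elim (intro ennreal_leI C)
    qed simp
    finally show ?thesis .
  qed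
  have D: "L2pos (\<lambda>x. F x - u n x)" for n
    unfolding L2pos_def
  proof
    show "integrable posline (\<lambda>x. (cmod (F x - u n x))\<^sup>2)"
      using fat[of n] by (intro integrableI_bounded) (auto simp: order_le_less_trans)
  qed measurable
  have "L2pos (\<lambda>x. (F x - u 0 x) + u 0 x)" by (intro L2pos_add D u)
  hence LF: "L2pos F" by simp
  show ?thesis
  proof (rule that[OF LF], intro allI)
    show "sqnorm (\<lambda>x. F x - u n x) \<le> C * (1/4) ^ n" for n
      using fat[of n] C0 unfolding nn[OF D] by (subst (asm) ennreal_le_iff) auto
  qed
qed

text \<open>R is the closure of the graph of U on test functions. Isometry, linearity and uniqueness
  are shown for this relation, and only then is a value selected; since functions stand for classes
  modulo null sets, T is linear and extends U only almost everywhere.\<close>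

lemma isometric_extension:
  fixes U :: "(real \<Rightarrow> complex) \<Rightarrow> real \<Rightarrow> complex"
  assumes UL: "\<And>f. test_fun f \<Longrightarrow> L2pos (U f)" and Uiso: "\<And>f. test_fun f \<Longrightarrow> sqnorm (U f) = sqnorm f"
    and Ulin: "\<And>f g a b x. test_fun f \<Longrightarrow> test_fun g \<Longrightarrow> x > 0 \<Longrightarrow> U (\<lambda>y. a * f y + b * g y) x = a * U f x + b * U g x"
  obtains T where "\<forall>g. L2pos g \<longrightarrow> L2pos (T g) \<and> sqnorm (T g) = sqnorm g"
    "\<forall>g k a b. L2pos g \<longrightarrow> L2pos k \<longrightarrow> (AE x in posline. T (\<lambda>y. a * g y + b * k y) x = a * T g x + b * T k x)"
    "\<forall>f. test_fun f \<longrightarrow> (AE x in posline. T f x = U f x)"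
proof -
  define R where "R = (\<lambda>g G. L2pos g \<and> L2pos G \<and> (\<forall>\<epsilon>>0. \<exists>f. test_fun f \<and> sqnorm (\<lambda>x. g x - f x) < \<epsilon> \<and> sqnorm (\<lambda>x. G x - U f x) < \<epsilon>))"
  have R_iso: "sqnorm G = sqnorm g" if rel: "R g G" for g G
  proof (rule antisym)
    have L: "L2pos g" "L2pos G" using rel by (auto simp: R_def)
    have ex: "\<exists>u. test_fun u \<and> sqnorm (\<lambda>x. g x - u x) < \<epsilon> \<and> sqnorm (\<lambda>x. G x - U u x) < \<epsilon>" if "\<epsilon> > 0" for \<epsilon>
      using rel that unfolding R_def by blast
    show "sqnorm G \<le> sqnorm g"
    proof (rule sqnorm_le_of_close[OF L(2,1)])
      fix \<epsilon> :: real assume "\<epsilon> > 0"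
      then obtain u where "test_fun u" "sqnorm (\<lambda>x. g x - u x) < \<epsilon>" "sqnorm (\<lambda>x. G x - U u x) < \<epsilon>"
        using ex by blast
      thus "\<exists>p q. L2pos p \<and> L2pos q \<and> sqnorm p = sqnorm q \<and> sqnorm (\<lambda>x. G x - p x) < \<epsilon> \<and> sqnorm (\<lambda>x. g x - q x) < \<epsilon>"
        by (intro exI[of _ "U u"] exI[of _ u] conjI UL Uiso L2pos_test_fun(1))
    qed
    show "sqnorm g \<le> sqnorm G"
    proof (rule sqnorm_le_of_close[OF L])
      fix \<epsilon> :: real assume "\<epsilon> > 0"
      then obtain u where "test_fun u" "sqnorm (\<lambda>x. g x - u x) < \<epsilon>" "sqnorm (\<lambda>x. G x - U u x) < \<epsilon>"
        using ex by blast
      thus "\<exists>p q. L2pos p \<and> L2pos q \<and> sqnorm p = sqnorm q \<and> sqnorm (\<lambda>x. g x - p x) < \<epsilon> \<and> sqnorm (\<lambda>x. G x - q x) < \<epsilon>"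
        by (intro exI[of _ u] exI[of _ "U u"] conjI UL Uiso[symmetric] L2pos_test_fun(1))
    qed
  qed
  have R_lin: "R (\<lambda>x. a * g x + b * h x) (\<lambda>x. a * G x + b * H x)" if gG: "R g G" and hH: "R h H" for g G h H a b
    unfolding R_def
  proof (intro conjI allI impI)
    have L: "L2pos g" "L2pos G" "L2pos h" "L2pos H" using gG hH by (auto simp: R_def)
    show "L2pos (\<lambda>x. a * g x + b * h x)" "L2pos (\<lambda>x. a * G x + b * H x)" by (intro L2pos_linear L)+
    fix \<epsilon> :: real assume \<epsilon>: "\<epsilon> > 0"
    let ?e = "\<epsilon> / (2 * (cmod a)\<^sup>2 + 2 * (cmod b)\<^sup>2 + 1)"
    have e: "?e > 0" using \<epsilon> by (intro divide_pos_pos add_nonneg_pos) auto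
    obtain u where u: "test_fun u" "sqnorm (\<lambda>x. g x - u x) < ?e" "sqnorm (\<lambda>x. G x - U u x) < ?e"
      using gG e unfolding R_def by blast
    obtain v where v: "test_fun v" "sqnorm (\<lambda>x. h x - v x) < ?e" "sqnorm (\<lambda>x. H x - U v x) < ?e"
      using hH e unfolding R_def by blast
    show "\<exists>f. test_fun f \<and> sqnorm (\<lambda>x. (a * g x + b * h x) - f x) < \<epsilon> \<and> sqnorm (\<lambda>x. (a * G x + b * H x) - U f x) < \<epsilon>"
    proof (intro exI conjI)
      show "test_fun (\<lambda>x. a * u x + b * v x)" by (rule test_fun_linear[OF u(1) v(1)])
      show "sqnorm (\<lambda>x. (a * g x + b * h x) - (a * u x + b * v x)) < \<epsilon>"
        by (intro sqnorm_linear_less L u v L2pos_test_fun(1) \<epsilon>)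
      have "sqnorm (\<lambda>x. (a * G x + b * H x) - U (\<lambda>x. a * u x + b * v x) x) = sqnorm (\<lambda>x. (a * G x + b * H x) - (a * U u x + b * U v x))"
        by (intro Bochner_Integration.integral_cong refl) (simp add: Ulin[OF u(1) v(1)])
      also have "\<dots> < \<epsilon>" by (intro sqnorm_linear_less L u v UL \<epsilon>)
      finally show "sqnorm (\<lambda>x. (a * G x + b * H x) - U (\<lambda>x. a * u x + b * v x) x) < \<epsilon>" .
    qed
  qed
  have R_unique: "AE x in posline. G x = G' x" if "R g G" "R g G'" for g G G'
  proof -
    \<comment> \<open>The difference of two images is related to g - g, so the isometry gives it
      norm 0.\<close>
    have r: "R (\<lambda>x. 1 * g x + (- 1) * g x) (\<lambda>x. 1 * G x + (- 1) * G' x)" by (rule R_lin[OF that])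
    have "sqnorm (\<lambda>x. 1 * G x + (- 1) * G' x) = 0" unfolding R_iso[OF r] by simp
    moreover have "L2pos (\<lambda>x. 1 * G x + (- 1) * G' x)" using r by (simp add: R_def)
    ultimately have "AE x in posline. 1 * G x + (- 1) * G' x = 0" by (intro sqnorm_zero_AE)
    thus ?thesis by eventually_elim simp
  qed
  have R_test: "R f (U f)" if "test_fun f" for f
    unfolding R_def using that UL L2pos_test_fun(1) by (auto intro!: exI[of _ f])
  have R_ex: "\<exists>G. R g G" if g: "L2pos g" for g
  proof -
    have "\<exists>f. test_fun f \<and> sqnorm (\<lambda>x. g x - f x) < (1/4) ^ n" for n :: nat
      using L2pos_approximable[OF g] unfolding approximable_def by simp
    then obtain f where f: "\<And>n. test_fun (f n)" "\<And>n. sqnorm (\<lambda>x. g x - f n x) < (1/4) ^ n" by metis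
    have Lf: "L2pos (f n)" for n by (rule L2pos_test_fun(1)[OF f(1)])
    \<comment> \<open>Differences of images are images of differences, which are again test
      functions, so the images form a Cauchy sequence at the same rate.\<close>
    have sqd: "sqnorm (\<lambda>x. U (f m) x - U (f n) x) = sqnorm (\<lambda>x. f m x - f n x)" for m n
    proof -
      have "sqnorm (\<lambda>x. U (f m) x - U (f n) x) = sqnorm (U (\<lambda>y. 1 * f m y + (- 1) * f n y))"
      proof (intro Bochner_Integration.integral_cong refl)
        fix x assume "x \<in> space posline"
        hence "U (\<lambda>y. 1 * f m y + (- 1) * f n y) x = 1 * U (f m) x + (- 1) * U (f n) x"
          by (intro Ulin f(1)) simp
        thus "(cmod (U (f m) x - U (f n) x))\<^sup>2 = (cmod (U (\<lambda>y. 1 * f m y + (- 1) * f n y) x))\<^sup>2" by simp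
      qed
      also have "\<dots> = sqnorm (\<lambda>y. 1 * f m y + (- 1) * f n y)" by (intro Uiso test_fun_linear f)
      finally show ?thesis by simp
    qed
    \<comment> \<open>Passing through g costs a factor 2 for each of the two approximation
      errors.\<close>
    have "sqnorm (\<lambda>x. U (f m) x - U (f n) x) \<le> 4 * (1/4) ^ n" if "n \<le> m" for m n
    proof -
      have "sqnorm (\<lambda>x. f m x - f n x) \<le> 2 * sqnorm (\<lambda>x. f m x - g x) + 2 * sqnorm (\<lambda>x. g x - f n x)"
        by (intro sqnorm_triangle Lf g)
      also have "\<dots> \<le> 2 * (1/4) ^ m + 2 * (1/4) ^ n"
        using f(2)[of m] f(2)[of n] by (intro add_mono mult_left_mono) (auto simp: sqnorm_commute less_imp_le)
      also have "\<dots> \<le> 2 * (1/4) ^ n + 2 * (1/4) ^ n"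
        using that by (intro add_mono mult_left_mono power_decreasing) auto
      finally show ?thesis unfolding sqd by simp
    qed
    then obtain G where G: "L2pos G" "\<forall>n. sqnorm (\<lambda>x. G x - U (f n) x) \<le> 4 * (1/4) ^ n"
      using L2pos_complete[of "\<lambda>n. U (f n)" 4] UL[OF f(1)] by blast
    have "R g G" unfolding R_def
    proof (intro conjI g G allI impI)
      fix \<epsilon> :: real assume "\<epsilon> > 0"
      moreover have "(\<lambda>n. 4 * (1/4) ^ n :: real) \<longlonglongrightarrow> 4 * 0" by (intro tendsto_intros) simp
      ultimately have "\<forall>\<^sub>F n in sequentially. 4 * (1/4) ^ n < \<epsilon>" by (intro order_tendstoD) auto
      then obtain n where n: "4 * (1/4) ^ n < \<epsilon>" using eventually_happens'[OF sequentially_bot] by blast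
      have "sqnorm (\<lambda>x. g x - f n x) < \<epsilon>"
      proof -
        have "(1/4) ^ n \<le> 4 * (1/4 :: real) ^ n" by simp
        thus ?thesis using f(2)[of n] n by linarith
      qed
      moreover have "sqnorm (\<lambda>x. G x - U (f n) x) < \<epsilon>" using G(2) n by (auto intro: le_less_trans)
      ultimately show "\<exists>f. test_fun f \<and> sqnorm (\<lambda>x. g x - f x) < \<epsilon> \<and> sqnorm (\<lambda>x. G x - U f x) < \<epsilon>"
        using f(1) by blast
    qed
    thus ?thesis by blast
  qed
  define T where "T = (\<lambda>g. SOME G. R g G)"
  have T: "R g (T g)" if "L2pos g" for g unfolding T_def using R_ex[OF that] by (rule someI_ex)
  show ?thesis
  proof (rule that[of T]; intro allI impI)
    show "L2pos (T g) \<and> sqnorm (T g) = sqnorm g" if "L2pos g" for g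
      using T[OF that] R_iso[OF T[OF that]] by (simp add: R_def)
    show "AE x in posline. T (\<lambda>y. a * g y + b * k y) x = a * T g x + b * T k x" if "L2pos g" "L2pos k" for g k a b
      by (rule R_unique[OF T[OF L2pos_linear[OF that]] R_lin[OF T[OF that(1)] T[OF that(2)]]])
    show "AE x in posline. T f x = U f x" if "test_fun f" for f
      by (rule R_unique[OF T[OF L2pos_test_fun(1)[OF that]] R_test[OF that]])
  qed
qed

theorem theoremA2:
  fixes \<omega> :: real
  assumes "0 < \<omega>"
    and "meromorphic_inner (Theta \<omega>)"
  shows "(\<forall>f. test_fun f \<longrightarrow>
            (AE x in posline. Htilde_pre \<omega> f differentiable (at x)) \<and>
            L2pos (Htilde \<omega> f))
     \<and> (\<exists>T :: (real \<Rightarrow> complex) \<Rightarrow> (real \<Rightarrow> complex).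
          (\<forall>g. L2pos g \<longrightarrow> L2pos (T g) \<and> L2norm (T g) = L2norm g) \<and>
          (\<forall>g k a b. L2pos g \<longrightarrow> L2pos k \<longrightarrow>
              (AE x in posline. T (\<lambda>y. a * g y + b * k y) x = a * T g x + b * T k x)) \<and>
          (\<forall>f. test_fun f \<longrightarrow> (AE x in posline. T f x = Htilde \<omega> f x)) \<and>
          (\<forall>f. test_fun f \<longrightarrow> (AE x in posline. T f x = int_op (h_fun \<omega>) f x)))"
proof -
  note iso = int_op_h_isometry[OF assms]
  \<comment> \<open>The equality holds at every point of the half line, so a single extension serves
    both operators.\<close>
  have eq: "AE x in posline. Htilde \<omega> f x = int_op (h_fun \<omega>) f x" if "test_fun f" for f
    using Htilde_eq(2)[OF assms(1) that] by (intro AE_I2) simp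
  have L: "L2pos (Htilde \<omega> f)" if f: "test_fun f" for f
  proof -
    have "L2pos (Htilde \<omega> f) \<longleftrightarrow> L2pos (int_op (h_fun \<omega>) f)"
      unfolding L2pos_def using Htilde_eq(2)[OF assms(1) f]
      by (intro arg_cong2[where f = conj] measurable_cong Bochner_Integration.integrable_cong refl) auto
    thus ?thesis using iso(1)[OF f] by simp
  qed
  obtain T where T: "\<forall>g. L2pos g \<longrightarrow> L2pos (T g) \<and> sqnorm (T g) = sqnorm g"
    "\<forall>g k a b. L2pos g \<longrightarrow> L2pos k \<longrightarrow> (AE x in posline. T (\<lambda>y. a * g y + b * k y) x = a * T g x + b * T k x)"
    "\<forall>f. test_fun f \<longrightarrow> (AE x in posline. T f x = int_op (h_fun \<omega>) f x)"
    using isometric_extension[of "int_op (h_fun \<omega>)", OF iso int_op_h_linear[OF assms(1)]] by blast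
  have T4: "AE x in posline. T f x = Htilde \<omega> f x" if "test_fun f" for f
    using T(3)[rule_format, OF that] eq[OF that] by eventually_elim simp
  have "AE x in posline. Htilde_pre \<omega> f differentiable (at x)" if "test_fun f" for f
    using Htilde_eq(1)[OF assms(1) that] by (intro AE_I2) simp
  thus ?thesis
    using L T T4 by (intro conjI exI[of _ T]) (auto simp: L2norm_def)
qed

end
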